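(* Let $0<p<1$ be fixed. For each $n$ let $m=m(n)\ge2$ and let $V_1,\ldots,V_m$ be a partition of $[n]$ with $|V_i|=n\nu_i$, and suppose that for some $r\ge1$ the parts $V_1,\ldots,V_r$ have size of linear order in $n$ while $|V_{r+1}|,\ldots,|V_m|$ are $o(n)$. Let $G_{n;\nu_1\ldots\nu_m}(p)$ be the random graph obtained from the complete $m$-partite graph with parts $V_1,\ldots,V_m$ by keeping each edge independently with probability $p$. Then almost surely $$\Big(1-\sum_{i=1}^r\nu_i^{3/2}\Big)n^{3/2}\le \mathcal{E}(G_{n;\nu_1\ldots\nu_m}(p))\left(\frac{8}{3\pi}\sqrt{p(1-p)}+o(1)\right)^{-1}\le\Big(1+\sum_{i=1}^r\nu_i^{3/2}\Big)n^{3/2},$$ where $o(1)$ denotes a quantity tending to $0$ as $n\to\infty$.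
   Context: The energy $\mathcal{E}(G)$ of a simple graph $G$ is the sum of the absolute values of the eigenvalues of its adjacency matrix. *)

theory Defs
  imports
    "HOL-Probability.Probability"
    "HOL-Library.Landau_Symbols"
    "Jordan_Normal_Form.Char_Poly"
    "Jordan_Normal_Form.Spectral_Radius"
begin

text \<open>A simple graph on the vertex set \<open>[n] = {1..n}\<close> is given by \<open>n\<close> and its set of edges,
  each edge being a two-element set. Row and column \<open>i\<close> of the matrix (counted from 0) belong to
  the vertex \<open>Suc i\<close>.\<close>

definition adjacency_matrix :: "nat \<Rightarrow> nat set set \<Rightarrow> real Matrix.mat" where
  "adjacency_matrix n E = Matrix.mat n n (\<lambda>(i, j). if {Suc i, Suc j} \<in> E then 1 else 0)"

text \<open>Eigenvalues are counted with their algebraic multiplicity. Since the matrix is real symmetric,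
  its real eigenvalues are all of its eigenvalues.\<close>

definition graph_energy :: "nat \<Rightarrow> nat set set \<Rightarrow> real" where
  "graph_energy n E =
     (\<Sum>x \<in> spectrum (adjacency_matrix n E).
        real (Polynomial.order x (char_poly (adjacency_matrix n E))) * \<bar>x\<bar>)"

definition indexed_partition :: "'v set \<Rightarrow> nat \<Rightarrow> (nat \<Rightarrow> 'v set) \<Rightarrow> bool" where
  "indexed_partition A m V \<longleftrightarrow> partition_on A (V ` {1..m}) \<and> inj_on V {1..m}"

definition complete_multipartite_edges :: "nat \<Rightarrow> (nat \<Rightarrow> 'v set) \<Rightarrow> 'v set set" where
  "complete_multipartite_edges m V =
     {{u, v} | u v i j. i \<in> {1..m} \<and> j \<in> {1..m} \<and> i \<noteq> j \<and> u \<in> V i \<and> v \<in> V j}"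

text \<open>\<open>G\<close> is an edge-set-valued random variable distributed as the random multipartite graph:
  each edge of the complete multipartite graph is kept independently with probability \<open>p\<close>.\<close>

definition random_multipartite_graph ::
    "'a measure \<Rightarrow> nat \<Rightarrow> (nat \<Rightarrow> 'v set) \<Rightarrow> real \<Rightarrow> ('a \<Rightarrow> 'v set set) \<Rightarrow> bool" where
  "random_multipartite_graph M m V p G \<longleftrightarrow>
     (\<forall>\<omega> \<in> space M. G \<omega> \<subseteq> complete_multipartite_edges m V) \<and>
     prob_space.indep_events M (\<lambda>e. {\<omega> \<in> space M. e \<in> G \<omega>}) (complete_multipartite_edges m V) \<and>
     (\<forall>e \<in> complete_multipartite_edges m V. measure M {\<omega> \<in> space M. e \<in> G \<omega>} = p)"

end

theory Submission
  imports Defs "HOL-Real_Asymp.Real_Asymp"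
begin

text \<open>
  The energy of a graph is the trace norm of its adjacency matrix, and adding an edge changes it by
  at most 2. By the bounded differences inequality it stays within \<open>o(n\<^bsup>3/2\<^esup>)\<close> of its expectation outside
  events of summable probability, so by Borel--Cantelli only expectations matter, and these are
  finite sums over edge sets.

  For the complete graph let \<open>W\<close> be the centred adjacency matrix and let \<open>g\<close> be \<open>n\<^bsup>-1/2\<^esup>\<close> times the expected trace of
  \<open>(W - i\<tau>\<surd>n)\<^bsup>-1\<^esup>\<close>. Integration by parts in each edge variable gives \<open>1 + i\<tau>g + p(1-p)g\<^sup>2 = o(1)\<close>, which
  determines \<open>g\<close>, and \<open>\<bar>\<lambda>\<bar> = 2/\<pi> \<integral> \<lambda>\<^sup>2/(\<lambda>\<^sup>2 + t\<^sup>2) dt\<close> over \<open>t > 0\<close> turns this into the expected trace norm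
  \<open>(8/(3\<pi>) \<surd>(p(1-p)) + o(1)) n\<^bsup>3/2\<^esup>\<close>. Adding independent edges inside the parts and using the triangle
  inequality transfers it to the multipartite graph, with the contributions of the parts as error.

  This proves the bounds up to an additive \<open>o(n\<^bsup>3/2\<^esup>)\<close>, which is enough unless one part misses only
  \<open>k = o(n)\<close> vertices. Then the left-hand side is at most \<open>3/2 k \<surd>n\<close>, and it suffices that the energy exceeds
  \<open>4/3 \<surd>(p(1-p)) k \<surd>n\<close>. For \<open>k \<ge> n\<^bsup>1/4\<^esup>\<close> this follows from \<open>\<bar>\<lambda>\<bar> \<ge> (3a\<^sup>2\<lambda>\<^sup>2 - \<lambda>\<^sup>4)/(2a\<^sup>3)\<close> and the second and
  fourth moments of the centred bipartite matrix between the large part and the rest; for smaller \<open>k\<close>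
  that bipartite matrix is, up to scaling, a dual certificate for the trace norm.
\<close>

section \<open>The spectral theorem over a finite index set\<close>

text \<open>The partition changes with n, so the estimates need thresholds depending only on p and
  the tolerance, and tail bounds that are functions of n alone. Centring is cheap: the mean matrix
  is a signed combination of all-ones blocks and has trace norm at most 2n. The resolvent is taken
  on the imaginary axis because there Im g \<ge> 0 keeps g away from the other root of the quadratic
  equation, so a small residual gives a small error at once. A part missing only k vertices needs
  separate care because the bound then lives on the scale k sqrt n, possibly far below n^(3/2).
  Bounded differences over at most k n edges give failure probability exp(-const k), useless for
  bounded k; the dual certificate fails with probability of order k^2 exp(-const n/k^2), useless for
  large k. The split at n^(1/4) makes both summable. The constants fit because 3/2 times 8/(3 pi) is
  4/pi < 4/3, while both lower bounds start from about 2 k sqrt(p(1-p) n) before numerical losses.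
  The o(1) is chosen outcome by outcome, from countably many tolerances 1/(j+1).\<close>

definition orthonormal_system :: "'v set \<Rightarrow> ('v \<Rightarrow> 'v \<Rightarrow> real) \<Rightarrow> bool" where
  "orthonormal_system I u \<longleftrightarrow>
     (\<forall>i\<in>I. \<forall>j\<in>I. (\<Sum>k\<in>I. u i k * u j k) = of_bool (i = j)) \<and>
     (\<forall>k\<in>I. \<forall>l\<in>I. (\<Sum>i\<in>I. u i k * u i l) = of_bool (k = l))"

text \<open>The eigenvector \<open>u i\<close> has coordinates \<open>u i k\<close>. Eigenvectors
  are indexed by the vertices themselves, which avoids an enumeration of \<open>I\<close>; the two
  relations in \<open>orthonormal_system\<close> give Parseval and the inverse change of
  basis.\<close>

definition diagonalises ::
    "'v set \<Rightarrow> ('v \<Rightarrow> 'v \<Rightarrow> real) \<Rightarrow> ('v \<Rightarrow> real) \<Rightarrow> ('v \<Rightarrow> 'v \<Rightarrow> real) \<Rightarrow> bool" where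
  "diagonalises I A lam u \<longleftrightarrow> orthonormal_system I u \<and>
     (\<forall>k\<in>I. \<forall>l\<in>I. A k l = (\<Sum>i\<in>I. lam i * u i k * u i l))"

definition symmetric_on :: "'v set \<Rightarrow> ('v \<Rightarrow> 'v \<Rightarrow> real) \<Rightarrow> bool" where
  "symmetric_on I A \<longleftrightarrow> (\<forall>k\<in>I. \<forall>l\<in>I. A k l = A l k)"

lemma sum_mult_of_bool:
  fixes f :: "'v \<Rightarrow> 'b::semiring_1"
  assumes "finite I" "a \<in> I"
  shows "(\<Sum>k\<in>I. f k * of_bool (k = a)) = f a" "(\<Sum>k\<in>I. f k * of_bool (a = k)) = f a"
    and "(\<Sum>k\<in>I. of_bool (k = a) * f k) = f a" "(\<Sum>k\<in>I. of_bool (a = k) * f k) = f a"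
proof -
  have "f k * of_bool (k = a) = (if k = a then f k else 0)"
    "f k * of_bool (a = k) = (if k = a then f k else 0)"
    "of_bool (k = a) * f k = (if k = a then f k else 0)"
    "of_bool (a = k) * f k = (if k = a then f k else 0)" for k
    by auto
  then show "(\<Sum>k\<in>I. f k * of_bool (k = a)) = f a" "(\<Sum>k\<in>I. f k * of_bool (a = k)) = f a"
    "(\<Sum>k\<in>I. of_bool (k = a) * f k) = f a" "(\<Sum>k\<in>I. of_bool (a = k) * f k) = f a"
    using assms by simp_all
qed

lemma sum_swap3:
  "(\<Sum>k\<in>A. \<Sum>j\<in>B. \<Sum>l\<in>C. f k j l) = (\<Sum>j\<in>B. \<Sum>l\<in>C. \<Sum>k\<in>A. f k j l)"
  by (rule trans[OF sum.swap]) (intro sum.cong refl sum.swap)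

text \<open>Enumerating \<open>I\<close> transports the question to a complex matrix, whose spectrum
  is non-empty; the eigenvector is pulled back along the enumeration.\<close>

lemma exists_complex_eigenvector:
  fixes A :: "'v \<Rightarrow> 'v \<Rightarrow> complex"
  assumes "finite I" "I \<noteq> {}"
  obtains mu x where "\<forall>i\<in>I. (\<Sum>j\<in>I. A i j * x j) = mu * x i" "\<exists>i\<in>I. x i \<noteq> 0"
proof -
  define n where "n = card I"
  obtain h where h: "bij_betw h {0..<n} I"
    using ex_bij_betw_nat_finite[OF assms(1)] n_def by auto
  define B where "B = Matrix.mat n n (\<lambda>(i, j). A (h i) (h j))"
  have B: "B \<in> carrier_mat n n" by (simp add: B_def)
  have "n \<noteq> 0" using assms by (simp add: n_def)
  then obtain mu where "eigenvalue B mu"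
    using spectrum_non_empty[OF B] by (auto simp: spectrum_def)
  then obtain v where v: "v \<in> carrier_vec n" "v \<noteq> 0\<^sub>v n" "B *\<^sub>v v = mu \<cdot>\<^sub>v v"
    using B by (auto simp: eigenvalue_def eigenvector_def)
  define g where "g = the_inv_into {0..<n} h"
  have gh: "g (h i) = i" if "i < n" for i
    using h that unfolding g_def by (auto intro!: the_inv_into_f_f simp: bij_betw_def)
  have hI: "\<exists>k<n. i = h k" if "i \<in> I" for i
    using h that by (auto simp: bij_betw_def)
  define x where "x i = v $ (g i)" for i
  have sumI: "(\<Sum>j\<in>I. f j) = (\<Sum>k\<in>{0..<n}. f (h k))" for f :: "'v \<Rightarrow> complex"
    using sum.reindex_bij_betw[OF h, of f] by simp
  have "(\<Sum>j\<in>I. A i j * x j) = mu * x i" if "i \<in> I" for i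
  proof -
    obtain k where k: "k < n" "i = h k" using hI \<open>i \<in> I\<close> by blast
    have "(B *\<^sub>v v) $ k = mu * v $ k" using v k by simp
    moreover have "(B *\<^sub>v v) $ k = (\<Sum>l\<in>{0..<n}. A (h k) (h l) * v $ l)"
      using k v(1) by (simp add: B_def scalar_prod_def)
    ultimately show ?thesis
      using k by (simp add: sumI x_def gh)
  qed
  moreover have "\<exists>i\<in>I. x i \<noteq> 0"
  proof (rule ccontr)
    assume "\<not> ?thesis"
    then have "\<forall>k<n. v $ k = 0"
      using h gh by (auto simp: x_def bij_betw_def)
    then have "v = 0\<^sub>v n" using v(1) by (intro eq_vecI) auto
    with v show False by simp
  qed
  ultimately show ?thesis using that by blast
qed

text \<open>The Hermitian form at a complex eigenvector is its own conjugate and equals the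
  eigenvalue times the squared norm, so the eigenvalue is real. Real and imaginary part of the
  vector then both satisfy the eigenvalue equation, and one of them is nonzero.\<close>

lemma exists_real_eigenvector:
  assumes fin: "finite I" and ne: "I \<noteq> {}" and sym: "symmetric_on I A"
  obtains mu x where "\<forall>i\<in>I. (\<Sum>j\<in>I. A i j * x j) = mu * x i" "(\<Sum>i\<in>I. (x i)\<^sup>2) = 1"
proof -
  obtain m y where e: "\<forall>i\<in>I. (\<Sum>j\<in>I. complex_of_real (A i j) * y j) = m * y i"
    and y: "\<exists>i\<in>I. y i \<noteq> 0"
    by (rule exists_complex_eigenvector[OF fin ne, of "\<lambda>i j. complex_of_real (A i j)"])
  define S where "S = (\<Sum>i\<in>I. \<Sum>j\<in>I. cnj (y i) * complex_of_real (A i j) * y j)"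
  define T where "T = (\<Sum>i\<in>I. (cmod (y i))\<^sup>2)"
  have "S = (\<Sum>i\<in>I. cnj (y i) * (m * y i))"
    unfolding S_def using e by (intro sum.cong refl) (simp add: mult.assoc flip: sum_distrib_left)
  also have "\<dots> = m * complex_of_real T"
    unfolding T_def of_real_sum sum_distrib_left
    by (intro sum.cong refl) (simp only: complex_norm_square mult_ac)
  finally have S: "S = m * complex_of_real T" .
  have "cnj S = (\<Sum>i\<in>I. \<Sum>j\<in>I. cnj (y j) * complex_of_real (A i j) * y i)"
    by (simp add: S_def mult_ac)
  also have "\<dots> = (\<Sum>j\<in>I. \<Sum>i\<in>I. cnj (y j) * complex_of_real (A i j) * y i)"
    by (rule sum.swap)
  also have "\<dots> = S"
    unfolding S_def using sym by (intro sum.cong) (auto simp: symmetric_on_def)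
  finally have "cnj S = S" .
  have T: "T > 0"
    unfolding T_def using y fin by (auto intro!: sum_pos2)
  have "cnj m = m" using \<open>cnj S = S\<close> S T by simp
  then have m: "m = complex_of_real (Re m)" by (simp add: complex_eq_iff)
  have re: "(\<Sum>j\<in>I. A i j * Re (y j)) = Re m * Re (y i)" if "i \<in> I" for i
  proof -
    have "Re (\<Sum>j\<in>I. complex_of_real (A i j) * y j) = Re (m * y i)" using e that by simp
    then show ?thesis using m by (simp add: complex_eq_iff)
  qed
  have im: "(\<Sum>j\<in>I. A i j * Im (y j)) = Re m * Im (y i)" if "i \<in> I" for i
  proof -
    have "Im (\<Sum>j\<in>I. complex_of_real (A i j) * y j) = Im (m * y i)" using e that by simp
    then show ?thesis using m by (simp add: complex_eq_iff)
  qed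
  obtain w where w: "\<forall>i\<in>I. (\<Sum>j\<in>I. A i j * w j) = Re m * w i" "\<exists>i\<in>I. w i \<noteq> 0"
  proof (cases "\<exists>i\<in>I. Re (y i) \<noteq> 0")
    case True
    then show ?thesis using re that[of "\<lambda>i. Re (y i)"] by auto
  next
    case False
    then have "\<exists>i\<in>I. Im (y i) \<noteq> 0" using y by (auto simp: complex_eq_iff)
    then show ?thesis using im that[of "\<lambda>i. Im (y i)"] by auto
  qed
  define Q where "Q = (\<Sum>i\<in>I. (w i)\<^sup>2)"
  have Q: "Q > 0" unfolding Q_def using w fin by (auto intro!: sum_pos2)
  have "(\<Sum>i\<in>I. (w i / sqrt Q)\<^sup>2) = Q / Q"
    using Q by (simp add: power_divide Q_def flip: sum_divide_distrib)
  moreover have "(\<Sum>j\<in>I. A i j * (w j / sqrt Q)) = Re m * (w i / sqrt Q)" if "i \<in> I" for i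
    using w that by (simp flip: sum_divide_distrib)
  ultimately show ?thesis using Q that[of "\<lambda>i. w i / sqrt Q" "Re m"] by auto
qed

lemma orthonormal_system_mult:
  assumes fin: "finite I" and u: "orthonormal_system I u" and H: "orthonormal_system I H"
  shows "orthonormal_system I (\<lambda>i k. \<Sum>j\<in>I. u i j * H j k)"
proof -
  have a: "(\<Sum>k\<in>I. (\<Sum>j\<in>I. u i j * H j k) * (\<Sum>j\<in>I. u i' j * H j k)) = of_bool (i = i')"
    if "i \<in> I" "i' \<in> I" for i i'
  proof -
    have "(\<Sum>k\<in>I. (\<Sum>j\<in>I. u i j * H j k) * (\<Sum>j\<in>I. u i' j * H j k))
        = (\<Sum>k\<in>I. \<Sum>j\<in>I. \<Sum>l\<in>I. u i j * u i' l * (H j k * H l k))"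
      unfolding sum_product by (intro sum.cong refl) (simp add: mult_ac)
    also have "\<dots> = (\<Sum>j\<in>I. \<Sum>l\<in>I. \<Sum>k\<in>I. u i j * u i' l * (H j k * H l k))"
      by (rule sum_swap3)
    also have "\<dots> = (\<Sum>j\<in>I. \<Sum>l\<in>I. u i j * u i' l * of_bool (j = l))"
      using H by (intro sum.cong refl) (simp add: orthonormal_system_def flip: sum_distrib_left)
    also have "\<dots> = (\<Sum>j\<in>I. u i j * u i' j)"
      using fin by (intro sum.cong refl) (simp add: sum_mult_of_bool)
    also have "\<dots> = of_bool (i = i')" using u that by (simp add: orthonormal_system_def)
    finally show ?thesis .
  qed
  have b: "(\<Sum>i\<in>I. (\<Sum>j\<in>I. u i j * H j k) * (\<Sum>j\<in>I. u i j * H j k')) = of_bool (k = k')"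
    if "k \<in> I" "k' \<in> I" for k k'
  proof -
    have "(\<Sum>i\<in>I. (\<Sum>j\<in>I. u i j * H j k) * (\<Sum>j\<in>I. u i j * H j k'))
        = (\<Sum>i\<in>I. \<Sum>j\<in>I. \<Sum>l\<in>I. H j k * H l k' * (u i j * u i l))"
      unfolding sum_product by (intro sum.cong refl) (simp add: mult_ac)
    also have "\<dots> = (\<Sum>j\<in>I. \<Sum>l\<in>I. \<Sum>i\<in>I. H j k * H l k' * (u i j * u i l))"
      by (rule sum_swap3)
    also have "\<dots> = (\<Sum>j\<in>I. \<Sum>l\<in>I. H j k * H l k' * of_bool (j = l))"
      using u by (intro sum.cong refl) (simp add: orthonormal_system_def flip: sum_distrib_left)
    also have "\<dots> = (\<Sum>j\<in>I. H j k * H j k')"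
      using fin by (intro sum.cong refl) (simp add: sum_mult_of_bool)
    also have "\<dots> = of_bool (k = k')" using H that by (simp add: orthonormal_system_def)
    finally show ?thesis .
  qed
  show ?thesis using a b by (simp add: orthonormal_system_def)
qed

text \<open>The reflection in the hyperplane orthogonal to \<open>x\<close> minus the unit vector at
  \<open>i0\<close> exchanges these two vectors. It degenerates when they coincide, whence the case
  distinction.\<close>

lemma householder:
  assumes fin: "finite I" and i0: "i0 \<in> I" and x: "(\<Sum>i\<in>I. (x i)\<^sup>2) = (1::real)"
  obtains H where "orthonormal_system I H" "symmetric_on I H" "\<forall>i\<in>I. H i0 i = x i"
proof (cases "\<forall>i\<in>I. x i = of_bool (i = i0)")
  case True
  define H :: "'a \<Rightarrow> 'a \<Rightarrow> real" where "H i j = of_bool (i = j)" for i j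
  have sym: "symmetric_on I H" by (auto simp: symmetric_on_def H_def)
  have "(\<Sum>k\<in>I. H i k * H j k) = (\<Sum>k\<in>I. if k = i then of_bool (j = k) else 0)" for i j
    by (intro sum.cong refl) (auto simp: H_def)
  then have "orthonormal_system I H"
    using fin sym by (auto simp: orthonormal_system_def symmetric_on_def)
  with sym show ?thesis using that True by (auto simp: H_def)
next
  case False
  define d :: "'a \<Rightarrow> real" where "d i = of_bool (i = i0)" for i
  define w where "w i = x i - d i" for i
  define q where "q = (\<Sum>i\<in>I. (w i)\<^sup>2)"
  have q0: "q > 0" unfolding q_def using False fin by (auto intro!: sum_pos2 simp: w_def d_def)
  have sd: "(\<Sum>i\<in>I. f i * d i) = f i0" "(\<Sum>i\<in>I. d i * f i) = f i0" for f :: "'a \<Rightarrow> real"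
    using fin i0 by (simp_all add: d_def sum_mult_of_bool)
  have "q = (\<Sum>i\<in>I. (x i)\<^sup>2 - 2 * (x i * d i) + d i * d i)"
    unfolding q_def w_def by (intro sum.cong refl) (simp add: power2_eq_square algebra_simps)
  also have "\<dots> = 1 - 2 * x i0 + 1"
    using x by (simp add: sum.distrib sum_subtractf sd flip: sum_distrib_left)(simp add: d_def)
  finally have q: "q = 2 - 2 * x i0" by simp
  define H where "H i j = of_bool (i = j) - 2 * w i * w j / q" for i j
  have sym: "symmetric_on I H" by (auto simp: symmetric_on_def H_def)
  have "(\<Sum>k\<in>I. H i k * H j k) = of_bool (i = j)" if "i \<in> I" "j \<in> I" for i j
  proof -
    have "(\<Sum>k\<in>I. H i k * H j k) =
       (\<Sum>k\<in>I. (if k = i then of_bool (j = k) else 0) - (if k = i then 2 * w j * w k / q else 0)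
         - (if k = j then 2 * w i * w k / q else 0) + 4 * w i * w j / q\<^sup>2 * (w k)\<^sup>2)"
      using q0 by (intro sum.cong refl) (auto simp: H_def field_simps power2_eq_square)
    also have "\<dots> = of_bool (i = j) - 2 * w j * w i / q - 2 * w i * w j / q + 4 * w i * w j / q\<^sup>2 * q"
      unfolding sum.distrib sum_subtractf sum_distrib_left[symmetric] q_def[symmetric]
      using fin that by auto
    also have "\<dots> = of_bool (i = j)" using q0 by (simp add: field_simps power2_eq_square)
    finally show ?thesis .
  qed
  then have "orthonormal_system I H"
    using sym by (simp add: orthonormal_system_def symmetric_on_def)
  moreover have "H i0 i = x i" if "i \<in> I" for i
  proof -
    have "w i0 = - q / 2" by (simp add: w_def d_def q)
    then have "H i0 i = d i + w i" using q0 by (auto simp: H_def d_def)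
    then show ?thesis by (simp add: w_def)
  qed
  ultimately show ?thesis using that sym by blast
qed

text \<open>Deflation: conjugating by a Householder reflection whose row \<open>i0\<close> is a unit
  eigenvector clears row and column \<open>i0\<close> off the diagonal, and the induction hypothesis
  diagonalises the remaining block.\<close>

theorem spectral_theorem:
  assumes "finite I" "symmetric_on I A"
  shows "\<exists>lam u. diagonalises I A lam u"
  using assms
proof (induction I arbitrary: A rule: finite_induct)
  case empty
  then show ?case by (simp add: diagonalises_def orthonormal_system_def)
next
  case (insert i0 J)
  define I where "I = insert i0 J"
  have fin: "finite I" and i0: "i0 \<in> I" using insert by (auto simp: I_def)
  have sym: "symmetric_on I A" using insert.prems by (simp add: I_def)
  obtain mu x where x: "\<forall>i\<in>I. (\<Sum>j\<in>I. A i j * x j) = mu * x i" "(\<Sum>i\<in>I. (x i)\<^sup>2) = 1"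
    by (rule exists_real_eigenvector[OF fin _ sym]) (use i0 in auto)
  obtain H where H: "orthonormal_system I H" "symmetric_on I H" "\<forall>i\<in>I. H i0 i = x i"
    using householder[OF fin i0 x(2)] by blast
  define B where "B i j = (\<Sum>k\<in>I. \<Sum>l\<in>I. H i k * A k l * H j l)" for i j
  have Bsym: "B i j = B j i" if "i \<in> I" "j \<in> I" for i j
    unfolding B_def using sym that
    by (subst sum.swap) (auto intro!: sum.cong simp: symmetric_on_def mult_ac)
  have B0: "B i i0 = mu * of_bool (i = i0)" if "i \<in> I" for i
  proof -
    have "B i i0 = (\<Sum>k\<in>I. H i k * (\<Sum>l\<in>I. A k l * x l))"
      unfolding B_def using H(3) by (intro sum.cong refl) (simp add: sum_distrib_left mult.assoc)
    also have "\<dots> = (\<Sum>k\<in>I. mu * (H i k * H i0 k))"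
      using x H(3) by (intro sum.cong refl) auto
    also have "\<dots> = mu * of_bool (i = i0)"
      using H(1) that i0 by (simp add: orthonormal_system_def flip: sum_distrib_left)
    finally show ?thesis .
  qed
  have HBH: "A k l = (\<Sum>i\<in>I. \<Sum>j\<in>I. B i j * H i k * H j l)" if "k \<in> I" "l \<in> I" for k l
  proof -
    have "(\<Sum>i\<in>I. \<Sum>j\<in>I. B i j * H i k * H j l)
        = (\<Sum>i\<in>I. \<Sum>j\<in>I. \<Sum>a\<in>I. \<Sum>b\<in>I. A a b * (H i a * H i k) * (H j b * H j l))"
      unfolding B_def sum_distrib_right by (intro sum.cong refl) (simp add: mult_ac)
    also have "\<dots> = (\<Sum>i\<in>I. \<Sum>a\<in>I. \<Sum>b\<in>I. \<Sum>j\<in>I. A a b * (H i a * H i k) * (H j b * H j l))"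
      by (intro sum.cong refl sum_swap3)
    also have "\<dots> = (\<Sum>i\<in>I. \<Sum>a\<in>I. \<Sum>b\<in>I. A a b * (H i a * H i k) * of_bool (b = l))"
      using H(1) that by (intro sum.cong refl) (simp add: orthonormal_system_def flip: sum_distrib_left)
    also have "\<dots> = (\<Sum>i\<in>I. \<Sum>a\<in>I. A a l * (H i a * H i k))"
      using fin that by (intro sum.cong refl) (simp add: sum_mult_of_bool)
    also have "\<dots> = (\<Sum>a\<in>I. \<Sum>i\<in>I. A a l * (H i a * H i k))" by (rule sum.swap)
    also have "\<dots> = (\<Sum>a\<in>I. A a l * of_bool (a = k))"
      using H(1) that by (intro sum.cong refl) (simp add: orthonormal_system_def flip: sum_distrib_left)
    also have "\<dots> = A k l"
      using fin that by (simp add: sum_mult_of_bool)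
    finally show ?thesis by simp
  qed
  have "symmetric_on J B" using Bsym by (auto simp: symmetric_on_def I_def)
  then obtain lam' u' where d': "diagonalises J B lam' u'" using insert.IH by blast
  \<comment> \<open>The eigenvectors of the block on \<open>J\<close> are bordered by the unit
    vector at \<open>i0\<close>, which belongs to the eigenvalue \<open>mu\<close>.\<close>
  define lam where "lam i = (if i = i0 then mu else lam' i)" for i
  define u where "u i k = (if i = i0 \<or> k = i0 then of_bool (i = k) else u' i k)" for i k
  have sumI: "(\<Sum>k\<in>I. f k) = f i0 + (\<Sum>k\<in>J. f k)" for f :: "'a \<Rightarrow> real"
    using insert by (simp add: I_def)
  have J: "i \<noteq> i0" if "i \<in> J" for i using that insert by auto
  have "orthonormal_system I u"
    unfolding orthonormal_system_def
  proof (intro conjI ballI)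
    fix i j assume ij: "i \<in> I" "j \<in> I"
    have "(\<Sum>k\<in>J. u i k * u j k) = (if i = i0 \<or> j = i0 then 0 else of_bool (i = j))"
    proof (cases "i = i0 \<or> j = i0")
      case True
      then show ?thesis using insert.hyps(2) by (auto simp: u_def intro!: sum.neutral)
    next
      case False
      then have "(\<Sum>k\<in>J. u i k * u j k) = (\<Sum>k\<in>J. u' i k * u' j k)"
        using J by (intro sum.cong refl) (auto simp: u_def)
      then show ?thesis using False ij d' by (auto simp: diagonalises_def orthonormal_system_def I_def)
    qed
    then show "(\<Sum>k\<in>I. u i k * u j k) = of_bool (i = j)"
      by (auto simp: sumI u_def)
  next
    fix i j assume ij: "i \<in> I" "j \<in> I"
    have "(\<Sum>k\<in>J. u k i * u k j) = (if i = i0 \<or> j = i0 then 0 else of_bool (i = j))"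
    proof (cases "i = i0 \<or> j = i0")
      case True
      then show ?thesis using insert.hyps(2) by (auto simp: u_def intro!: sum.neutral)
    next
      case False
      then have "(\<Sum>k\<in>J. u k i * u k j) = (\<Sum>k\<in>J. u' k i * u' k j)"
        using J by (intro sum.cong refl) (auto simp: u_def)
      then show ?thesis using False ij d' by (auto simp: diagonalises_def orthonormal_system_def I_def)
    qed
    then show "(\<Sum>k\<in>I. u k i * u k j) = of_bool (i = j)"
      by (auto simp: sumI u_def)
  qed
  moreover have uB: "B k l = (\<Sum>i\<in>I. lam i * u i k * u i l)" if kl: "k \<in> I" "l \<in> I" for k l
  proof -
    have *: "(\<Sum>i\<in>J. lam i * u i k * u i l) = (if k = i0 \<or> l = i0 then 0 else B k l)"
    proof (cases "k = i0 \<or> l = i0")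
      case True
      then show ?thesis using insert.hyps(2) by (auto simp: u_def intro!: sum.neutral)
    next
      case False
      then have "(\<Sum>i\<in>J. lam i * u i k * u i l) = (\<Sum>i\<in>J. lam' i * u' i k * u' i l)"
        using J by (intro sum.cong refl) (auto simp: u_def lam_def)
      then show ?thesis using False kl d' by (auto simp: diagonalises_def I_def)
    qed
    show ?thesis
      using B0[OF kl(1)] B0[OF kl(2)] Bsym[OF kl] * by (auto simp: sumI u_def lam_def)
  qed
  define v where "v i k = (\<Sum>j\<in>I. u i j * H j k)" for i k
  have "orthonormal_system I v"
    unfolding v_def by (rule orthonormal_system_mult[OF fin]) fact+
  moreover have "A k l = (\<Sum>i\<in>I. lam i * v i k * v i l)" if kl: "k \<in> I" "l \<in> I" for k l
  proof -
    have "A k l = (\<Sum>a\<in>I. \<Sum>b\<in>I. \<Sum>i\<in>I. lam i * u i a * u i b * H a k * H b l)"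
      using uB by (simp add: HBH[OF kl] sum_distrib_right)
    also have "\<dots> = (\<Sum>i\<in>I. \<Sum>a\<in>I. \<Sum>b\<in>I. lam i * u i a * u i b * H a k * H b l)"
      by (rule sum_swap3[symmetric])
    also have "\<dots> = (\<Sum>i\<in>I. lam i * (v i k * v i l))"
      unfolding v_def sum_product unfolding sum_distrib_left by (intro sum.cong refl) (simp add: mult_ac)
    finally show ?thesis by (simp add: mult.assoc)
  qed
  ultimately have "diagonalises I A lam v" by (simp add: diagonalises_def)
  then show ?case by (auto simp: I_def)
qed

section \<open>The trace norm\<close>

text \<open>\<open>SOME\<close> fixes one family of eigenvalues; \<open>trace_norm_eq\<close> shows
  that the value does not depend on the choice.\<close>

definition trace_norm :: "'v set \<Rightarrow> ('v \<Rightarrow> 'v \<Rightarrow> real) \<Rightarrow> real" where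
  "trace_norm I A = (\<Sum>i\<in>I. \<bar>(SOME lam. \<exists>u. diagonalises I A lam u) i\<bar>)"

definition quad_form :: "'v set \<Rightarrow> ('v \<Rightarrow> 'v \<Rightarrow> real) \<Rightarrow> ('v \<Rightarrow> real) \<Rightarrow> real" where
  "quad_form I A x = (\<Sum>j\<in>I. \<Sum>k\<in>I. A j k * x j * x k)"

lemma parseval:
  assumes fin: "finite I" and v: "orthonormal_system I v"
  shows "(\<Sum>i\<in>I. (\<Sum>j\<in>I. w j * v i j)\<^sup>2) = (\<Sum>j\<in>I. (w j)\<^sup>2)"
proof -
  have "(\<Sum>i\<in>I. (\<Sum>j\<in>I. w j * v i j)\<^sup>2) = (\<Sum>i\<in>I. \<Sum>j\<in>I. \<Sum>k\<in>I. w j * w k * (v i j * v i k))"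
    unfolding power2_eq_square sum_product by (intro sum.cong refl) (simp add: mult_ac)
  also have "\<dots> = (\<Sum>j\<in>I. \<Sum>k\<in>I. \<Sum>i\<in>I. w j * w k * (v i j * v i k))" by (rule sum_swap3)
  also have "\<dots> = (\<Sum>j\<in>I. \<Sum>k\<in>I. w j * w k * of_bool (j = k))"
    using v by (intro sum.cong refl) (simp add: orthonormal_system_def flip: sum_distrib_left)
  also have "\<dots> = (\<Sum>j\<in>I. (w j)\<^sup>2)"
    using fin by (intro sum.cong refl) (simp add: sum_mult_of_bool power2_eq_square)
  finally show ?thesis .
qed

lemma quad_form_decomposition:
  assumes "\<And>j k. j \<in> I \<Longrightarrow> k \<in> I \<Longrightarrow> A j k = (\<Sum>l\<in>L. c l * w l j * w l k)"
  shows "quad_form I A x = (\<Sum>l\<in>L. c l * (\<Sum>j\<in>I. w l j * x j)\<^sup>2)"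
proof -
  have "quad_form I A x = (\<Sum>j\<in>I. \<Sum>k\<in>I. \<Sum>l\<in>L. c l * w l j * w l k * x j * x k)"
    unfolding quad_form_def using assms
    by (intro sum.cong refl) (simp add: sum_distrib_right)
  also have "\<dots> = (\<Sum>l\<in>L. \<Sum>j\<in>I. \<Sum>k\<in>I. c l * w l j * w l k * x j * x k)"
    by (rule sum_swap3[symmetric])
  also have "\<dots> = (\<Sum>l\<in>L. c l * (\<Sum>j\<in>I. w l j * x j)\<^sup>2)"
    unfolding power2_eq_square sum_product unfolding sum_distrib_left
    by (intro sum.cong refl) (simp add: mult_ac)
  finally show ?thesis .
qed

text \<open>Each rank-one term contributes at most |c l| times the squared norm of
  \<open>w l\<close>, by Parseval in the basis \<open>v\<close>. With an eigenbasis as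
  \<open>v\<close> this bounds the trace norm from above; with a spectral decomposition on the right
  it bounds it from below.\<close>

lemma sum_abs_quad_form_le:
  assumes fin: "finite I" and v: "orthonormal_system I v"
    and A: "\<And>j k. j \<in> I \<Longrightarrow> k \<in> I \<Longrightarrow> A j k = (\<Sum>l\<in>L. c l * w l j * w l k)"
  shows "(\<Sum>i\<in>I. \<bar>quad_form I A (v i)\<bar>) \<le> (\<Sum>l\<in>L. \<bar>c l\<bar> * (\<Sum>j\<in>I. (w l j)\<^sup>2))"
proof -
  have "(\<Sum>i\<in>I. \<bar>quad_form I A (v i)\<bar>) \<le> (\<Sum>i\<in>I. \<Sum>l\<in>L. \<bar>c l\<bar> * (\<Sum>j\<in>I. w l j * v i j)\<^sup>2)"
  proof (rule sum_mono)
    fix i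
    have "\<bar>quad_form I A (v i)\<bar> = \<bar>\<Sum>l\<in>L. c l * (\<Sum>j\<in>I. w l j * v i j)\<^sup>2\<bar>"
      using A by (subst quad_form_decomposition[where L = L and c = c and w = w]) auto
    also have "\<dots> \<le> (\<Sum>l\<in>L. \<bar>c l\<bar> * (\<Sum>j\<in>I. w l j * v i j)\<^sup>2)"
      by (rule order_trans[OF sum_abs]) (simp add: abs_mult)
    finally show "\<bar>quad_form I A (v i)\<bar> \<le> (\<Sum>l\<in>L. \<bar>c l\<bar> * (\<Sum>j\<in>I. w l j * v i j)\<^sup>2)" .
  qed
  also have "\<dots> = (\<Sum>l\<in>L. \<Sum>i\<in>I. \<bar>c l\<bar> * (\<Sum>j\<in>I. w l j * v i j)\<^sup>2)" by (rule sum.swap)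
  also have "\<dots> = (\<Sum>l\<in>L. \<bar>c l\<bar> * (\<Sum>j\<in>I. (w l j)\<^sup>2))"
    by (simp add: parseval[OF fin v] flip: sum_distrib_left)
  finally show ?thesis .
qed

lemma quad_form_eigenvector:
  assumes fin: "finite I" and d: "diagonalises I A lam u" and i: "i \<in> I"
  shows "quad_form I A (u i) = lam i"
proof -
  have "quad_form I A (u i) = (\<Sum>l\<in>I. lam l * (\<Sum>j\<in>I. u l j * u i j)\<^sup>2)"
    using d by (intro quad_form_decomposition) (simp add: diagonalises_def)
  also have "\<dots> = (\<Sum>l\<in>I. lam l * of_bool (l = i))"
    using d i by (intro sum.cong refl) (auto simp: diagonalises_def orthonormal_system_def)
  finally show ?thesis using fin i by (simp add: sum_mult_of_bool)
qed

lemma sum_abs_eigenvalues_le: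
  assumes fin: "finite I" and d: "diagonalises I B lam u"
    and AB: "\<And>j k. j \<in> I \<Longrightarrow> k \<in> I \<Longrightarrow> B j k = A j k"
    and A: "\<And>j k. j \<in> I \<Longrightarrow> k \<in> I \<Longrightarrow> A j k = (\<Sum>l\<in>L. c l * w l j * w l k)"
  shows "(\<Sum>i\<in>I. \<bar>lam i\<bar>) \<le> (\<Sum>l\<in>L. \<bar>c l\<bar> * (\<Sum>j\<in>I. (w l j)\<^sup>2))"
proof -
  have "(\<Sum>i\<in>I. \<bar>lam i\<bar>) = (\<Sum>i\<in>I. \<bar>quad_form I B (u i)\<bar>)"
    using quad_form_eigenvector[OF fin d] by simp
  also have "\<dots> \<le> (\<Sum>l\<in>L. \<bar>c l\<bar> * (\<Sum>j\<in>I. (w l j)\<^sup>2))"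
    using d AB A by (intro sum_abs_quad_form_le[OF fin]) (auto simp: diagonalises_def)
  finally show ?thesis .
qed

lemma sum_square_row:
  assumes "diagonalises I A lam u" "l \<in> I"
  shows "(\<Sum>j\<in>I. (u l j)\<^sup>2) = 1"
  using assms by (auto simp: diagonalises_def orthonormal_system_def power2_eq_square)

text \<open>Two diagonalisations are compared in both directions, each serving once as basis and
  once as decomposition.\<close>

lemma trace_norm_eq:
  assumes fin: "finite I" and d: "diagonalises I A lam u"
  shows "trace_norm I A = (\<Sum>i\<in>I. \<bar>lam i\<bar>)"
proof -
  define lam' where "lam' = (SOME lam. \<exists>u. diagonalises I A lam u)"
  obtain u' where d': "diagonalises I A lam' u'"
    unfolding lam'_def using someI_ex[of "\<lambda>lam. \<exists>u. diagonalises I A lam u"] d by blast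
  have "(\<Sum>i\<in>I. \<bar>lam' i\<bar>) \<le> (\<Sum>i\<in>I. \<bar>lam i\<bar> * (\<Sum>j\<in>I. (u i j)\<^sup>2))"
    by (rule sum_abs_eigenvalues_le[OF fin d' refl]) (use d in \<open>auto simp: diagonalises_def\<close>)
  moreover have "(\<Sum>i\<in>I. \<bar>lam i\<bar>) \<le> (\<Sum>i\<in>I. \<bar>lam' i\<bar> * (\<Sum>j\<in>I. (u' i j)\<^sup>2))"
    by (rule sum_abs_eigenvalues_le[OF fin d refl]) (use d' in \<open>auto simp: diagonalises_def\<close>)
  ultimately show ?thesis
    using sum_square_row[OF d] sum_square_row[OF d'] by (simp add: trace_norm_def lam'_def)
qed

lemma trace_norm_spectral:
  assumes "finite I" "symmetric_on I A"
  obtains lam u where "diagonalises I A lam u" "trace_norm I A = (\<Sum>i\<in>I. \<bar>lam i\<bar>)"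
  using spectral_theorem[OF assms] trace_norm_eq[OF assms(1)] by blast

text \<open>Any signed rank-one decomposition, orthogonal or not, yields an upper bound; explicit
  matrices such as means and single edges are estimated this way.\<close>

lemma trace_norm_le_decomposition:
  assumes fin: "finite I"
    and A: "\<And>j k. j \<in> I \<Longrightarrow> k \<in> I \<Longrightarrow> A j k = (\<Sum>l\<in>L. c l * w l j * w l k)"
  shows "trace_norm I A \<le> (\<Sum>l\<in>L. \<bar>c l\<bar> * (\<Sum>j\<in>I. (w l j)\<^sup>2))"
proof -
  have "symmetric_on I A" by (auto simp: symmetric_on_def A mult_ac)
  then obtain lam u where d: "diagonalises I A lam u" "trace_norm I A = (\<Sum>i\<in>I. \<bar>lam i\<bar>)"
    using trace_norm_spectral[OF fin] by blast
  then show ?thesis using sum_abs_eigenvalues_le[OF fin d(1) refl A] by simp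
qed

section \<open>Norm inequalities drawn from the variational bounds\<close>

lemma trace_norm_nonneg: "trace_norm I A \<ge> 0"
  by (simp add: trace_norm_def sum_nonneg)

lemma sum_abs_quad_form_le_trace_norm:
  assumes fin: "finite I" and v: "orthonormal_system I v" and A: "symmetric_on I A"
  shows "(\<Sum>i\<in>I. \<bar>quad_form I A (v i)\<bar>) \<le> trace_norm I A"
proof -
  obtain lam u where d: "diagonalises I A lam u" "trace_norm I A = (\<Sum>i\<in>I. \<bar>lam i\<bar>)"
    using trace_norm_spectral[OF fin A] by blast
  have "(\<Sum>i\<in>I. \<bar>quad_form I A (v i)\<bar>) \<le> (\<Sum>l\<in>I. \<bar>lam l\<bar> * (\<Sum>j\<in>I. (u l j)\<^sup>2))"
    using d by (intro sum_abs_quad_form_le[OF fin v]) (auto simp: diagonalises_def)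
  then show ?thesis using d sum_square_row[OF d(1)] by simp
qed

lemma symmetric_on_add:
  "symmetric_on I A \<Longrightarrow> symmetric_on I B \<Longrightarrow> symmetric_on I (\<lambda>j k. A j k + B j k)"
  by (simp add: symmetric_on_def)

lemma trace_norm_cong:
  assumes eq: "\<And>j k. j \<in> I \<Longrightarrow> k \<in> I \<Longrightarrow> A j k = B j k"
  shows "trace_norm I A = trace_norm I B"
proof -
  have "diagonalises I A = diagonalises I B"
    using eq by (intro ext) (auto simp: diagonalises_def)
  then show ?thesis by (simp add: trace_norm_def)
qed

text \<open>In an eigenbasis of the sum each eigenvalue is the sum of two quadratic forms, and each
  family of forms is controlled by its own trace norm.\<close>

lemma trace_norm_triangle:
  assumes fin: "finite I" and A: "symmetric_on I A" and B: "symmetric_on I B"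
  shows "trace_norm I (\<lambda>j k. A j k + B j k) \<le> trace_norm I A + trace_norm I B"
proof -
  obtain lam u where d: "diagonalises I (\<lambda>j k. A j k + B j k) lam u"
      "trace_norm I (\<lambda>j k. A j k + B j k) = (\<Sum>i\<in>I. \<bar>lam i\<bar>)"
    using trace_norm_spectral[OF fin symmetric_on_add[OF A B]] by blast
  have u: "orthonormal_system I u" using d by (simp add: diagonalises_def)
  have "(\<Sum>i\<in>I. \<bar>lam i\<bar>) = (\<Sum>i\<in>I. \<bar>quad_form I A (u i) + quad_form I B (u i)\<bar>)"
    using quad_form_eigenvector[OF fin d(1)]
    by (intro sum.cong refl) (simp add: quad_form_def sum.distrib algebra_simps)
  also have "\<dots> \<le> (\<Sum>i\<in>I. \<bar>quad_form I A (u i)\<bar> + \<bar>quad_form I B (u i)\<bar>)"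
    by (intro sum_mono) simp
  also have "\<dots> \<le> trace_norm I A + trace_norm I B"
    unfolding sum.distrib
    by (intro add_mono sum_abs_quad_form_le_trace_norm fin u A B)
  finally show ?thesis using d by simp
qed

text \<open>Multiplying coordinates by signs keeps the eigenvectors normalised.\<close>

lemma trace_norm_scale_le:
  assumes fin: "finite I" and A: "symmetric_on I A" and s: "\<And>j. j \<in> I \<Longrightarrow> (s j)\<^sup>2 = 1"
  shows "trace_norm I (\<lambda>j k. a * s j * s k * A j k) \<le> \<bar>a\<bar> * trace_norm I A"
proof -
  obtain lam u where d: "diagonalises I A lam u" "trace_norm I A = (\<Sum>i\<in>I. \<bar>lam i\<bar>)"
    using trace_norm_spectral[OF fin A] by blast
  have "trace_norm I (\<lambda>j k. a * s j * s k * A j k)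
      \<le> (\<Sum>l\<in>I. \<bar>a * lam l\<bar> * (\<Sum>j\<in>I. (s j * u l j)\<^sup>2))"
    using d by (intro trace_norm_le_decomposition[OF fin])
      (auto simp: diagonalises_def sum_distrib_left mult_ac)
  also have "\<dots> = (\<Sum>l\<in>I. \<bar>a\<bar> * \<bar>lam l\<bar>)"
    using sum_square_row[OF d(1)] s by (simp add: power_mult_distrib abs_mult)
  finally show ?thesis using d by (simp add: sum_distrib_left)
qed

lemma trace_norm_uminus_le:
  assumes "finite I" "symmetric_on I A"
  shows "trace_norm I (\<lambda>j k. - A j k) \<le> trace_norm I A"
  using trace_norm_scale_le[OF assms, of "\<lambda>_. 1" "- 1"] by simp

lemma trace_norm_diff_le:
  assumes fin: "finite I" and A: "symmetric_on I A" and B: "symmetric_on I B"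
  shows "trace_norm I (\<lambda>j k. A j k - B j k) \<le> trace_norm I A + trace_norm I B"
    and "\<bar>trace_norm I A - trace_norm I B\<bar> \<le> trace_norm I (\<lambda>j k. A j k - B j k)"
proof -
  have m: "symmetric_on I (\<lambda>j k. - B j k)" "symmetric_on I (\<lambda>j k. A j k - B j k)"
      "symmetric_on I (\<lambda>j k. B j k - A j k)"
    using A B by (auto simp: symmetric_on_def)
  show "trace_norm I (\<lambda>j k. A j k - B j k) \<le> trace_norm I A + trace_norm I B"
    using trace_norm_triangle[OF fin A m(1)] trace_norm_uminus_le[OF fin B] by simp
  have "trace_norm I A \<le> trace_norm I (\<lambda>j k. A j k - B j k) + trace_norm I B"
    using trace_norm_triangle[OF fin m(2) B] by simp
  moreover have "trace_norm I B \<le> trace_norm I (\<lambda>j k. B j k - A j k) + trace_norm I A"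
    using trace_norm_triangle[OF fin m(3) A] by simp
  moreover have "trace_norm I (\<lambda>j k. B j k - A j k) \<le> trace_norm I (\<lambda>j k. A j k - B j k)"
    using trace_norm_uminus_le[OF fin m(2)] by simp
  ultimately show "\<bar>trace_norm I A - trace_norm I B\<bar> \<le> trace_norm I (\<lambda>j k. A j k - B j k)"
    by linarith
qed

lemma symmetric_on_sum:
  "(\<And>i. i \<in> L \<Longrightarrow> symmetric_on I (A i)) \<Longrightarrow> symmetric_on I (\<lambda>j k. \<Sum>i\<in>L. A i j k)"
  by (auto simp: symmetric_on_def intro!: sum.cong)

lemma trace_norm_zero: "finite I \<Longrightarrow> trace_norm I (\<lambda>j k. 0) = 0"
  using trace_norm_le_decomposition[where L = "{} :: nat set" and I = I and A = "\<lambda>j k. 0"] trace_norm_nonneg[of I "\<lambda>j k. 0"]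
  by simp

lemma trace_norm_sum_le:
  assumes fin: "finite I" and L: "finite L" and A: "\<And>i. i \<in> L \<Longrightarrow> symmetric_on I (A i)"
  shows "trace_norm I (\<lambda>j k. \<Sum>i\<in>L. A i j k) \<le> (\<Sum>i\<in>L. trace_norm I (A i))"
  using L A
proof (induction L rule: finite_induct)
  case empty
  then show ?case using fin by (simp add: trace_norm_zero)
next
  case (insert x L)
  have "trace_norm I (\<lambda>j k. A x j k + (\<Sum>i\<in>L. A i j k))
      \<le> trace_norm I (A x) + trace_norm I (\<lambda>j k. \<Sum>i\<in>L. A i j k)"
    using insert by (intro trace_norm_triangle[OF fin] symmetric_on_sum) auto
  then show ?case using insert by simp
qed

lemma trace_norm_supported_le:
  assumes fin: "finite I" and J: "J \<subseteq> I" and A: "symmetric_on J A"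
    and supp: "\<And>j k. j \<in> I \<Longrightarrow> k \<in> I \<Longrightarrow> j \<notin> J \<or> k \<notin> J \<Longrightarrow> A j k = 0"
  shows "trace_norm I A \<le> trace_norm J A"
proof -
  have finJ: "finite J" using fin J finite_subset by blast
  obtain lam u where d: "diagonalises J A lam u" "trace_norm J A = (\<Sum>i\<in>J. \<bar>lam i\<bar>)"
    using trace_norm_spectral[OF finJ A] by blast
  define w where "w l j = (if j \<in> J then u l j else 0)" for l j
  have "A j k = (\<Sum>l\<in>J. lam l * w l j * w l k)" if "j \<in> I" "k \<in> I" for j k
    using d(1) supp[OF that] that by (cases "j \<in> J \<and> k \<in> J") (auto simp: diagonalises_def w_def)
  then have "trace_norm I A \<le> (\<Sum>l\<in>J. \<bar>lam l\<bar> * (\<Sum>j\<in>I. (w l j)\<^sup>2))"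
    by (rule trace_norm_le_decomposition[OF fin])
  moreover have "(\<Sum>j\<in>I. (w l j)\<^sup>2) = (\<Sum>j\<in>J. (u l j)\<^sup>2)" for l
    using fin J by (intro sum.mono_neutral_cong_right) (auto simp: w_def)
  ultimately show ?thesis using d sum_square_row[OF d(1)] by simp
qed

text \<open>Polarisation: the matrix is half the difference of the squares of sqrt a x + y/sqrt a
  and sqrt a x - y/sqrt a. The free parameter \<open>a\<close> serves to balance the two
  norms.\<close>

lemma trace_norm_rank_two_le:
  assumes fin: "finite I" and a: "a > 0"
  shows "trace_norm I (\<lambda>j k. x j * y k + y j * x k) \<le> a * (\<Sum>j\<in>I. (x j)\<^sup>2) + (\<Sum>j\<in>I. (y j)\<^sup>2) / a"
proof -
  define w where "w l j = (if l then sqrt a * x j + y j / sqrt a else sqrt a * x j - y j / sqrt a)" for l j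
  have "x j * y k + y j * x k = (\<Sum>l\<in>UNIV. (if l then 1/2 else -1/2) * w l j * w l k)" for j k
  proof -
    define r where "r = sqrt a"
    have "r \<noteq> 0" using a by (simp add: r_def)
    then show ?thesis by (simp add: UNIV_bool w_def field_simps flip: r_def)
  qed
  then have "trace_norm I (\<lambda>j k. x j * y k + y j * x k)
      \<le> (\<Sum>l\<in>UNIV. \<bar>if l then 1/2 else -1/2\<bar> * (\<Sum>j\<in>I. (w l j)\<^sup>2))"
    by (intro trace_norm_le_decomposition[OF fin]) auto
  also have "\<dots> = (\<Sum>j\<in>I. (w True j)\<^sup>2 / 2 + (w False j)\<^sup>2 / 2)"
    by (simp add: UNIV_bool sum.distrib flip: sum_divide_distrib)
  also have "\<dots> = (\<Sum>j\<in>I. a * (x j)\<^sup>2 + (y j)\<^sup>2 / a)"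
  proof (intro sum.cong refl)
    fix j
    have "(w True j)\<^sup>2 / 2 + (w False j)\<^sup>2 / 2 = (sqrt a * x j)\<^sup>2 + (y j / sqrt a)\<^sup>2"
      by (simp add: w_def power2_eq_square algebra_simps add_divide_distrib diff_divide_distrib)
    then show "(w True j)\<^sup>2 / 2 + (w False j)\<^sup>2 / 2 = a * (x j)\<^sup>2 + (y j)\<^sup>2 / a"
      using a by (simp add: power_mult_distrib power_divide)
  qed
  finally show ?thesis by (simp add: sum.distrib sum_distrib_left sum_divide_distrib)
qed

section \<open>Second and fourth moments of the eigenvalues, and duality\<close>

lemma diagonalises_sum_square:
  assumes fin: "finite I" and d: "diagonalises I A lam u"
  shows "(\<Sum>j\<in>I. \<Sum>k\<in>I. (A j k)\<^sup>2) = (\<Sum>i\<in>I. (lam i)\<^sup>2)"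
proof -
  have "(\<Sum>k\<in>I. (A j k)\<^sup>2) = (\<Sum>i\<in>I. (lam i * u i j)\<^sup>2)" if j: "j \<in> I" for j
  proof -
    have "(\<Sum>k\<in>I. (A j k)\<^sup>2) = (\<Sum>k\<in>I. \<Sum>i\<in>I. \<Sum>l\<in>I. lam i * u i j * (lam l * u l j) * (u i k * u l k))"
      using d j unfolding diagonalises_def
      by (intro sum.cong refl) (simp add: power2_eq_square sum_product, intro sum.cong refl, simp)
    also have "\<dots> = (\<Sum>i\<in>I. \<Sum>l\<in>I. \<Sum>k\<in>I. lam i * u i j * (lam l * u l j) * (u i k * u l k))"
      by (rule sum_swap3)
    also have "\<dots> = (\<Sum>i\<in>I. \<Sum>l\<in>I. lam i * u i j * (lam l * u l j) * of_bool (i = l))"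
      using d by (intro sum.cong refl) (simp add: diagonalises_def orthonormal_system_def flip: sum_distrib_left)
    also have "\<dots> = (\<Sum>i\<in>I. (lam i * u i j)\<^sup>2)"
      using fin by (intro sum.cong refl) (simp add: sum_mult_of_bool power2_eq_square)
    finally show ?thesis .
  qed
  then have "(\<Sum>j\<in>I. \<Sum>k\<in>I. (A j k)\<^sup>2) = (\<Sum>j\<in>I. \<Sum>i\<in>I. (lam i * u i j)\<^sup>2)" by simp
  also have "\<dots> = (\<Sum>i\<in>I. \<Sum>j\<in>I. (lam i * u i j)\<^sup>2)" by (rule sum.swap)
  also have "\<dots> = (\<Sum>i\<in>I. (lam i)\<^sup>2)"
    using sum_square_row[OF d] by (intro sum.cong refl) (simp add: power_mult_distrib flip: sum_distrib_left)
  finally show ?thesis .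
qed

text \<open>Combined with \<open>diagonalises_sum_square\<close> this expresses the fourth moment of
  the eigenvalues through the entries of the squared matrix.\<close>

lemma diagonalises_square:
  assumes fin: "finite I" and d: "diagonalises I A lam u"
  shows "diagonalises I (\<lambda>j k. \<Sum>l\<in>I. A j l * A l k) (\<lambda>i. (lam i)\<^sup>2) u"
proof -
  have "(\<Sum>l\<in>I. A j l * A l k) = (\<Sum>i\<in>I. (lam i)\<^sup>2 * u i j * u i k)" if jk: "j \<in> I" "k \<in> I" for j k
  proof -
    have "(\<Sum>l\<in>I. A j l * A l k) = (\<Sum>l\<in>I. \<Sum>a\<in>I. \<Sum>b\<in>I. lam a * u a j * (lam b * u b k) * (u a l * u b l))"
      using d jk unfolding diagonalises_def
      by (intro sum.cong refl) (simp add: sum_product, intro sum.cong refl, simp)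
    also have "\<dots> = (\<Sum>a\<in>I. \<Sum>b\<in>I. \<Sum>l\<in>I. lam a * u a j * (lam b * u b k) * (u a l * u b l))"
      by (rule sum_swap3)
    also have "\<dots> = (\<Sum>a\<in>I. \<Sum>b\<in>I. lam a * u a j * (lam b * u b k) * of_bool (a = b))"
      using d by (intro sum.cong refl) (simp add: diagonalises_def orthonormal_system_def flip: sum_distrib_left)
    also have "\<dots> = (\<Sum>a\<in>I. (lam a)\<^sup>2 * u a j * u a k)"
      using fin by (intro sum.cong refl) (simp add: sum_mult_of_bool power2_eq_square)
    finally show ?thesis .
  qed
  then show ?thesis using d by (simp add: diagonalises_def)
qed

lemma trace_norm_square_le:
  fixes A :: "'v \<Rightarrow> 'v \<Rightarrow> real"
  assumes fin: "finite I" and A: "symmetric_on I A"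
  shows "(trace_norm I A)\<^sup>2 \<le> card I * (\<Sum>j\<in>I. \<Sum>k\<in>I. (A j k)\<^sup>2)"
proof -
  obtain lam u where d: "diagonalises I A lam u" "trace_norm I A = (\<Sum>i\<in>I. \<bar>lam i\<bar>)"
    using trace_norm_spectral[OF fin A] by blast
  have "(\<Sum>i\<in>I. 1 * \<bar>lam i\<bar>)\<^sup>2 \<le> (\<Sum>i\<in>I. 1\<^sup>2) * (\<Sum>i\<in>I. \<bar>lam i\<bar>\<^sup>2)"
    by (rule Cauchy_Schwarz_ineq_sum)
  then show ?thesis using d diagonalises_sum_square[OF fin d(1)] by simp
qed

text \<open>The polynomial (3 a^2 x^2 - x^4)/(2 a^3) lies below |x| and meets it at 0 and,
  tangentially, at a: for x \<ge> 0 the difference is x (x - a)^2 (x + 2 a)/(2 a^3). Little is lost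
  when the nonzero eigenvalues have modulus close to \<open>a\<close>.\<close>

lemma trace_norm_ge_tangent:
  assumes fin: "finite I" and A: "symmetric_on I A" and a: "a > 0"
  shows "trace_norm I A \<ge> (3 * a\<^sup>2 * (\<Sum>j\<in>I. \<Sum>k\<in>I. (A j k)\<^sup>2)
            - (\<Sum>j\<in>I. \<Sum>k\<in>I. (\<Sum>l\<in>I. A j l * A l k)\<^sup>2)) / (2 * a ^ 3)"
proof -
  obtain lam u where d: "diagonalises I A lam u" "trace_norm I A = (\<Sum>i\<in>I. \<bar>lam i\<bar>)"
    using trace_norm_spectral[OF fin A] by blast
  have id: "x * (x - a)\<^sup>2 * (x + 2 * a) = (x\<^sup>2)\<^sup>2 - 3 * a\<^sup>2 * x\<^sup>2 + 2 * a ^ 3 * x" for x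
    by (simp add: power2_eq_square power3_eq_cube algebra_simps)
  have "3 * a\<^sup>2 * (lam i)\<^sup>2 - ((lam i)\<^sup>2)\<^sup>2 \<le> 2 * a ^ 3 * \<bar>lam i\<bar>" for i
  proof -
    have "0 \<le> \<bar>lam i\<bar> * (\<bar>lam i\<bar> - a)\<^sup>2 * (\<bar>lam i\<bar> + 2 * a)" using a by simp
    also have "\<dots> = (\<bar>lam i\<bar>\<^sup>2)\<^sup>2 - 3 * a\<^sup>2 * \<bar>lam i\<bar>\<^sup>2 + 2 * a ^ 3 * \<bar>lam i\<bar>"
      by (rule id)
    finally show ?thesis by simp
  qed
  then have "(\<Sum>i\<in>I. 3 * a\<^sup>2 * (lam i)\<^sup>2 - ((lam i)\<^sup>2)\<^sup>2) \<le> (\<Sum>i\<in>I. 2 * a ^ 3 * \<bar>lam i\<bar>)"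
    by (intro sum_mono) auto
  then have "3 * a\<^sup>2 * (\<Sum>i\<in>I. (lam i)\<^sup>2) - (\<Sum>i\<in>I. ((lam i)\<^sup>2)\<^sup>2) \<le> trace_norm I A * (2 * a ^ 3)"
    unfolding d(2) sum_subtractf sum_distrib_left[symmetric] by (simp add: mult_ac)
  then show ?thesis
    using a diagonalises_sum_square[OF fin d(1)]
      diagonalises_sum_square[OF fin diagonalises_square[OF fin d(1)]]
    by (simp add: pos_divide_le_eq)
qed

text \<open>The hypothesis says that \<open>X\<close> has operator norm at most \<open>a\<close> as
  a quadratic form; in an eigenbasis of \<open>A\<close> the pairing weighs each eigenvalue by a
  value of that form.\<close>

lemma trace_norm_ge_dual:
  assumes fin: "finite I" and A: "symmetric_on I A"
    and X: "\<And>y. \<bar>quad_form I X y\<bar> \<le> a * (\<Sum>j\<in>I. (y j)\<^sup>2)"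
  shows "(\<Sum>j\<in>I. \<Sum>k\<in>I. A j k * X j k) \<le> a * trace_norm I A"
proof -
  obtain lam u where d: "diagonalises I A lam u" "trace_norm I A = (\<Sum>i\<in>I. \<bar>lam i\<bar>)"
    using trace_norm_spectral[OF fin A] by blast
  have "(\<Sum>j\<in>I. \<Sum>k\<in>I. A j k * X j k) = (\<Sum>j\<in>I. \<Sum>k\<in>I. \<Sum>i\<in>I. lam i * (X j k * u i j * u i k))"
    using d unfolding diagonalises_def
    by (intro sum.cong refl) (simp add: sum_distrib_left mult_ac)
  also have "\<dots> = (\<Sum>i\<in>I. \<Sum>j\<in>I. \<Sum>k\<in>I. lam i * (X j k * u i j * u i k))"
    by (rule sum_swap3[symmetric])
  also have "\<dots> = (\<Sum>i\<in>I. lam i * quad_form I X (u i))"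
    by (simp add: quad_form_def sum_distrib_left)
  also have "\<dots> \<le> (\<Sum>i\<in>I. \<bar>lam i\<bar> * a)"
  proof (rule sum_mono)
    fix i assume "i \<in> I"
    then have "\<bar>quad_form I X (u i)\<bar> \<le> a" using X[of "u i"] sum_square_row[OF d(1)] by simp
    then have "\<bar>lam i * quad_form I X (u i)\<bar> \<le> \<bar>lam i\<bar> * a"
      unfolding abs_mult by (rule mult_left_mono) simp
    then show "lam i * quad_form I X (u i) \<le> \<bar>lam i\<bar> * a" by linarith
  qed
  finally show ?thesis using d by (simp add: mult.commute flip: sum_distrib_left)
qed

text \<open>Pinching: the entries between \<open>V\<close> and its complement are half the
  difference of \<open>A\<close> and its conjugate by the signs of \<open>V\<close>, and that
  conjugate has no larger trace norm than \<open>A\<close>.\<close>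

lemma trace_norm_bipartite_le:
  assumes fin: "finite I" and A: "symmetric_on I A"
  shows "trace_norm I (\<lambda>j k. if (j \<in> V) = (k \<in> V) then 0 else A j k) \<le> trace_norm I A"
proof -
  define s where "s j = (if j \<in> V then 1 else - 1 :: real)" for j
  have s: "(s j)\<^sup>2 = 1" for j by (simp add: s_def)
  have sym: "symmetric_on I (\<lambda>j k. 1/2 * A j k)" "symmetric_on I (\<lambda>j k. 1/2 * s j * s k * A j k)"
    using A by (auto simp: symmetric_on_def)
  have "(\<lambda>j k. if (j \<in> V) = (k \<in> V) then 0 else A j k) = (\<lambda>j k. 1/2 * A j k - 1/2 * s j * s k * A j k)"
    by (intro ext) (auto simp: s_def)
  then have "trace_norm I (\<lambda>j k. if (j \<in> V) = (k \<in> V) then 0 else A j k)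
      \<le> trace_norm I (\<lambda>j k. 1/2 * A j k) + trace_norm I (\<lambda>j k. 1/2 * s j * s k * A j k)"
    using trace_norm_diff_le(1)[OF fin sym] by simp
  then show ?thesis
    using trace_norm_scale_le[OF fin A, of "\<lambda>_. 1" "1/2"] trace_norm_scale_le[OF fin A, of s "1/2"] s
    by simp
qed

section \<open>Random subsets of a finite set\<close>

text \<open>The expectation of \<open>f\<close> at the random subset of \<open>E\<close> that contains each element independently
  with probability \<open>p\<close>.\<close>

definition bexp :: "real \<Rightarrow> 'e set \<Rightarrow> ('e set \<Rightarrow> 'b::real_vector) \<Rightarrow> 'b" where
  "bexp p E f = (\<Sum>F\<in>Pow E. (p ^ card F * (1 - p) ^ card (E - F)) *\<^sub>R f F)"

lemma bexp_empty [simp]: "bexp p {} f = f {}"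
  by (simp add: bexp_def)

text \<open>Conditioning on the presence of \<open>e\<close>; the inductions over edge sets rest on
  this recursion.\<close>

lemma bexp_insert:
  assumes fin: "finite E" and e: "e \<notin> E"
  shows "bexp p (insert e E) f = p *\<^sub>R bexp p E (\<lambda>F. f (insert e F)) + (1 - p) *\<^sub>R bexp p E f"
proof -
  have inj: "inj_on (insert e) (Pow E)" using e by (intro inj_onI) (auto simp: insert_ident)
  have disj: "Pow E \<inter> insert e ` Pow E = {}" using e by auto
  let ?g = "\<lambda>F. (p ^ card F * (1 - p) ^ card (insert e E - F)) *\<^sub>R f F"
  have "bexp p (insert e E) f = (\<Sum>F\<in>Pow E. ?g F) + (\<Sum>F\<in>Pow E. ?g (insert e F))"
    unfolding bexp_def Pow_insert
    using fin disj by (subst sum.union_disjoint) (auto simp: sum.reindex[OF inj])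
  also have "(\<Sum>F\<in>Pow E. ?g F) = (1 - p) *\<^sub>R bexp p E f"
    unfolding bexp_def scaleR_sum_right
  proof (intro sum.cong refl)
    fix F assume "F \<in> Pow E"
    then have "insert e E - F = insert e (E - F)" "e \<notin> E - F" "finite (E - F)" using e fin by auto
    then show "?g F = (1 - p) *\<^sub>R (p ^ card F * (1 - p) ^ card (E - F)) *\<^sub>R f F"
      by (simp add: mult_ac)
  qed
  also have "(\<Sum>F\<in>Pow E. ?g (insert e F)) = p *\<^sub>R bexp p E (\<lambda>F. f (insert e F))"
    unfolding bexp_def scaleR_sum_right
  proof (intro sum.cong refl)
    fix F assume "F \<in> Pow E"
    then have "insert e E - insert e F = E - F" "e \<notin> F" "finite F"
      using e fin by (auto intro: finite_subset)
    then show "?g (insert e F) = p *\<^sub>R (p ^ card F * (1 - p) ^ card (E - F)) *\<^sub>R f (insert e F)"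
      by (simp add: mult_ac)
  qed
  finally show ?thesis by (simp add: add.commute)
qed

lemma bexp_add: "bexp p E (\<lambda>F. f F + g F) = bexp p E f + bexp p E g"
  by (simp add: bexp_def scaleR_add_right sum.distrib)

lemma bexp_diff: "bexp p E (\<lambda>F. f F - g F) = bexp p E f - bexp p E g"
  by (simp add: bexp_def scaleR_diff_right sum_subtractf)

lemma bexp_minus: "bexp p E (\<lambda>F. - f F) = - bexp p E f"
  by (simp add: bexp_def sum_negf)

lemma bexp_bounded_linear:
  assumes "bounded_linear h"
  shows "bexp p E (\<lambda>F. h (f F)) = h (bexp p E f)"
  by (simp add: bexp_def linear_sum[OF bounded_linear.linear[OF assms]]
      linear_scale[OF bounded_linear.linear[OF assms]])

lemma bexp_mult_left: "bexp p E (\<lambda>F. c * f F) = c * bexp p E f"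
  for c :: "'b::real_normed_algebra"
  by (rule bexp_bounded_linear[OF bounded_linear_mult_right])

lemma bexp_divide: "bexp p E (\<lambda>F. f F / c) = bexp p E f / c"
  for c :: "'b::real_normed_field"
  by (rule bexp_bounded_linear[OF bounded_linear_divide])

lemma bexp_sum: "bexp p E (\<lambda>F. \<Sum>i\<in>L. f i F) = (\<Sum>i\<in>L. bexp p E (f i))"
  unfolding bexp_def scaleR_sum_right by (rule sum.swap)

lemma bexp_cong: "(\<And>F. F \<subseteq> E \<Longrightarrow> f F = g F) \<Longrightarrow> bexp p E f = bexp p E g"
  by (auto simp: bexp_def intro!: sum.cong)

lemma bexp_const: "finite E \<Longrightarrow> bexp p E (\<lambda>F. c) = c"
  by (induction E rule: finite_induct) (simp_all add: bexp_insert flip: scaleR_add_left)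

text \<open>The extra elements are removed one at a time, their weights p and 1 - p adding up to 1.
  This lets random subsets of several edge sets be read off a single random set.\<close>

lemma bexp_marginal:
  assumes "finite E'" "finite E" "E \<inter> E' = {}"
  shows "bexp p (E' \<union> E) (\<lambda>F. f (F \<inter> E)) = bexp p E f"
  using assms
proof (induction E' rule: finite_induct)
  case empty
  then show ?case by (auto intro!: bexp_cong simp: Int_absorb2)
next
  case (insert e E')
  then have "e \<notin> E' \<union> E" "finite (E' \<union> E)" "e \<notin> E" by auto
  then show ?case using insert by (simp add: bexp_insert flip: scaleR_add_left)
qed

lemma bexp_marginal':
  assumes "finite K" "E \<subseteq> K"
  shows "bexp p K (\<lambda>F. f (F \<inter> E)) = bexp p E f"
proof -
  have "bexp p ((K - E) \<union> E) (\<lambda>F. f (F \<inter> E)) = bexp p E f"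
    by (rule bexp_marginal) (use assms finite_subset in auto)
  moreover have "(K - E) \<union> E = K" using assms by auto
  ultimately show ?thesis by simp
qed

text \<open>Integration by parts, exact for a centred Bernoulli variable.\<close>

lemma bexp_stein:
  fixes f :: "'e set \<Rightarrow> 'b::real_vector"
  assumes fin: "finite E" and e: "e \<in> E"
  shows "bexp p E (\<lambda>F. (of_bool (e \<in> F) - p) *\<^sub>R f F)
       = (p * (1 - p)) *\<^sub>R bexp p E (\<lambda>F. f (insert e F) - f (F - {e}))"
proof -
  define E' where "E' = E - {e}"
  have E: "E = insert e E'" "e \<notin> E'" "finite E'" using e fin by (auto simp: E'_def)
  have h: "bexp p E' (\<lambda>F. (of_bool (e \<in> insert e F) - p) *\<^sub>R f (insert e F)) = (1 - p) *\<^sub>R bexp p E' (\<lambda>F. f (insert e F))"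
    by (simp add: bexp_def scaleR_sum_right mult.commute)
  have h': "bexp p E' (\<lambda>F. (of_bool (e \<in> F) - p) *\<^sub>R f F) = (- p) *\<^sub>R bexp p E' f"
    unfolding bexp_def scaleR_sum_right using E(2) by (intro sum.cong refl) (auto simp: mult.commute)
  have "bexp p E' (\<lambda>F. f (insert e F) - f (F - {e})) = bexp p E' (\<lambda>F. f (insert e F) - f F)"
    using E(2) by (intro bexp_cong) (metis Diff_empty Diff_insert0 subset_eq)
  moreover have "bexp p E' (\<lambda>F. f (insert e (insert e F)) - f (insert e F - {e})) = bexp p E' (\<lambda>F. f (insert e F) - f F)"
    using E(2) by (intro bexp_cong) (metis Diff_insert_absorb insert_absorb2 subset_eq)
  ultimately have r: "bexp p E (\<lambda>F. f (insert e F) - f (F - {e})) = bexp p E' (\<lambda>F. f (insert e F)) - bexp p E' f"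
    unfolding E(1) bexp_insert[OF E(3,2)] by (simp add: bexp_diff flip: scaleR_add_left)
  show ?thesis
    unfolding r unfolding E(1) bexp_insert[OF E(3,2)] h h'
    by (simp add: algebra_simps)
qed

text \<open>\<open>f\<close> does not see \<open>e\<close>, so its difference in \<open>e\<close>
  vanishes and integration by parts gives the first claim. The second uses x^2 = (1 - 2p) x + p(1 -
  p), valid at both values 1 - p and -p of the centred indicator.\<close>

lemma bexp_square_independent:
  fixes f :: "'e set \<Rightarrow> real"
  assumes fin: "finite E" and e: "e \<in> E" and f: "\<And>F. F \<subseteq> E \<Longrightarrow> f (insert e F) = f (F - {e})"
  shows "bexp p E (\<lambda>F. (of_bool (e \<in> F) - p) * f F) = 0"
    and "bexp p E (\<lambda>F. (of_bool (e \<in> F) - p)\<^sup>2 * f F) = p * (1 - p) * bexp p E f"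
proof -
  have "bexp p E (\<lambda>F. f (insert e F) - f (F - {e})) = bexp p E (\<lambda>F. 0 :: real)"
    using f by (intro bexp_cong) simp
  then show 0: "bexp p E (\<lambda>F. (of_bool (e \<in> F) - p) * f F) = 0"
    using bexp_stein[OF fin e, of p f] fin by (simp add: bexp_const)
  have "bexp p E (\<lambda>F. (of_bool (e \<in> F) - p)\<^sup>2 * f F)
      = bexp p E (\<lambda>F. (1 - 2 * p) * ((of_bool (e \<in> F) - p) * f F) + p * (1 - p) * f F)"
    by (intro bexp_cong) (auto simp: power2_eq_square algebra_simps)
  also have "\<dots> = p * (1 - p) * bexp p E f"
    by (simp add: bexp_add bexp_mult_left 0)
  finally show "bexp p E (\<lambda>F. (of_bool (e \<in> F) - p)\<^sup>2 * f F) = p * (1 - p) * bexp p E f" .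
qed

text \<open>Substitute for Hoeffding's lemma: for a centred variable the linear term has mean zero,
  which leaves the exponential of the square.\<close>

lemma exp_le_add_exp_square: "exp x \<le> x + exp (x\<^sup>2)" for x :: real
proof -
  have 1: "exp x \<le> x + exp (x\<^sup>2)" if "exp x \<le> 1 + x + x\<^sup>2"
    using that exp_ge_add_one_self[of "x\<^sup>2"] by linarith
  consider "x \<le> 0" | "0 \<le> x" "x \<le> 1" | "x \<ge> 1" by linarith
  then show ?thesis
  proof cases
    case 1
    have "exp x * (1 - x) \<le> exp x * exp (- x)"
      using exp_ge_add_one_self[of "- x"] by (intro mult_left_mono) auto
    also have "\<dots> = 1" by (simp flip: exp_add)
    \<comment> \<open>The product is 1 - x^3.\<close>
    also have "1 \<le> (1 + x + x\<^sup>2) * (1 - x)"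
      using 1 by (simp add: power2_eq_square algebra_simps mult_nonpos_nonneg)
    finally have "exp x \<le> 1 + x + x\<^sup>2" using 1 by (simp add: mult_le_cancel_right)
    then show ?thesis by (rule \<open>exp x \<le> 1 + x + x\<^sup>2 \<Longrightarrow> _\<close>)
  next
    case 2
    then show ?thesis using exp_bound[of x] \<open>exp x \<le> 1 + x + x\<^sup>2 \<Longrightarrow> _\<close> by simp
  next
    case 3
    then have "x * 1 \<le> x * x" by (intro mult_left_mono) auto
    then have "exp x \<le> exp (x\<^sup>2)" by (simp add: power2_eq_square)
    then show ?thesis using 3 by linarith
  qed
qed

section \<open>Variance and exponential tail bounds under bounded differences\<close>

context
  fixes p :: real
  assumes p: "0 < p" "p < 1"
begin

lemma bexp_mono:
  fixes f g :: "'e set \<Rightarrow> real"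
  assumes "\<And>F. F \<subseteq> E \<Longrightarrow> f F \<le> g F"
  shows "bexp p E f \<le> bexp p E g"
  unfolding bexp_def using assms p
  by (intro sum_mono scaleR_left_mono) auto

lemma bexp_nonneg:
  fixes f :: "'e set \<Rightarrow> real"
  assumes "\<And>F. F \<subseteq> E \<Longrightarrow> 0 \<le> f F"
  shows "0 \<le> bexp p E f"
  unfolding bexp_def using assms p by (intro sum_nonneg) auto

lemma norm_bexp_le:
  fixes f :: "'e set \<Rightarrow> 'b::real_normed_vector"
  shows "norm (bexp p E f) \<le> bexp p E (\<lambda>F. norm (f F))"
  unfolding bexp_def using p
  by (intro order_trans[OF norm_sum] sum_mono) auto

lemma bexp_le_const:
  fixes f :: "'e set \<Rightarrow> real"
  assumes "finite E" "\<And>F. F \<subseteq> E \<Longrightarrow> f F \<le> c"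
  shows "bexp p E f \<le> c"
  using bexp_mono[of E f "\<lambda>_. c"] assms by (simp add: bexp_const)

text \<open>Law of total variance over one element: the two conditional variances obey the induction
  hypothesis, and the two conditional means differ by at most \<open>c\<close>.\<close>

lemma efron_stein:
  fixes f :: "'e set \<Rightarrow> real" and c :: real
  assumes "finite E" "\<And>e F. e \<in> E \<Longrightarrow> F \<subseteq> E - {e} \<Longrightarrow> \<bar>f (insert e F) - f F\<bar> \<le> c"
  shows "bexp p E (\<lambda>F. (f F)\<^sup>2) - (bexp p E f)\<^sup>2 \<le> card E * c\<^sup>2"
  using assms
proof (induction E arbitrary: f rule: finite_induct)
  case empty
  then show ?case by simp
next
  case (insert e E)
  define f1 where "f1 F = f (insert e F)" for F
  have IH0: "bexp p E (\<lambda>F. (f F)\<^sup>2) - (bexp p E f)\<^sup>2 \<le> card E * c\<^sup>2"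
    by (rule insert.IH) (use insert.prems insert.hyps in auto)
  have IH1: "bexp p E (\<lambda>F. (f1 F)\<^sup>2) - (bexp p E f1)\<^sup>2 \<le> card E * c\<^sup>2"
  proof (rule insert.IH)
    fix e' F assume "e' \<in> E" "F \<subseteq> E - {e'}"
    then have "\<bar>f (insert e' (insert e F)) - f (insert e F)\<bar> \<le> c"
      using insert.hyps by (intro insert.prems) auto
    then show "\<bar>f1 (insert e' F) - f1 F\<bar> \<le> c" by (simp add: f1_def insert_commute)
  qed
  have "\<bar>bexp p E f1 - bexp p E f\<bar> \<le> bexp p E (\<lambda>F. \<bar>f1 F - f F\<bar>)"
    using norm_bexp_le[of E "\<lambda>F. f1 F - f F"] by (simp add: bexp_diff)
  also have "\<dots> \<le> c"
    using insert.hyps by (intro bexp_le_const) (auto simp: f1_def intro!: insert.prems)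
  finally have d: "(bexp p E f1 - bexp p E f)\<^sup>2 \<le> c\<^sup>2"
    using power_mono[of "\<bar>bexp p E f1 - bexp p E f\<bar>" c 2] by simp
  have pp: "p * (1 - p) * (bexp p E f1 - bexp p E f)\<^sup>2 \<le> 1 * c\<^sup>2"
    using p d by (intro mult_mono mult_le_one) auto
  have "bexp p (insert e E) (\<lambda>F. (f F)\<^sup>2) - (bexp p (insert e E) f)\<^sup>2
      = p * (bexp p E (\<lambda>F. (f1 F)\<^sup>2) - (bexp p E f1)\<^sup>2) + (1 - p) * (bexp p E (\<lambda>F. (f F)\<^sup>2) - (bexp p E f)\<^sup>2)
        + p * (1 - p) * (bexp p E f1 - bexp p E f)\<^sup>2"
  proof -
    have "p * A1 + (1 - p) * A0 - (p * B1 + (1 - p) * B0)\<^sup>2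
        = p * (A1 - B1\<^sup>2) + (1 - p) * (A0 - B0\<^sup>2) + p * (1 - p) * (B1 - B0)\<^sup>2" for A1 A0 B1 B0 :: real
      by (simp add: power2_eq_square algebra_simps)
    then show ?thesis
      unfolding bexp_insert[OF insert.hyps] f1_def[symmetric] real_scaleR_def .
  qed
  also have "\<dots> \<le> p * (card E * c\<^sup>2) + (1 - p) * (card E * c\<^sup>2) + 1 * c\<^sup>2"
    using p IH0 IH1 pp by (intro add_mono mult_left_mono) auto
  also have "\<dots> = card (insert e E) * c\<^sup>2"
    using insert.hyps by (simp add: algebra_simps)
  finally show ?case .
qed

text \<open>After subtraction of the mean the linear terms of \<open>exp_le_add_exp_square\<close>
  cancel, and both deviations are at most \<open>c\<close>.\<close>

lemma two_point_mgf:
  fixes a b c lam :: real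
  assumes "\<bar>a - b\<bar> \<le> c"
  shows "p * exp (lam * a) + (1 - p) * exp (lam * b) \<le> exp (lam * (p * a + (1 - p) * b)) * exp (lam\<^sup>2 * c\<^sup>2)"
proof -
  define m where "m = p * a + (1 - p) * b"
  have am: "a - m = (1 - p) * (a - b)" and bm: "b - m = - (p * (a - b))"
    by (auto simp: m_def algebra_simps)
  have ac: "\<bar>a - m\<bar> \<le> c"
  proof -
    have "\<bar>a - m\<bar> \<le> 1 * \<bar>a - b\<bar>" unfolding am abs_mult using p by (intro mult_right_mono) auto
    then show ?thesis using assms by simp
  qed
  have bc: "\<bar>b - m\<bar> \<le> c"
  proof -
    have "\<bar>b - m\<bar> \<le> 1 * \<bar>a - b\<bar>" unfolding bm abs_minus_cancel abs_mult using p by (intro mult_right_mono) auto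
    then show ?thesis using assms by simp
  qed
  have sq: "(lam * x)\<^sup>2 \<le> lam\<^sup>2 * c\<^sup>2" if "\<bar>x\<bar> \<le> c" for x
  proof -
    have "x\<^sup>2 \<le> c\<^sup>2" using power_mono[OF that, of 2] by simp
    then show ?thesis by (simp add: power_mult_distrib mult_left_mono)
  qed
  have e: "exp (lam * x) \<le> lam * x + exp (lam\<^sup>2 * c\<^sup>2)" if "\<bar>x\<bar> \<le> c" for x
    using exp_le_add_exp_square[of "lam * x"] sq[OF that] by (meson add_left_mono exp_le_cancel_iff order_trans)
  have "p * exp (lam * (a - m)) + (1 - p) * exp (lam * (b - m))
      \<le> p * (lam * (a - m) + exp (lam\<^sup>2 * c\<^sup>2)) + (1 - p) * (lam * (b - m) + exp (lam\<^sup>2 * c\<^sup>2))"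
    using p ac bc by (intro add_mono mult_left_mono e) auto
  also have "\<dots> = exp (lam\<^sup>2 * c\<^sup>2)" unfolding am bm by (simp add: algebra_simps)
  finally have "exp (lam * m) * (p * exp (lam * (a - m)) + (1 - p) * exp (lam * (b - m)))
      \<le> exp (lam * m) * exp (lam\<^sup>2 * c\<^sup>2)" by (intro mult_left_mono) auto
  moreover have "exp (lam * m) * exp (lam * (x - m)) = exp (lam * x)" for x
    by (simp add: algebra_simps flip: exp_add)
  then have "exp (lam * m) * (p * exp (lam * (a - m)) + (1 - p) * exp (lam * (b - m)))
      = p * exp (lam * a) + (1 - p) * exp (lam * b)"
    by (simp only: distrib_left mult.left_commute)
  ultimately show ?thesis unfolding m_def by linarith
qed

text \<open>Averaging out one element leaves a function with the same difference bounds and costs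
  one factor, by \<open>two_point_mgf\<close>. The bound \<open>c\<close> depends on the element so
  that a statistic seeing few edges has a small total.\<close>

lemma bounded_differences_mgf:
  fixes f :: "'e set \<Rightarrow> real"
  assumes "finite E" "\<And>e F. e \<in> E \<Longrightarrow> F \<subseteq> E - {e} \<Longrightarrow> \<bar>f (insert e F) - f F\<bar> \<le> c e"
  shows "bexp p E (\<lambda>F. exp (lam * f F)) \<le> exp (lam * bexp p E f) * exp (lam\<^sup>2 * (\<Sum>e\<in>E. (c e)\<^sup>2))"
  using assms
proof (induction E arbitrary: f rule: finite_induct)
  case empty
  then show ?case by simp
next
  case (insert e E)
  define g where "g F = p * f (insert e F) + (1 - p) * f F" for F
  have IH: "bexp p E (\<lambda>F. exp (lam * g F)) \<le> exp (lam * bexp p E g) * exp (lam\<^sup>2 * (\<Sum>e\<in>E. (c e)\<^sup>2))"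
  proof (rule insert.IH)
    fix e' F assume *: "e' \<in> E" "F \<subseteq> E - {e'}"
    have "\<bar>f (insert e' (insert e F)) - f (insert e F)\<bar> \<le> c e'"
      using insert.hyps * by (intro insert.prems) auto
    then have 1: "\<bar>f (insert e (insert e' F)) - f (insert e F)\<bar> \<le> c e'" by (simp add: insert_commute)
    have 2: "\<bar>f (insert e' F) - f F\<bar> \<le> c e'" using * by (intro insert.prems) auto
    have "\<bar>g (insert e' F) - g F\<bar> = \<bar>p * (f (insert e (insert e' F)) - f (insert e F)) + (1 - p) * (f (insert e' F) - f F)\<bar>"
      by (simp add: g_def algebra_simps)
    also have "\<dots> \<le> p * \<bar>f (insert e (insert e' F)) - f (insert e F)\<bar> + (1 - p) * \<bar>f (insert e' F) - f F\<bar>"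
      using p by (intro order_trans[OF abs_triangle_ineq]) (simp add: abs_mult)
    also have "\<dots> \<le> p * c e' + (1 - p) * c e'"
      using p 1 2 by (intro add_mono mult_left_mono) auto
    finally show "\<bar>g (insert e' F) - g F\<bar> \<le> c e'" by (simp add: algebra_simps)
  qed
  have gE: "bexp p E g = bexp p (insert e E) f"
    unfolding g_def using insert.hyps by (simp add: bexp_insert bexp_add bexp_mult_left)
  have "bexp p (insert e E) (\<lambda>F. exp (lam * f F))
      = bexp p E (\<lambda>F. p * exp (lam * f (insert e F)) + (1 - p) * exp (lam * f F))"
    using insert.hyps by (simp add: bexp_insert bexp_add bexp_mult_left)
  also have "\<dots> \<le> bexp p E (\<lambda>F. exp (lam\<^sup>2 * (c e)\<^sup>2) * exp (lam * g F))"
  proof (rule bexp_mono)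
    fix F assume "F \<subseteq> E"
    then have "\<bar>f (insert e F) - f F\<bar> \<le> c e" using insert.hyps by (intro insert.prems) auto
    from two_point_mgf[OF this]
    show "p * exp (lam * f (insert e F)) + (1 - p) * exp (lam * f F) \<le> exp (lam\<^sup>2 * (c e)\<^sup>2) * exp (lam * g F)"
      by (simp add: g_def mult.commute)
  qed
  also have "\<dots> \<le> exp (lam\<^sup>2 * (c e)\<^sup>2) * (exp (lam * bexp p E g) * exp (lam\<^sup>2 * (\<Sum>e\<in>E. (c e)\<^sup>2)))"
    unfolding bexp_mult_left using IH by (intro mult_left_mono) auto
  also have "\<dots> = exp (lam * bexp p (insert e E) f) * exp (lam\<^sup>2 * (\<Sum>e\<in>insert e E. (c e)\<^sup>2))"
    using insert.hyps by (simp add: gE algebra_simps exp_add)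
  finally show ?case .
qed

lemma bounded_differences_upper_tail:
  fixes f :: "'e set \<Rightarrow> real"
  assumes fin: "finite E"
    and c: "\<And>e F. e \<in> E \<Longrightarrow> F \<subseteq> E - {e} \<Longrightarrow> \<bar>f (insert e F) - f F\<bar> \<le> c e"
    and S: "(\<Sum>e\<in>E. (c e)\<^sup>2) \<le> S" "S > 0" and t: "t \<ge> 0"
  shows "bexp p E (\<lambda>F. of_bool (f F \<ge> bexp p E f + t)) \<le> exp (- t\<^sup>2 / (4 * S))"
proof -
  \<comment> \<open>Minimises the exponent lam^2 S - lam t of the Chernoff bound.\<close>
  define lam where "lam = t / (2 * S)"
  have lam: "lam \<ge> 0" using S t by (simp add: lam_def)
  define m where "m = bexp p E f"
  have "bexp p E (\<lambda>F. of_bool (f F \<ge> m + t)) \<le> bexp p E (\<lambda>F. exp (- lam * (m + t)) * exp (lam * f F))"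
  proof (rule bexp_mono)
    fix F
    have "1 \<le> exp (- lam * (m + t)) * exp (lam * f F)" if "f F \<ge> m + t"
      using mult_left_mono[OF that lam] by (simp flip: exp_add)
    then show "of_bool (f F \<ge> m + t) \<le> exp (- lam * (m + t)) * exp (lam * f F)" by auto
  qed
  also have "\<dots> \<le> exp (- lam * (m + t)) * (exp (lam * m) * exp (lam\<^sup>2 * (\<Sum>e\<in>E. (c e)\<^sup>2)))"
    unfolding bexp_mult_left m_def by (intro mult_left_mono bounded_differences_mgf fin c) auto
  also have "\<dots> \<le> exp (- lam * (m + t)) * (exp (lam * m) * exp (lam\<^sup>2 * S))"
    using S by (intro mult_left_mono) (auto intro: mult_left_mono)
  also have "\<dots> = exp (lam\<^sup>2 * S - lam * t)"
    by (simp add: algebra_simps flip: exp_add)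
  also have "lam\<^sup>2 * S - lam * t = - t\<^sup>2 / (4 * S)"
    using S by (simp add: lam_def power2_eq_square field_simps)
  finally show ?thesis by (simp add: m_def)
qed

lemma bounded_differences_lower_tail:
  fixes f :: "'e set \<Rightarrow> real"
  assumes fin: "finite E"
    and c: "\<And>e F. e \<in> E \<Longrightarrow> F \<subseteq> E - {e} \<Longrightarrow> \<bar>f (insert e F) - f F\<bar> \<le> c e"
    and S: "(\<Sum>e\<in>E. (c e)\<^sup>2) \<le> S" "S > 0" and t: "t \<ge> 0"
  shows "bexp p E (\<lambda>F. of_bool (f F \<le> bexp p E f - t)) \<le> exp (- t\<^sup>2 / (4 * S))"
proof -
  have "bexp p E (\<lambda>F. of_bool (- f F \<ge> bexp p E (\<lambda>F. - f F) + t)) \<le> exp (- t\<^sup>2 / (4 * S))"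
  proof (rule bounded_differences_upper_tail[OF fin _ S t])
    fix e F assume "e \<in> E" "F \<subseteq> E - {e}"
    then show "\<bar>- f (insert e F) - - f F\<bar> \<le> c e" using c[of e F] by linarith
  qed
  moreover have "- f F \<ge> bexp p E (\<lambda>F. - f F) + t \<longleftrightarrow> f F \<le> bexp p E f - t" for F
    by (auto simp: bexp_minus)
  ultimately show ?thesis by simp
qed

end

section \<open>Resolvents of symmetric matrices\<close>

text \<open>The entries of the inverse of A - i t, written through eigenvectors; for t > 0 no
  denominator vanishes.\<close>

definition resolvent :: "'v set \<Rightarrow> ('v \<Rightarrow> 'v \<Rightarrow> real) \<Rightarrow> real \<Rightarrow> 'v \<Rightarrow> 'v \<Rightarrow> complex" where
  "resolvent I A t j k = (let (lam, u) = SOME (lam, u). diagonalises I A lam u in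
     \<Sum>i\<in>I. complex_of_real (u i j * u i k) / (complex_of_real (lam i) - \<i> * complex_of_real t))"

lemma resolvent_spectral:
  assumes "finite I" "symmetric_on I A"
  obtains lam u where "diagonalises I A lam u"
    and "\<And>t j k. resolvent I A t j k
      = (\<Sum>i\<in>I. complex_of_real (u i j * u i k) / (complex_of_real (lam i) - \<i> * complex_of_real t))"
proof -
  define x where "x = (SOME (lam, u). diagonalises I A lam u)"
  obtain lam u where x: "x = (lam, u)" by (cases x)
  have "\<exists>x. case x of (lam, u) \<Rightarrow> diagonalises I A lam u"
    using spectral_theorem[OF assms] by auto
  then have "case x of (lam, u) \<Rightarrow> diagonalises I A lam u"
    unfolding x_def by (rule someI_ex)
  then have "diagonalises I A lam u" by (simp add: x)
  moreover have "resolvent I A t j k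
      = (\<Sum>i\<in>I. complex_of_real (u i j * u i k) / (complex_of_real (lam i) - \<i> * complex_of_real t))" for t j k
    using x by (simp add: resolvent_def flip: x_def)
  ultimately show ?thesis using that by blast
qed

lemma shifted_eigenvalue_nonzero:
  assumes "t > 0" shows "complex_of_real l - \<i> * complex_of_real t \<noteq> 0"
  using assms by (auto simp: complex_eq_iff)

lemma resolvent_sym: "resolvent I A t j k = resolvent I A t k j"
  by (simp add: resolvent_def mult.commute)

lemma of_real_sum_of_bool:
  assumes "(\<Sum>k\<in>I. f k) = of_bool P"
  shows "(\<Sum>k\<in>I. complex_of_real (f k)) = of_bool P"
  using assms by (metis of_real_0 of_real_1 of_real_sum of_bool_def)

text \<open>On each eigenvector with eigenvalue x this is x/(x - i t) = 1 + i t/(x - i t).\<close>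

lemma mult_resolvent:
  assumes fin: "finite I" and A: "symmetric_on I A" and t: "t > 0" and jl: "j \<in> I" "l \<in> I"
  shows "(\<Sum>k\<in>I. complex_of_real (A j k) * resolvent I A t k l)
       = of_bool (j = l) + \<i> * complex_of_real t * resolvent I A t j l"
proof -
  obtain lam u where d: "diagonalises I A lam u"
    and R: "\<And>t j k. resolvent I A t j k
      = (\<Sum>i\<in>I. complex_of_real (u i j * u i k) / (complex_of_real (lam i) - \<i> * complex_of_real t))"
    using resolvent_spectral[OF fin A] by blast
  define z where "z i = complex_of_real (lam i) - \<i> * complex_of_real t" for i
  have z: "z i \<noteq> 0" for i using shifted_eigenvalue_nonzero[OF t] by (simp add: z_def)
  have "(\<Sum>k\<in>I. complex_of_real (A j k) * resolvent I A t k l)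
      = (\<Sum>k\<in>I. (\<Sum>i\<in>I. complex_of_real (lam i * u i j * u i k)) * (\<Sum>m\<in>I. complex_of_real (u m k * u m l) / z m))"
    using d jl by (simp add: R diagonalises_def z_def)
  also have "\<dots> = (\<Sum>k\<in>I. \<Sum>i\<in>I. \<Sum>m\<in>I. (lam i * u i j * u m l / z m) * complex_of_real (u i k * u m k))"
    unfolding sum_product by (intro sum.cong refl) simp
  also have "\<dots> = (\<Sum>i\<in>I. \<Sum>m\<in>I. \<Sum>k\<in>I. (lam i * u i j * u m l / z m) * complex_of_real (u i k * u m k))"
    by (rule sum_swap3)
  also have "\<dots> = (\<Sum>i\<in>I. \<Sum>m\<in>I. (lam i * u i j * u m l / z m) * of_bool (i = m))"
  proof (intro sum.cong refl)
    fix i m assume im: "i \<in> I" "m \<in> I"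
    have "(\<Sum>k\<in>I. complex_of_real (u i k * u m k)) = of_bool (i = m)"
      using d im by (intro of_real_sum_of_bool) (simp add: diagonalises_def orthonormal_system_def)
    then show "(\<Sum>k\<in>I. (lam i * u i j * u m l / z m) * complex_of_real (u i k * u m k))
        = (lam i * u i j * u m l / z m) * of_bool (i = m)"
      unfolding sum_distrib_left[symmetric] by simp
  qed
  also have "\<dots> = (\<Sum>i\<in>I. lam i * u i j * u i l / z i)"
    by (intro sum.cong refl sum_mult_of_bool(2)[OF fin])
  also have "\<dots> = (\<Sum>i\<in>I. complex_of_real (u i j * u i l) + \<i> * t * (complex_of_real (u i j * u i l) / z i))"
  proof (intro sum.cong refl)
    fix i
    have "complex_of_real (lam i) = z i + \<i> * t" by (simp add: z_def)
    then have "lam i * u i j * u i l / z i = (z i + \<i> * t) * complex_of_real (u i j * u i l) / z i"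
      by (simp add: mult.assoc)
    also have "\<dots> = complex_of_real (u i j * u i l) + \<i> * t * (complex_of_real (u i j * u i l) / z i)"
      using z[of i] by (simp add: distrib_right add_divide_distrib)
    finally show "lam i * u i j * u i l / z i = complex_of_real (u i j * u i l) + \<i> * t * (complex_of_real (u i j * u i l) / z i)" .
  qed
  also have "\<dots> = of_bool (j = l) + \<i> * complex_of_real t * resolvent I A t j l"
  proof -
    have "(\<Sum>i\<in>I. complex_of_real (u i j * u i l)) = of_bool (j = l)"
      using d jl by (intro of_real_sum_of_bool) (simp add: diagonalises_def orthonormal_system_def)
    then show ?thesis unfolding sum.distrib sum_distrib_left[symmetric] R z_def by simp
  qed
  finally show ?thesis .
qed

text \<open>A row of the resolvent has coefficients u i j/(lam i - i t) in the eigenbasis. Parseval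
  for real and imaginary parts and |lam i - i t| \<ge> t give the bound; summing entrywise bounds
  would lose a factor \<open>card I\<close>.\<close>

lemma sum_norm_resolvent_le:
  assumes fin: "finite I" and A: "symmetric_on I A" and t: "t > 0" and j: "j \<in> I"
  shows "(\<Sum>k\<in>I. (cmod (resolvent I A t j k))\<^sup>2) \<le> 1 / t\<^sup>2"
proof -
  obtain lam u where d: "diagonalises I A lam u"
    and R: "\<And>t j k. resolvent I A t j k
      = (\<Sum>i\<in>I. complex_of_real (u i j * u i k) / (complex_of_real (lam i) - \<i> * complex_of_real t))"
    using resolvent_spectral[OF fin A] by blast
  define z where "z i = complex_of_real (lam i) - \<i> * complex_of_real t" for i
  define c where "c i = complex_of_real (u i j) / z i" for i
  have ut: "orthonormal_system I (\<lambda>k i. u i k)"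
    using d by (simp add: diagonalises_def orthonormal_system_def)
  have "(cmod (resolvent I A t j k))\<^sup>2 = (\<Sum>i\<in>I. Re (c i) * u i k)\<^sup>2 + (\<Sum>i\<in>I. Im (c i) * u i k)\<^sup>2" for k
  proof -
    have "resolvent I A t j k = (\<Sum>i\<in>I. c i * complex_of_real (u i k))"
      by (simp add: R c_def z_def)
    then show ?thesis by (simp add: cmod_power2)
  qed
  then have "(\<Sum>k\<in>I. (cmod (resolvent I A t j k))\<^sup>2) = (\<Sum>i\<in>I. (Re (c i))\<^sup>2) + (\<Sum>i\<in>I. (Im (c i))\<^sup>2)"
    by (simp add: sum.distrib parseval[OF fin ut])
  also have "\<dots> = (\<Sum>i\<in>I. (cmod (c i))\<^sup>2)" by (simp add: cmod_power2 sum.distrib)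
  also have "\<dots> \<le> (\<Sum>i\<in>I. (u i j)\<^sup>2 / t\<^sup>2)"
  proof (rule sum_mono)
    fix i
    have "(cmod (z i))\<^sup>2 = (lam i)\<^sup>2 + t\<^sup>2" by (simp add: z_def cmod_power2)
    then have "(cmod (c i))\<^sup>2 = (u i j)\<^sup>2 / ((lam i)\<^sup>2 + t\<^sup>2)"
      by (simp add: c_def norm_divide power_divide)
    also have "\<dots> \<le> (u i j)\<^sup>2 / t\<^sup>2" using t by (intro divide_left_mono) (auto simp: sum_power2_gt_zero_iff)
    finally show "(cmod (c i))\<^sup>2 \<le> (u i j)\<^sup>2 / t\<^sup>2" .
  qed
  also have "\<dots> = 1 / t\<^sup>2"
    using d j by (simp add: diagonalises_def orthonormal_system_def power2_eq_square flip: sum_divide_distrib)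
  finally show ?thesis .
qed

lemma norm_resolvent_le:
  assumes fin: "finite I" and A: "symmetric_on I A" and t: "t > 0" and j: "j \<in> I" and k: "k \<in> I"
  shows "cmod (resolvent I A t j k) \<le> 1 / t"
proof (rule power2_le_imp_le)
  have "(cmod (resolvent I A t j k))\<^sup>2 \<le> (\<Sum>k\<in>I. (cmod (resolvent I A t j k))\<^sup>2)"
    using fin k by (intro member_le_sum) auto
  then show "(cmod (resolvent I A t j k))\<^sup>2 \<le> (1 / t)\<^sup>2"
    using sum_norm_resolvent_le[OF fin A t j] by (simp add: power_divide)
qed (use t in simp)

text \<open>In the product R_B A R_A the matrix A is absorbed by the right factor, in R_B B R_A the
  matrix B by the left one; the common term i t R_B R_A cancels in the difference.\<close>

lemma resolvent_identity:
  assumes fin: "finite I" and A: "symmetric_on I A" and B: "symmetric_on I B" and t: "t > 0"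
    and jl: "j \<in> I" "l \<in> I"
  shows "resolvent I B t j l - resolvent I A t j l
       = (\<Sum>a\<in>I. \<Sum>b\<in>I. resolvent I B t j a * complex_of_real (A a b - B a b) * resolvent I A t b l)"
proof -
  define RA where "RA = resolvent I A t"
  define RB where "RB = resolvent I B t"
  have "(\<Sum>a\<in>I. \<Sum>b\<in>I. RB j a * complex_of_real (A a b) * RA b l) = (\<Sum>a\<in>I. RB j a * (of_bool (a = l) + \<i> * t * RA a l))"
    using mult_resolvent[OF fin A t _ jl(2)]
    by (intro sum.cong refl) (simp add: RA_def mult.assoc flip: sum_distrib_left)
  also have "\<dots> = RB j l + (\<Sum>a\<in>I. \<i> * t * (RB j a * RA a l))"
    using fin jl by (simp add: distrib_left sum.distrib sum_mult_of_bool mult_ac)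
  finally have 1: "(\<Sum>a\<in>I. \<Sum>b\<in>I. RB j a * complex_of_real (A a b) * RA b l) = RB j l + (\<Sum>a\<in>I. \<i> * t * (RB j a * RA a l))" .
  have "(\<Sum>a\<in>I. \<Sum>b\<in>I. RB j a * complex_of_real (B a b) * RA b l) = (\<Sum>b\<in>I. \<Sum>a\<in>I. RB j a * complex_of_real (B a b) * RA b l)"
    by (rule sum.swap)
  also have "\<dots> = (\<Sum>b\<in>I. (\<Sum>a\<in>I. complex_of_real (B b a) * RB a j) * RA b l)"
    unfolding sum_distrib_right using B jl
    by (intro sum.cong refl) (simp add: RB_def resolvent_sym[of I B t j] symmetric_on_def)
  also have "\<dots> = (\<Sum>b\<in>I. (of_bool (b = j) + \<i> * t * RB b j) * RA b l)"
    using mult_resolvent[OF fin B t _ jl(1)] by (intro sum.cong refl) (simp add: RB_def)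
  also have "\<dots> = RA j l + (\<Sum>a\<in>I. \<i> * t * (RB j a * RA a l))"
  proof -
    have "(of_bool (b = j) + \<i> * t * RB b j) * RA b l = of_bool (b = j) * RA b l + \<i> * t * (RB j b * RA b l)" for b
      unfolding RB_def by (subst resolvent_sym) (simp add: distrib_right mult.assoc)
    then show ?thesis using fin jl by (simp add: sum.distrib sum_mult_of_bool)
  qed
  finally have 2: "(\<Sum>a\<in>I. \<Sum>b\<in>I. RB j a * complex_of_real (B a b) * RA b l) = RA j l + (\<Sum>a\<in>I. \<i> * t * (RB j a * RA a l))" .
  have "(\<Sum>a\<in>I. \<Sum>b\<in>I. RB j a * complex_of_real (A a b - B a b) * RA b l)
      = (\<Sum>a\<in>I. \<Sum>b\<in>I. RB j a * complex_of_real (A a b) * RA b l) - (\<Sum>a\<in>I. \<Sum>b\<in>I. RB j a * complex_of_real (B a b) * RA b l)"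
    by (simp add: algebra_simps sum_subtractf)
  then show ?thesis unfolding 1 2 by (simp add: RA_def RB_def)
qed

section \<open>Effect of changing one edge on the resolvent and on its trace\<close>

definition edge_perturbation ::
    "'v set \<Rightarrow> 'v \<Rightarrow> 'v \<Rightarrow> ('v \<Rightarrow> 'v \<Rightarrow> real) \<Rightarrow> ('v \<Rightarrow> 'v \<Rightarrow> real) \<Rightarrow> real \<Rightarrow> bool" where
  "edge_perturbation I a b A B s \<longleftrightarrow> a \<in> I \<and> b \<in> I \<and> a \<noteq> b \<and> symmetric_on I A \<and> symmetric_on I B \<and>
     (\<forall>j\<in>I. \<forall>k\<in>I. B j k = A j k + s * of_bool ({j, k} = {a, b}))"

lemma resolvent_edge_perturbation:
  assumes fin: "finite I" and P: "edge_perturbation I a b A B s" and t: "t > 0" and jl: "j \<in> I" "l \<in> I"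
  shows "resolvent I B t j l - resolvent I A t j l
    = - complex_of_real s * (resolvent I B t j a * resolvent I A t b l + resolvent I B t j b * resolvent I A t a l)"
proof -
  have ab: "a \<in> I" "b \<in> I" "a \<noteq> b" and sym: "symmetric_on I A" "symmetric_on I B"
    using P by (auto simp: edge_perturbation_def)
  have "resolvent I B t j l - resolvent I A t j l
      = (\<Sum>x\<in>I. \<Sum>y\<in>I. resolvent I B t j x * complex_of_real (A x y - B x y) * resolvent I A t y l)"
    by (rule resolvent_identity[OF fin sym t jl])
  also have "\<dots> = (\<Sum>x\<in>I. \<Sum>y\<in>I. (- s * resolvent I B t j x * resolvent I A t y l * of_bool (x = a)) * of_bool (y = b)
      + (- s * resolvent I B t j x * resolvent I A t y l * of_bool (x = b)) * of_bool (y = a))"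
    using P ab(3) by (intro sum.cong refl) (auto simp: edge_perturbation_def doubleton_eq_iff)
  also have "\<dots> = (\<Sum>x\<in>I. (- s * resolvent I B t j x * resolvent I A t b l) * of_bool (x = a)
      + (- s * resolvent I B t j x * resolvent I A t a l) * of_bool (x = b))"
    unfolding sum.distrib sum_mult_of_bool(1)[OF fin ab(1)] sum_mult_of_bool(1)[OF fin ab(2)] by simp
  also have "\<dots> = - s * (resolvent I B t j a * resolvent I A t b l + resolvent I B t j b * resolvent I A t a l)"
    unfolding sum.distrib sum_mult_of_bool(1)[OF fin ab(1)] sum_mult_of_bool(1)[OF fin ab(2)]
    by (simp add: algebra_simps)
  finally show ?thesis by simp
qed

lemma resolvent_edge_perturbation_le:
  assumes fin: "finite I" and P: "edge_perturbation I a b A B s" and s: "\<bar>s\<bar> \<le> 1" and t: "t > 0"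
    and jl: "j \<in> I" "l \<in> I"
  shows "cmod (resolvent I B t j l - resolvent I A t j l) \<le> 2 / t\<^sup>2"
proof -
  have ab: "a \<in> I" "b \<in> I" and sym: "symmetric_on I A" "symmetric_on I B"
    using P by (auto simp: edge_perturbation_def)
  let ?x = "resolvent I B t j a * resolvent I A t b l + resolvent I B t j b * resolvent I A t a l"
  have "cmod ?x \<le> 1 / t * (1 / t) + 1 / t * (1 / t)"
    unfolding norm_mult[symmetric] using t
    by (intro norm_triangle_le add_mono; unfold norm_mult; intro mult_mono norm_resolvent_le fin sym ab jl) auto
  then have "cmod ?x \<le> 2 / t\<^sup>2" by (simp add: power2_eq_square)
  moreover have "\<bar>s\<bar> * cmod ?x \<le> 1 * cmod ?x" using s by (intro mult_right_mono) auto
  ultimately show ?thesis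
    unfolding resolvent_edge_perturbation[OF fin P t jl] by (simp add: norm_mult)
qed

definition resolvent_trace :: "'v set \<Rightarrow> ('v \<Rightarrow> 'v \<Rightarrow> real) \<Rightarrow> real \<Rightarrow> complex" where
  "resolvent_trace I A t = (\<Sum>j\<in>I. resolvent I A t j j)"

text \<open>The bound does not grow with \<open>I\<close>: the difference is, up to the factor
  \<open>s\<close>, a sum of two inner products of resolvent rows, and each row has norm at most
  1/t.\<close>

lemma resolvent_trace_edge_perturbation_le:
  assumes fin: "finite I" and P: "edge_perturbation I a b A B s" and s: "\<bar>s\<bar> \<le> 1" and t: "t > 0"
  shows "cmod (resolvent_trace I B t - resolvent_trace I A t) \<le> 2 / t\<^sup>2"
proof -
  have ab: "a \<in> I" "b \<in> I" and sym: "symmetric_on I A" "symmetric_on I B"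
    using P by (auto simp: edge_perturbation_def)
  define RA where "RA = resolvent I A t"
  define RB where "RB = resolvent I B t"
  have cs: "cmod (\<Sum>j\<in>I. RB j x * RA y j) \<le> 1 / t\<^sup>2" if xy: "x \<in> I" "y \<in> I" for x y
  proof -
    have "cmod (\<Sum>j\<in>I. RB j x * RA y j) \<le> (\<Sum>j\<in>I. (cmod (RB x j))\<^sup>2 / 2 + (cmod (RA y j))\<^sup>2 / 2)"
    proof (intro order_trans[OF norm_sum] sum_mono)
      fix j
      have "0 \<le> (cmod (RB x j) - cmod (RA y j))\<^sup>2" by simp
      then have "cmod (RB x j) * cmod (RA y j) \<le> (cmod (RB x j))\<^sup>2 / 2 + (cmod (RA y j))\<^sup>2 / 2"
        by (simp add: power2_diff)
      then show "cmod (RB j x * RA y j) \<le> (cmod (RB x j))\<^sup>2 / 2 + (cmod (RA y j))\<^sup>2 / 2"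
        by (simp add: norm_mult RB_def resolvent_sym[of I B t j])
    qed
    also have "\<dots> \<le> (1 / t\<^sup>2) / 2 + (1 / t\<^sup>2) / 2"
      unfolding sum.distrib sum_divide_distrib[symmetric] RA_def RB_def
      by (intro add_mono divide_right_mono sum_norm_resolvent_le fin sym t xy) auto
    finally show ?thesis by simp
  qed
  have "resolvent_trace I B t - resolvent_trace I A t
      = - s * ((\<Sum>j\<in>I. RB j a * RA b j) + (\<Sum>j\<in>I. RB j b * RA a j))"
    unfolding resolvent_trace_def sum_subtractf[symmetric] RA_def RB_def sum.distrib[symmetric] sum_distrib_left
    by (intro sum.cong refl) (use resolvent_edge_perturbation[OF fin P t] in simp)
  moreover have "cmod ((\<Sum>j\<in>I. RB j a * RA b j) + (\<Sum>j\<in>I. RB j b * RA a j)) \<le> 1 / t\<^sup>2 + 1 / t\<^sup>2"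
    using ab by (intro norm_triangle_le add_mono cs)
  moreover have "\<bar>s\<bar> * x \<le> 1 * x" if "x \<ge> 0" for x using s that by (intro mult_right_mono) auto
  ultimately show ?thesis
    by (simp add: norm_mult) (meson norm_ge_zero order_trans)
qed

text \<open>A single diagonalisation serves both the trace norm and the resolvent trace; for an
  eigenvalue x, Im (1/(x - i t)) = t/(x^2 + t^2).\<close>

lemma resolvent_trace_spectral:
  assumes fin: "finite I" and A: "symmetric_on I A"
  obtains lam u where "diagonalises I A lam u" "trace_norm I A = (\<Sum>i\<in>I. \<bar>lam i\<bar>)"
    and "\<And>t. t > 0 \<Longrightarrow> Im (resolvent_trace I A t) = (\<Sum>i\<in>I. t / ((lam i)\<^sup>2 + t\<^sup>2))"
proof -
  obtain lam u where d: "diagonalises I A lam u"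
    and R: "\<And>t j k. resolvent I A t j k
      = (\<Sum>i\<in>I. complex_of_real (u i j * u i k) / (complex_of_real (lam i) - \<i> * complex_of_real t))"
    using resolvent_spectral[OF fin A] by blast
  have "Im (resolvent_trace I A t) = (\<Sum>i\<in>I. t / ((lam i)\<^sup>2 + t\<^sup>2))" if t: "t > 0" for t
  proof -
    define z where "z i = complex_of_real (lam i) - \<i> * complex_of_real t" for i
    have "resolvent_trace I A t = (\<Sum>i\<in>I. \<Sum>j\<in>I. complex_of_real (u i j * u i j) / z i)"
      unfolding resolvent_trace_def R z_def by (rule sum.swap)
    also have "\<dots> = (\<Sum>i\<in>I. 1 / z i)"
      using d of_real_sum_of_bool[of "\<lambda>j. u i j * u i j" I True for i]
      by (intro sum.cong refl) (simp add: diagonalises_def orthonormal_system_def flip: sum_divide_distrib of_real_mult)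
    finally have "Im (resolvent_trace I A t) = (\<Sum>i\<in>I. Im (1 / z i))" by simp
    also have "\<dots> = (\<Sum>i\<in>I. t / ((lam i)\<^sup>2 + t\<^sup>2))"
      by (intro sum.cong refl) (simp add: z_def Im_divide)
    finally show ?thesis .
  qed
  then show ?thesis using that d trace_norm_eq[OF fin d] by blast
qed

section \<open>The self-consistent equation for the expected resolvent\<close>

definition all_edges :: "'v set \<Rightarrow> 'v set set" where
  "all_edges I = {{j, k} | j k. j \<in> I \<and> k \<in> I \<and> j \<noteq> k}"

text \<open>\<open>S\<close> is the set of pairs that carry randomness. Using the same
  \<open>F\<close> with different \<open>S\<close> couples the matrices of different graphs.\<close>

definition centred :: "real \<Rightarrow> 'v set set \<Rightarrow> 'v set set \<Rightarrow> 'v \<Rightarrow> 'v \<Rightarrow> real" where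
  "centred p S F j k = (if {j, k} \<in> S then of_bool ({j, k} \<in> F) - p else 0)"

lemma all_edges_image: "all_edges I \<subseteq> (\<lambda>(j, k). {j, k}) ` (I \<times> I)"
  by (auto simp: all_edges_def)

lemma finite_all_edges: "finite I \<Longrightarrow> finite (all_edges I)"
  by (rule finite_subset[OF all_edges_image]) simp

lemma card_all_edges_le: "finite I \<Longrightarrow> card (all_edges I) \<le> (card I)\<^sup>2"
proof -
  assume fin: "finite I"
  have "card (all_edges I) \<le> card ((\<lambda>(j, k). {j, k}) ` (I \<times> I))"
    using fin by (intro card_mono all_edges_image) auto
  also have "\<dots> \<le> card (I \<times> I)" using fin by (intro card_image_le) auto
  finally show ?thesis by (simp add: card_cartesian_product power2_eq_square)
qed

lemma doubleton_mem_all_edges: "{j, k} \<in> all_edges I \<longleftrightarrow> j \<in> I \<and> k \<in> I \<and> j \<noteq> k"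
  by (auto simp: all_edges_def doubleton_eq_iff)

lemma centred_symmetric: "symmetric_on I (centred p S F)"
  by (simp add: symmetric_on_def centred_def insert_commute)

lemma centred_edge_perturbation:
  assumes "a \<in> I" "b \<in> I" "a \<noteq> b" "{a, b} \<in> S" "\<And>e. e \<noteq> {a, b} \<Longrightarrow> e \<in> F \<longleftrightarrow> e \<in> F'"
  shows "edge_perturbation I a b (centred p S F) (centred p S F')
    (of_bool ({a, b} \<in> F') - of_bool ({a, b} \<in> F))"
  unfolding edge_perturbation_def
proof (intro conjI ballI centred_symmetric assms(1-3))
  fix j k
  show "centred p S F' j k = centred p S F j k
      + (of_bool ({a, b} \<in> F') - of_bool ({a, b} \<in> F)) * of_bool ({j, k} = {a, b})"
    using assms(4,5) by (cases "{j, k} = {a, b}") (auto simp: centred_def)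
qed

lemma centred_abs_le: "0 < p \<Longrightarrow> p < 1 \<Longrightarrow> \<bar>centred p S F j k\<bar> \<le> 1"
  by (auto simp: centred_def)

context
  fixes p :: real
  assumes p: "0 < p" "p < 1"
begin

text \<open>The square carries no conjugate, yet |E (f - m)^2| is at most E |f - m|^2, which splits
  into the variances of real and imaginary part.\<close>

lemma bexp_complex_variance:
  fixes f :: "'e set \<Rightarrow> complex" and c :: real
  assumes fin: "finite E"
    and c: "\<And>e F. e \<in> E \<Longrightarrow> F \<subseteq> E - {e} \<Longrightarrow> cmod (f (insert e F) - f F) \<le> c"
  shows "cmod (bexp p E (\<lambda>F. (f F)\<^sup>2) - (bexp p E f)\<^sup>2) \<le> 2 * card E * c\<^sup>2"
proof -
  define m where "m = bexp p E f"
  have re: "bexp p E (\<lambda>F. Re (f F)) = Re m" and im: "bexp p E (\<lambda>F. Im (f F)) = Im m"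
    unfolding m_def by (rule bexp_bounded_linear[OF bounded_linear_Re], rule bexp_bounded_linear[OF bounded_linear_Im])
  have "bexp p E (\<lambda>F. (f F - m)\<^sup>2) = bexp p E (\<lambda>F. (f F)\<^sup>2 - 2 * m * f F + m\<^sup>2)"
    by (intro bexp_cong) (simp add: power2_eq_square algebra_simps)
  also have "\<dots> = bexp p E (\<lambda>F. (f F)\<^sup>2) - m\<^sup>2"
    using fin by (simp add: bexp_add bexp_diff bexp_mult_left bexp_const power2_eq_square flip: m_def)
  finally have "cmod (bexp p E (\<lambda>F. (f F)\<^sup>2) - m\<^sup>2) \<le> bexp p E (\<lambda>F. cmod ((f F - m)\<^sup>2))"
    using norm_bexp_le[OF p, of E "\<lambda>F. (f F - m)\<^sup>2"] by simp
  also have "\<dots> = bexp p E (\<lambda>F. ((Re (f F))\<^sup>2 - 2 * Re m * Re (f F) + (Re m)\<^sup>2)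
      + ((Im (f F))\<^sup>2 - 2 * Im m * Im (f F) + (Im m)\<^sup>2))"
    unfolding norm_power cmod_power2 by (intro bexp_cong) (simp add: power2_diff mult_ac)
  also have "\<dots> = (bexp p E (\<lambda>F. (Re (f F))\<^sup>2) - (bexp p E (\<lambda>F. Re (f F)))\<^sup>2)
      + (bexp p E (\<lambda>F. (Im (f F))\<^sup>2) - (bexp p E (\<lambda>F. Im (f F)))\<^sup>2)"
    using fin by (simp add: bexp_add bexp_diff bexp_mult_left bexp_const re im power2_eq_square)
  also have "\<dots> \<le> card E * c\<^sup>2 + card E * c\<^sup>2"
  proof (intro add_mono efron_stein p fin)
    fix e F assume "e \<in> E" "F \<subseteq> E - {e}"
    note * = c[OF this]
    show "\<bar>Re (f (insert e F)) - Re (f F)\<bar> \<le> c"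
      using order_trans[OF abs_Re_le_cmod *] by simp
    show "\<bar>Im (f (insert e F)) - Im (f F)\<bar> \<le> c"
      using order_trans[OF abs_Im_le_cmod *] by simp
  qed
  finally show ?thesis by (simp add: m_def)
qed

text \<open>With W the centred matrix, R its resolvent and T the trace of R,
  \<open>mult_resolvent\<close> gives N + i t T as the trace of W R. Integration by parts turns the
  expectation into -p(1-p) times that of T^2 up to the remainder \<open>D\<close>, and the small
  variance of T replaces the mean of T^2 by m^2.\<close>

lemma self_consistent_equation:
  fixes I :: "'v set"
  assumes fin: "finite I" and t: "t > 0"
  defines "K \<equiv> all_edges I" and "N \<equiv> real (card I)"
  defines "m \<equiv> bexp p K (\<lambda>F. resolvent_trace I (centred p K F) t)"
  shows "cmod (of_real N + \<i> * of_real t * m + of_real (p * (1 - p)) * m\<^sup>2)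
    \<le> 2 * N / t\<^sup>2 + N\<^sup>2 * (16 / t ^ 4 + 4 / t ^ 3)"
proof -
  define R where "R F = resolvent I (centred p K F) t" for F
  define T where "T F = resolvent_trace I (centred p K F) t" for F
  define s where "s = p * (1 - p)"
  have s: "0 \<le> s" "s \<le> 1" using p by (auto simp: s_def mult_le_one)
  have finK: "finite K" unfolding K_def by (rule finite_all_edges[OF fin])
  have sym: "symmetric_on I (centred p K F)" for F by (rule centred_symmetric)
  \<comment> \<open>\<open>D\<close> is the error of replacing the products at the two graphs with
    and without the edge by R k k R j j at \<open>F\<close>. On the diagonal there is no edge, and
    the chosen value makes D - R k k R j j vanish there.\<close>
  define D where "D F j k = (if j = k then R F k k * R F j j else
     R F k k * R F j j - (R (insert {j, k} F) k j * R (F - {{j, k}}) k j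
       + R (insert {j, k} F) k k * R (F - {{j, k}}) j j))" for F j k
  have stein: "bexp p K (\<lambda>F. centred p K F j k * R F k j)
      = of_real s * bexp p K (\<lambda>F. D F j k - R F k k * R F j j)" if jk: "j \<in> I" "k \<in> I" for j k
  proof (cases "j = k")
    case True
    then have "{j, k} \<notin> K" by (auto simp: K_def all_edges_def)
    then show ?thesis using True finK by (simp add: centred_def D_def bexp_const)
  next
    case False
    then have e: "{j, k} \<in> K" using jk by (simp add: K_def doubleton_mem_all_edges)
    have "bexp p K (\<lambda>F. centred p K F j k * R F k j)
        = bexp p K (\<lambda>F. (of_bool ({j, k} \<in> F) - p) *\<^sub>R R F k j)"
      using e by (intro bexp_cong) (simp add: centred_def scaleR_conv_of_real)
    also have "\<dots> = s *\<^sub>R bexp p K (\<lambda>F. R (insert {j, k} F) k j - R (F - {{j, k}}) k j)"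
      unfolding s_def by (rule bexp_stein[OF finK e])
    also have "bexp p K (\<lambda>F. R (insert {j, k} F) k j - R (F - {{j, k}}) k j)
        = bexp p K (\<lambda>F. D F j k - R F k k * R F j j)"
    proof (rule bexp_cong)
      fix F
      have "edge_perturbation I j k (centred p K (F - {{j, k}})) (centred p K (insert {j, k} F))
          (of_bool ({j, k} \<in> insert {j, k} F) - of_bool ({j, k} \<in> F - {{j, k}}))"
        using jk False e by (intro centred_edge_perturbation) auto
      then have "edge_perturbation I j k (centred p K (F - {{j, k}})) (centred p K (insert {j, k} F)) 1" by simp
      from resolvent_edge_perturbation[OF fin this t jk(2,1)]
      show "R (insert {j, k} F) k j - R (F - {{j, k}}) k j = D F j k - R F k k * R F j j"
        using False by (simp add: R_def D_def)
    qed
    finally show ?thesis by (simp add: scaleR_conv_of_real)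
  qed
  \<comment> \<open>The squared entry is kept because its sum is at most N/t^2 by the row bound; the
    entrywise bound would give N^2/t^2, which at t of order sqrt N is as large as the main
    term.\<close>
  have Dle: "cmod (D F j k) \<le> 2 * (cmod (R F k j))\<^sup>2 + (8 / t ^ 4 + 4 / t ^ 3)"
    if jk: "j \<in> I" "k \<in> I" for F j k
  proof (cases "j = k")
    case True
    have "cmod (D F j k) = (cmod (R F k j))\<^sup>2" using True by (simp add: D_def norm_mult power2_eq_square)
    moreover have "0 \<le> 8 / t ^ 4 + 4 / t ^ 3" using t by simp
    ultimately show ?thesis using zero_le_power2[of "cmod (R F k j)"] by linarith
  next
    case False
    then have e: "{j, k} \<in> K" using jk by (simp add: K_def doubleton_mem_all_edges)
    have diff: "cmod (R F' x y - R F x y) \<le> 2 / t\<^sup>2"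
      if F': "F' = insert {j, k} F \<or> F' = F - {{j, k}}" and xy: "x \<in> I" "y \<in> I" for F' x y
    proof -
      have "edge_perturbation I j k (centred p K F) (centred p K F')
          (of_bool ({j, k} \<in> F') - of_bool ({j, k} \<in> F))"
        using jk False e F' by (intro centred_edge_perturbation) auto
      then show ?thesis
        unfolding R_def by (rule resolvent_edge_perturbation_le[OF fin _ _ t xy]) auto
    qed
    have bd: "cmod (R F' x y) \<le> 1 / t" if "x \<in> I" "y \<in> I" for F' x y
      unfolding R_def by (rule norm_resolvent_le[OF fin sym t that])
    define x1 where "x1 = R (insert {j, k} F) k j"
    define x0 where "x0 = R (F - {{j, k}}) k j"
    define y1 where "y1 = R (insert {j, k} F) k k"
    define y0 where "y0 = R (F - {{j, k}}) j j"
    define c where "c = 2 / t\<^sup>2"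
    have c: "c \<ge> 0" using t by (simp add: c_def)
    have x: "cmod x1 \<le> cmod (R F k j) + c" "cmod x0 \<le> cmod (R F k j) + c"
      using diff[of "insert {j, k} F" k j] diff[of "F - {{j, k}}" k j] jk
        norm_triangle_ineq2[of x1 "R F k j"] norm_triangle_ineq2[of x0 "R F k j"]
      unfolding x1_def x0_def c_def by auto
    have "cmod (x1 * x0) \<le> (cmod (R F k j) + c) * (cmod (R F k j) + c)"
      unfolding norm_mult using x c by (intro mult_mono) auto
    also have "\<dots> \<le> 2 * (cmod (R F k j))\<^sup>2 + 2 * c\<^sup>2"
      using sum_squares_bound[of "cmod (R F k j)" c] by (simp add: power2_eq_square algebra_simps)
    also have "2 * c\<^sup>2 = 8 / t ^ 4" by (simp add: c_def power_divide flip: power_mult)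
    finally have 1: "cmod (x1 * x0) \<le> 2 * (cmod (R F k j))\<^sup>2 + 8 / t ^ 4" .
    have "R F k k * R F j j - y1 * y0 = - ((y1 - R F k k) * y0 + R F k k * (y0 - R F j j))"
      by (simp add: algebra_simps)
    then have "cmod (R F k k * R F j j - y1 * y0) \<le> cmod ((y1 - R F k k) * y0) + cmod (R F k k * (y0 - R F j j))"
      by (metis norm_minus_cancel norm_triangle_ineq)
    also have "\<dots> \<le> c * (1 / t) + (1 / t) * c"
      unfolding norm_mult y1_def y0_def c_def using t jk
      by (intro add_mono mult_mono diff bd) auto
    also have "\<dots> = 4 / t ^ 3" by (simp add: c_def power2_eq_square power3_eq_cube)
    finally have 2: "cmod (R F k k * R F j j - y1 * y0) \<le> 4 / t ^ 3" .
    have "D F j k = (R F k k * R F j j - y1 * y0) - x1 * x0"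
      using False by (simp add: D_def x1_def x0_def y1_def y0_def)
    then have "cmod (D F j k) \<le> cmod (R F k k * R F j j - y1 * y0) + cmod (x1 * x0)"
      by (simp add: norm_triangle_ineq4)
    then show ?thesis using 1 2 by linarith
  qed
  have "cmod (bexp p K (\<lambda>F. \<Sum>j\<in>I. \<Sum>k\<in>I. D F j k)) \<le> bexp p K (\<lambda>F. cmod (\<Sum>j\<in>I. \<Sum>k\<in>I. D F j k))"
    by (rule norm_bexp_le[OF p])
  also have "\<dots> \<le> 2 * N / t\<^sup>2 + N\<^sup>2 * (8 / t ^ 4 + 4 / t ^ 3)"
  proof (rule bexp_le_const[OF p finK])
    fix F
    have "cmod (\<Sum>j\<in>I. \<Sum>k\<in>I. D F j k) \<le> (\<Sum>j\<in>I. \<Sum>k\<in>I. 2 * (cmod (R F j k))\<^sup>2 + (8 / t ^ 4 + 4 / t ^ 3))"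
    proof (intro order_trans[OF norm_sum] sum_mono)
      fix j k assume "j \<in> I" "k \<in> I"
      then show "cmod (D F j k) \<le> 2 * (cmod (R F j k))\<^sup>2 + (8 / t ^ 4 + 4 / t ^ 3)"
        using Dle[of j k F] unfolding R_def by (subst resolvent_sym)
    qed
    also have "\<dots> = 2 * (\<Sum>j\<in>I. \<Sum>k\<in>I. (cmod (R F j k))\<^sup>2) + N\<^sup>2 * (8 / t ^ 4 + 4 / t ^ 3)"
      by (simp add: sum.distrib sum_distrib_left N_def power2_eq_square distrib_left mult.assoc)
    also have "(\<Sum>j\<in>I. \<Sum>k\<in>I. (cmod (R F j k))\<^sup>2) \<le> (\<Sum>j\<in>I. 1 / t\<^sup>2)"
      unfolding R_def by (intro sum_mono sum_norm_resolvent_le[OF fin sym t])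
    finally show "cmod (\<Sum>j\<in>I. \<Sum>k\<in>I. D F j k) \<le> 2 * N / t\<^sup>2 + N\<^sup>2 * (8 / t ^ 4 + 4 / t ^ 3)"
      by (simp add: N_def)
  qed
  finally have Dsum: "cmod (bexp p K (\<lambda>F. \<Sum>j\<in>I. \<Sum>k\<in>I. D F j k)) \<le> 2 * N / t\<^sup>2 + N\<^sup>2 * (8 / t ^ 4 + 4 / t ^ 3)" .
  have "bexp p K (\<lambda>F. \<Sum>j\<in>I. \<Sum>k\<in>I. centred p K F j k * R F k j) = bexp p K (\<lambda>F. of_real N + \<i> * t * T F)"
  proof (rule bexp_cong)
    fix F
    have "(\<Sum>j\<in>I. \<Sum>k\<in>I. centred p K F j k * R F k j) = (\<Sum>j\<in>I. of_bool (j = j) + \<i> * t * R F j j)"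
      unfolding R_def by (intro sum.cong refl mult_resolvent[OF fin sym t])
    also have "\<dots> = of_real N + \<i> * t * T F"
      unfolding R_def T_def resolvent_trace_def N_def by (simp add: sum.distrib sum_distrib_left)
    finally show "(\<Sum>j\<in>I. \<Sum>k\<in>I. centred p K F j k * R F k j) = of_real N + \<i> * t * T F" .
  qed
  also have "\<dots> = of_real N + \<i> * t * m"
    using finK by (simp add: bexp_add bexp_mult_left bexp_const m_def T_def)
  finally have 1: "bexp p K (\<lambda>F. \<Sum>j\<in>I. \<Sum>k\<in>I. centred p K F j k * R F k j) = of_real N + \<i> * t * m" .
  have "bexp p K (\<lambda>F. \<Sum>j\<in>I. \<Sum>k\<in>I. centred p K F j k * R F k j)
      = (\<Sum>j\<in>I. \<Sum>k\<in>I. of_real s * bexp p K (\<lambda>F. D F j k - R F k k * R F j j))"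
    unfolding bexp_sum by (intro sum.cong refl stein)
  also have "\<dots> = of_real s * bexp p K (\<lambda>F. \<Sum>j\<in>I. \<Sum>k\<in>I. D F j k - R F k k * R F j j)"
    by (simp add: bexp_sum sum_distrib_left)
  also have "\<dots> = of_real s * (bexp p K (\<lambda>F. \<Sum>j\<in>I. \<Sum>k\<in>I. D F j k) - bexp p K (\<lambda>F. (T F)\<^sup>2))"
  proof -
    have "(T F)\<^sup>2 = (\<Sum>j\<in>I. \<Sum>k\<in>I. R F k k * R F j j)" for F
      unfolding T_def resolvent_trace_def R_def power2_eq_square sum_product
      by (intro sum.cong refl) (simp add: mult.commute)
    then show ?thesis by (simp add: sum_subtractf bexp_diff)
  qed
  finally have 2: "of_real N + \<i> * t * m + of_real s * m\<^sup>2
      = of_real s * (bexp p K (\<lambda>F. \<Sum>j\<in>I. \<Sum>k\<in>I. D F j k) - (bexp p K (\<lambda>F. (T F)\<^sup>2) - m\<^sup>2))"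
    unfolding 1 by (simp add: algebra_simps)
  \<comment> \<open>At most N^2 edges each move the trace by at most 2/t^2, so this stays bounded
    for t of order sqrt N.\<close>
  have var: "cmod (bexp p K (\<lambda>F. (T F)\<^sup>2) - m\<^sup>2) \<le> 2 * card K * (2 / t\<^sup>2)\<^sup>2"
    unfolding m_def T_def[symmetric]
  proof (rule bexp_complex_variance[OF finK])
    fix e F assume e: "e \<in> K" "F \<subseteq> K - {e}"
    obtain a b where ab: "a \<in> I" "b \<in> I" "a \<noteq> b" "e = {a, b}" using e by (auto simp: K_def all_edges_def)
    have "edge_perturbation I a b (centred p K F) (centred p K (insert e F))
        (of_bool ({a, b} \<in> insert e F) - of_bool ({a, b} \<in> F))"
      using ab e by (intro centred_edge_perturbation) auto
    then show "cmod (T (insert e F) - T F) \<le> 2 / t\<^sup>2"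
      unfolding T_def by (rule resolvent_trace_edge_perturbation_le[OF fin _ _ t]) auto
  qed
  have "real (card K) \<le> N\<^sup>2" using card_all_edges_le[OF fin] by (simp add: K_def N_def flip: of_nat_power)
  then have "2 * card K * (2 / t\<^sup>2)\<^sup>2 \<le> 2 * N\<^sup>2 * (2 / t\<^sup>2)\<^sup>2"
    by (intro mult_right_mono mult_left_mono) auto
  also have "\<dots> = N\<^sup>2 * (8 / t ^ 4)" by (simp add: power_divide flip: power_mult)
  finally have var': "cmod (bexp p K (\<lambda>F. (T F)\<^sup>2) - m\<^sup>2) \<le> N\<^sup>2 * (8 / t ^ 4)" using var by linarith
  have "cmod (of_real N + \<i> * t * m + of_real s * m\<^sup>2)
      \<le> 1 * cmod (bexp p K (\<lambda>F. \<Sum>j\<in>I. \<Sum>k\<in>I. D F j k) - (bexp p K (\<lambda>F. (T F)\<^sup>2) - m\<^sup>2))"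
    unfolding 2 norm_mult using s by (intro mult_right_mono) auto
  also have "\<dots> \<le> (2 * N / t\<^sup>2 + N\<^sup>2 * (8 / t ^ 4 + 4 / t ^ 3)) + N\<^sup>2 * (8 / t ^ 4)"
    using norm_triangle_ineq4[of "bexp p K (\<lambda>F. \<Sum>j\<in>I. \<Sum>k\<in>I. D F j k)" "bexp p K (\<lambda>F. (T F)\<^sup>2) - m\<^sup>2"]
      Dsum var' by linarith
  also have "\<dots> = 2 * N / t\<^sup>2 + N\<^sup>2 * (16 / t ^ 4 + 4 / t ^ 3)" by (simp add: algebra_simps)
  finally show ?thesis by (simp add: s_def)
qed

end

section \<open>The semicircle limit of the trace norm\<close>

text \<open>The positive root h of s h^2 + x h = 1. Then i h solves 1 + i x g + s g^2 = 0; it is the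
  Stieltjes transform at i x of the semicircle law of variance s.\<close>

definition semicircle_resolvent :: "real \<Rightarrow> real \<Rightarrow> real" where
  "semicircle_resolvent s x = (sqrt (x\<^sup>2 + 4 * s) - x) / (2 * s)"

text \<open>An antiderivative of 1 - x h(x), with h the \<open>semicircle_resolvent\<close>,
  normalised to vanish at infinity. Its value at 0 produces the constant: 2/pi times 4 sqrt s/3 is 8
  sqrt s/(3 pi).\<close>

definition semicircle_primitive :: "real \<Rightarrow> real \<Rightarrow> real" where
  "semicircle_primitive s x = x + x ^ 3 / (6 * s) - (x\<^sup>2 + 4 * s) * sqrt (x\<^sup>2 + 4 * s) / (6 * s)"

lemma semicircle_primitive_derivative:
  assumes s: "s > 0"
  shows "(semicircle_primitive s has_real_derivative 1 - x * semicircle_resolvent s x) (at x)"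
proof -
  define r where "r = sqrt (x\<^sup>2 + 4 * s)"
  have pos: "x\<^sup>2 + 4 * s > 0" using s by (simp add: add_nonneg_pos)
  then have r: "r > 0" "x\<^sup>2 + 4 * s = r\<^sup>2" by (auto simp: r_def)
  define S where "S y = sqrt (y\<^sup>2 + 4 * s)" for y
  have S: "(S has_real_derivative inverse r / 2 * (2 * x)) (at x)"
    unfolding S_def[abs_def] r_def
    by (rule DERIV_chain2[where f = sqrt and g = "\<lambda>y. y\<^sup>2 + 4 * s", OF DERIV_real_sqrt[OF pos]]) (auto intro!: derivative_eq_intros)
  have "((\<lambda>x. x + x ^ 3 / (6 * s) - (x\<^sup>2 + 4 * s) * S x / (6 * s))
     has_real_derivative 1 + 3 * x\<^sup>2 / (6 * s) - ((2 * x) * S x + (inverse r / 2 * (2 * x)) * (x\<^sup>2 + 4 * s)) / (6 * s)) (at x)"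
    using s by (intro DERIV_diff DERIV_add DERIV_cdivide DERIV_mult S DERIV_ident) (auto intro!: derivative_eq_intros)
  also have "S x = r" by (simp add: S_def r_def)
  also have "1 + 3 * x\<^sup>2 / (6 * s) - ((2 * x) * r + (inverse r / 2 * (2 * x)) * (x\<^sup>2 + 4 * s)) / (6 * s)
      = 1 - x * ((r - x) / (2 * s))"
    using r s unfolding r(2) by (simp add: field_simps power2_eq_square)
  finally show ?thesis by (simp add: semicircle_primitive_def[abs_def] S_def semicircle_resolvent_def r_def)
qed

lemma semicircle_primitive_0:
  assumes "s > 0" shows "semicircle_primitive s 0 = - (4 * sqrt s / 3)"
  using assms by (simp add: semicircle_primitive_def real_sqrt_mult)

text \<open>With r = sqrt (x^2 + 4 s) the cancellation is exact: 6 s times the primitive is -(r -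
  x)^2 (x + 2 r)/2, while (r - x)(r + x) = 4 s forces r - x \<le> 4 s/x.\<close>

lemma semicircle_primitive_at_top:
  assumes s: "s > 0" shows "(semicircle_primitive s \<longlongrightarrow> 0) at_top"
proof (rule Lim_null_comparison)
  show "((\<lambda>x. 8 * s / 3 / x) \<longlongrightarrow> 0) at_top"
    by (intro tendsto_divide_0[OF tendsto_const] filterlim_at_top_imp_at_infinity filterlim_ident)
  show "\<forall>\<^sub>F x in at_top. norm (semicircle_primitive s x) \<le> 8 * s / 3 / x"
    using eventually_gt_at_top[of 0]
  proof eventually_elim
    case (elim x)
    define r where "r = sqrt (x\<^sup>2 + 4 * s)"
    have rx: "r \<ge> x" unfolding r_def using s elim by (intro real_le_rsqrt) auto
    have r2: "r\<^sup>2 = x\<^sup>2 + 4 * s" unfolding r_def using s by simp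
    have s': "s = (r\<^sup>2 - x\<^sup>2) / 4" using r2 by simp
    have d: "4 * s = (r - x) * (r + x)" using r2 by (simp add: power2_eq_square algebra_simps)
    have "semicircle_primitive s x * (6 * s) = 6 * s * x + x ^ 3 - r ^ 3"
    proof -
      have e: "(x\<^sup>2 + 4 * s) * r = r ^ 3" unfolding r2[symmetric] by (simp add: power2_eq_square power3_eq_cube)
      have "semicircle_primitive s x = x + x ^ 3 / (6 * s) - (x\<^sup>2 + 4 * s) * r / (6 * s)"
        by (simp add: semicircle_primitive_def r_def)
      then have "semicircle_primitive s x * (6 * s) = x * (6 * s) + x ^ 3 / (6 * s) * (6 * s) - r ^ 3 / (6 * s) * (6 * s)"
        unfolding e by (simp only: left_diff_distrib distrib_right)
      then show ?thesis using s by simp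
    qed
    also have "\<dots> = - (r - x)\<^sup>2 * (x + 2 * r) / 2"
      unfolding s' by (simp add: field_simps power2_eq_square power3_eq_cube)
    finally have "\<bar>semicircle_primitive s x * (6 * s)\<bar> = \<bar>(r - x)\<^sup>2 * (x + 2 * r) / 2\<bar>" by simp
    then have "\<bar>semicircle_primitive s x\<bar> * (6 * s) = (r - x)\<^sup>2 * (x + 2 * r) / 2"
      using s rx elim by (simp only: abs_mult abs_divide) simp
    also have "\<dots> \<le> (r - x)\<^sup>2 * (2 * (r + x)) / 2"
      using elim rx by (intro divide_right_mono mult_left_mono) auto
    also have "\<dots> = 4 * s * (r - x)" unfolding d by (simp add: power2_eq_square field_simps)
    finally have "\<bar>semicircle_primitive s x\<bar> * 6 \<le> 4 * (r - x)" using s by (simp add: mult_ac)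
    moreover have "(r - x) * x \<le> 4 * s" unfolding d using rx elim by (intro mult_left_mono) auto
    then have "r - x \<le> 4 * s / x" using elim by (simp add: pos_le_divide_eq)
    ultimately show ?case by (simp add: field_simps)
  qed
qed

text \<open>The quadratic factors as s (g - i h)(g + i h') with h' \<ge> x/s. As Im g \<ge> 0, the
  second factor has modulus at least h', so the residual controls the first one directly.\<close>

lemma self_consistent_stability:
  fixes g :: complex
  assumes s: "s > 0" and x: "x > 0" and g: "Im g \<ge> 0"
    and e: "cmod (1 + \<i> * x * g + s * g\<^sup>2) \<le> e"
  shows "x * \<bar>Im g - semicircle_resolvent s x\<bar> \<le> e"
proof -
  define r where "r = sqrt (x\<^sup>2 + 4 * s)"
  define h where "h = semicircle_resolvent s x"
  define h' where "h' = (r + x) / (2 * s)"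
  have r2: "r\<^sup>2 = x\<^sup>2 + 4 * s" unfolding r_def using s by simp
  have rx: "r \<ge> x" unfolding r_def using s x by (intro real_le_rsqrt) auto
  have h: "h = (r - x) / (2 * s)" by (simp add: h_def semicircle_resolvent_def r_def)
  have 1: "s * (h' - h) = x" using s by (simp add: h h'_def field_simps)
  have 2: "s * (h * h') = 1"
    using s r2 by (simp add: h h'_def field_simps power2_eq_square)
  have "of_real s * (g - \<i> * h) * (g + \<i> * h') = of_real (s * (h * h')) + \<i> * of_real (s * (h' - h)) * g + s * g\<^sup>2"
    by (simp add: algebra_simps power2_eq_square)
  then have "of_real s * (g - \<i> * h) * (g + \<i> * h') = 1 + \<i> * x * g + s * g\<^sup>2" unfolding 1 2 by simp
  then have *: "s * cmod (g - \<i> * h) * cmod (g + \<i> * h') \<le> e"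
    using e s by (metis abs_of_pos norm_mult norm_of_real)
  have "x / s \<le> h'" using rx s by (simp add: h'_def field_simps)
  also have "h' \<le> Im (g + \<i> * h')" using g by simp
  also have "\<dots> \<le> cmod (g + \<i> * h')" using abs_Im_le_cmod[of "g + \<i> * h'"] by linarith
  finally have "x \<le> s * cmod (g + \<i> * h')" using s by (simp add: field_simps)
  moreover have "\<bar>Im g - h\<bar> \<le> cmod (g - \<i> * h)" using abs_Im_le_cmod[of "g - \<i> * h"] by simp
  ultimately have "x * \<bar>Im g - h\<bar> \<le> (s * cmod (g + \<i> * h')) * cmod (g - \<i> * h)"
    using x by (intro mult_mono) auto
  then show ?thesis using * by (simp add: h_def mult_ac)
qed

text \<open>Over all t > 0 the integral would be pi |l|/2. It is cut off at \<open>b\<close> and at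
  \<open>a\<close>, since the resolvent estimates blow up near 0; arctan y \<le> y bounds the two
  missing pieces.\<close>

lemma has_integral_square_fraction:
  fixes l :: real
  assumes "0 < a" "a \<le> b"
  obtains J where "((\<lambda>t. l\<^sup>2 / (l\<^sup>2 + t\<^sup>2)) has_integral J) {a..b}"
    and "\<bar>\<bar>l\<bar> - 2 / pi * J\<bar> \<le> 2 / pi * (a + l\<^sup>2 / b)"
proof (cases "l = 0")
  case True
  then show ?thesis using that[of 0] assms by (auto simp: has_integral_0)
next
  case False
  define m where "m = \<bar>l\<bar>"
  have m: "m > 0" "l\<^sup>2 = m\<^sup>2" using False by (auto simp: m_def)
  have arctan_le: "arctan y \<le> y" if "y \<ge> 0" for y using that arctan_le_self by simp
  have "((\<lambda>t. m * arctan (t / m)) has_real_derivative l\<^sup>2 / (l\<^sup>2 + t\<^sup>2)) (at t)" for t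
    using m by (auto intro!: derivative_eq_intros simp: field_simps power2_eq_square)
  then have "((\<lambda>t. l\<^sup>2 / (l\<^sup>2 + t\<^sup>2)) has_integral m * arctan (b / m) - m * arctan (a / m)) {a..b}"
    using assms by (intro fundamental_theorem_of_calculus)
      (auto intro: has_field_derivative_at_within simp flip: has_real_derivative_iff_has_vector_derivative)
  moreover have "\<bar>\<bar>l\<bar> - 2 / pi * (m * arctan (b / m) - m * arctan (a / m))\<bar> \<le> 2 / pi * (a + l\<^sup>2 / b)"
  proof -
    have inv: "arctan (b / m) = pi / 2 - arctan (m / b)"
      using arctan_inverse[of "m / b"] m assms by (simp add: sgn_if)
    have E: "\<bar>l\<bar> - 2 / pi * (m * arctan (b / m) - m * arctan (a / m)) = 2 / pi * (m * arctan (m / b) + m * arctan (a / m))"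
      unfolding inv by (simp add: m_def field_simps)
    have "m * arctan (m / b) \<le> l\<^sup>2 / b"
      using mult_left_mono[OF arctan_le[of "m / b"], of m] m assms by (simp add: power2_eq_square)
    moreover have "m * arctan (a / m) \<le> a"
      using mult_left_mono[OF arctan_le[of "a / m"], of m] m assms by simp
    moreover have "0 \<le> m * arctan (m / b)" "0 \<le> m * arctan (a / m)"
      using m assms by (auto intro!: mult_nonneg_nonneg)
    ultimately show ?thesis
      unfolding E by (subst abs_of_nonneg) (auto intro!: mult_left_mono mult_nonneg_nonneg simp del: times_divide_eq_left)
  qed
  ultimately show ?thesis using that by blast
qed

lemma bexp_has_integral:
  fixes f :: "'e set \<Rightarrow> real \<Rightarrow> real"
  assumes "finite E" "\<And>F. F \<subseteq> E \<Longrightarrow> (f F has_integral J F) S"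
  shows "((\<lambda>t. bexp p E (\<lambda>F. f F t)) has_integral bexp p E J) S"
  unfolding bexp_def using assms by (intro has_integral_sum) (auto intro!: has_integral_cmul simp del: real_scaleR_def)

text \<open>For an eigenvalue x, x^2/(x^2 + t^2) = 1 - t^2/(x^2 + t^2), which sums to the integrand.
  The upper cut-off costs the sum of squared eigenvalues, that is of squared entries, at most (card
  I)^2.\<close>

lemma trace_norm_resolvent_integral:
  fixes a b :: real
  assumes fin: "finite I" and A: "symmetric_on I A" and ab: "0 < a" "a \<le> b"
    and A1: "\<And>j k. \<bar>A j k\<bar> \<le> 1"
  obtains J where "((\<lambda>t. card I - t * Im (resolvent_trace I A t)) has_integral J) {a..b}"
    and "\<bar>trace_norm I A - 2 / pi * J\<bar> \<le> 2 / pi * (card I * a + (card I)\<^sup>2 / b)"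
proof -
  obtain lam u where d: "diagonalises I A lam u" and tn: "trace_norm I A = (\<Sum>i\<in>I. \<bar>lam i\<bar>)"
    and T: "\<And>t. t > 0 \<Longrightarrow> Im (resolvent_trace I A t) = (\<Sum>i\<in>I. t / ((lam i)\<^sup>2 + t\<^sup>2))"
    using resolvent_trace_spectral[OF fin A] by blast
  have "\<exists>J. ((\<lambda>t. l\<^sup>2 / (l\<^sup>2 + t\<^sup>2)) has_integral J) {a..b} \<and> \<bar>\<bar>l\<bar> - 2 / pi * J\<bar> \<le> 2 / pi * (a + l\<^sup>2 / b)" for l
    using has_integral_square_fraction[OF ab] by metis
  then obtain J where J: "\<And>l. ((\<lambda>t. l\<^sup>2 / (l\<^sup>2 + t\<^sup>2)) has_integral J l) {a..b}"
    and Jb: "\<And>l. \<bar>\<bar>l\<bar> - 2 / pi * J l\<bar> \<le> 2 / pi * (a + l\<^sup>2 / b)" by metis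
  have "((\<lambda>t. \<Sum>i\<in>I. (lam i)\<^sup>2 / ((lam i)\<^sup>2 + t\<^sup>2)) has_integral (\<Sum>i\<in>I. J (lam i))) {a..b}"
    using J fin by (intro has_integral_sum) auto
  moreover have "(\<Sum>i\<in>I. (lam i)\<^sup>2 / ((lam i)\<^sup>2 + t\<^sup>2)) = card I - t * Im (resolvent_trace I A t)" if "t \<in> {a..b}" for t
  proof -
    have t: "t > 0" using that ab by auto
    have "(lam i)\<^sup>2 / ((lam i)\<^sup>2 + t\<^sup>2) = 1 - t * (t / ((lam i)\<^sup>2 + t\<^sup>2))" for i
    proof -
      have "(lam i)\<^sup>2 + t\<^sup>2 > 0" using t by (simp add: add_nonneg_pos)
      then have "(lam i)\<^sup>2 / ((lam i)\<^sup>2 + t\<^sup>2) + t\<^sup>2 / ((lam i)\<^sup>2 + t\<^sup>2) = 1"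
        by (metis add_divide_distrib divide_self less_irrefl)
      then show ?thesis by (simp add: power2_eq_square)
    qed
    then show ?thesis using T[OF t] by (simp add: sum_subtractf sum_distrib_left)
  qed
  ultimately have 1: "((\<lambda>t. card I - t * Im (resolvent_trace I A t)) has_integral (\<Sum>i\<in>I. J (lam i))) {a..b}"
    by (rule has_integral_eq[rotated])
  have "\<bar>trace_norm I A - 2 / pi * (\<Sum>i\<in>I. J (lam i))\<bar> = \<bar>\<Sum>i\<in>I. \<bar>lam i\<bar> - 2 / pi * J (lam i)\<bar>"
    unfolding tn by (simp add: sum_subtractf sum_distrib_left)
  also have "\<dots> \<le> (\<Sum>i\<in>I. 2 / pi * (a + (lam i)\<^sup>2 / b))"
    by (intro order_trans[OF sum_abs] sum_mono Jb)
  also have "\<dots> = 2 / pi * (card I * a + (\<Sum>i\<in>I. (lam i)\<^sup>2) / b)"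
    unfolding sum_distrib_left[symmetric] by (simp add: sum.distrib sum_divide_distrib)
  also have "\<dots> \<le> 2 / pi * (card I * a + (card I)\<^sup>2 / b)"
  proof -
    have "(\<Sum>i\<in>I. (lam i)\<^sup>2) = (\<Sum>j\<in>I. \<Sum>k\<in>I. (A j k)\<^sup>2)" using diagonalises_sum_square[OF fin d] by simp
    also have "\<dots> \<le> (\<Sum>j\<in>I. \<Sum>k\<in>I. 1)" using A1 by (intro sum_mono) (simp add: abs_square_le_1)
    finally have "(\<Sum>i\<in>I. (lam i)\<^sup>2) \<le> (card I)\<^sup>2" by (simp add: power2_eq_square)
    then show ?thesis using ab by (intro mult_left_mono add_mono divide_right_mono) auto
  qed
  finally show ?thesis using 1 that by blast
qed

section \<open>Convergence of the expected trace norm to its semicircle value\<close>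

context
  fixes p :: real
  assumes p: "0 < p" "p < 1"
begin

text \<open>At t = x sqrt N and m = g sqrt N every term of the self-consistent equation has order N,
  while its error has order sqrt N; dividing by N leaves a residual of order 1/sqrt N for g.\<close>

lemma expected_resolvent_trace:
  fixes I :: "'v set"
  assumes fin: "finite I" and ne: "I \<noteq> {}" and x: "x > 0"
  defines "K \<equiv> all_edges I" and "N \<equiv> real (card I)"
  defines "t \<equiv> x * sqrt N"
  shows "\<bar>bexp p K (\<lambda>F. N - t * Im (resolvent_trace I (centred p K F) t))
      - N * (1 - x * semicircle_resolvent (p * (1 - p)) x)\<bar>
    \<le> (2 / x\<^sup>2 + 16 / x ^ 4 + 4 / x ^ 3) * sqrt N"
proof -
  define m where "m = bexp p K (\<lambda>F. resolvent_trace I (centred p K F) t)"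
  define s where "s = p * (1 - p)"
  define q where "q = sqrt N"
  have s: "s > 0" using p by (simp add: s_def)
  have N: "N \<ge> 1" using fin ne by (simp add: N_def Suc_le_eq card_gt_0_iff)
  then have q: "q \<ge> 1" "N = q\<^sup>2" by (auto simp: q_def)
  have t: "t > 0" "t = x * q" using x N by (simp_all add: t_def q_def)
  have finK: "finite K" unfolding K_def by (rule finite_all_edges[OF fin])
  define g where "g = m / of_real q"
  have mg: "m = of_real q * g" using q by (simp add: g_def)
  define C where "C = 2 / x\<^sup>2 + 16 / x ^ 4 + 4 / x ^ 3"
  have Im: "bexp p K (\<lambda>F. Im (resolvent_trace I (centred p K F) t)) = Im m"
    unfolding m_def by (rule bexp_bounded_linear[OF bounded_linear_Im])
  have "Im m \<ge> 0"
    unfolding Im[symmetric]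
  proof (rule bexp_nonneg[OF p])
    fix F
    obtain lam where "Im (resolvent_trace I (centred p K F) t) = (\<Sum>i\<in>I. t / ((lam i)\<^sup>2 + t\<^sup>2))"
      using resolvent_trace_spectral[OF fin centred_symmetric] t(1) by metis
    then show "0 \<le> Im (resolvent_trace I (centred p K F) t)" using t by (simp add: sum_nonneg)
  qed
  then have g0: "Im g \<ge> 0" using q by (simp add: g_def)
  have "cmod (of_real N + \<i> * of_real t * m + of_real s * m\<^sup>2) \<le> 2 * N / t\<^sup>2 + N\<^sup>2 * (16 / t ^ 4 + 4 / t ^ 3)"
    unfolding N_def m_def K_def s_def by (rule self_consistent_equation[OF p fin t(1)])
  also have "of_real N + \<i> * of_real t * m + of_real s * m\<^sup>2 = of_real N * (1 + \<i> * x * g + s * g\<^sup>2)"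
    unfolding mg t q(2) by (simp add: algebra_simps power2_eq_square)
  also have "2 * N / t\<^sup>2 + N\<^sup>2 * (16 / t ^ 4 + 4 / t ^ 3) = 2 / x\<^sup>2 + 16 / x ^ 4 + 4 / x ^ 3 * q"
    unfolding t(2) q(2) using q x by (simp add: field_simps power2_eq_square power3_eq_cube power4_eq_xxxx)
  also have "\<dots> \<le> 2 / x\<^sup>2 * q + 16 / x ^ 4 * q + 4 / x ^ 3 * q"
  proof -
    have "y * 1 \<le> y * q" if "y \<ge> 0" for y using q that by (intro mult_left_mono) auto
    from this[of "2 / x\<^sup>2"] this[of "16 / x ^ 4"] show ?thesis using x by simp
  qed
  also have "\<dots> = C * q" by (simp add: C_def algebra_simps)
  finally have "N * cmod (1 + \<i> * x * g + s * g\<^sup>2) \<le> C * q" using N by (simp add: norm_mult)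
  then have "cmod (1 + \<i> * x * g + s * g\<^sup>2) \<le> C * q / N" using N by (simp add: field_simps)
  from self_consistent_stability[OF s x g0 this]
  have st: "N * (x * \<bar>Im g - semicircle_resolvent s x\<bar>) \<le> C * q" using N by (simp add: field_simps)
  have "bexp p K (\<lambda>F. N - t * Im (resolvent_trace I (centred p K F) t)) = N - t * Im m"
    using finK by (simp add: bexp_diff bexp_const bexp_mult_left Im)
  also have "\<dots> = N * (1 - x * Im g)"
    unfolding mg t(2) q(2) by (simp add: algebra_simps power2_eq_square)
  also have "N * (1 - x * Im g) - N * (1 - x * semicircle_resolvent s x) = - (N * (x * (Im g - semicircle_resolvent s x)))"
    by (simp add: algebra_simps)
  finally show ?thesis
    using st x N unfolding s_def[symmetric] C_def[symmetric] q_def[symmetric]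
    by (simp add: abs_mult)
qed

text \<open>Integration between a sqrt N and b sqrt N: with t = x sqrt N the limit integrates to the
  primitive, and the error coefficient, decreasing in x, is bounded by its value at
  \<open>a\<close>.\<close>

lemma expected_trace_norm_bound:
  fixes I :: "'v set"
  assumes fin: "finite I" and ne: "I \<noteq> {}" and ab: "0 < a" "a \<le> b"
  defines "K \<equiv> all_edges I" and "N \<equiv> real (card I)"
  defines "H \<equiv> semicircle_primitive (p * (1 - p))"
  shows "\<bar>bexp p K (\<lambda>F. trace_norm I (centred p K F)) - 2 / pi * (N * sqrt N * (H b - H a))\<bar>
    \<le> 2 / pi * (N * sqrt N * (a + 1 / b) + (2 / a\<^sup>2 + 16 / a ^ 4 + 4 / a ^ 3) * (b - a) * N)"
proof -
  define q where "q = sqrt N"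
  have N: "N \<ge> 1" using fin ne by (simp add: N_def Suc_le_eq card_gt_0_iff)
  then have q: "q \<ge> 1" "N = q\<^sup>2" by (auto simp: q_def)
  define s where "s = p * (1 - p)"
  have s: "s > 0" using p by (simp add: s_def)
  have finK: "finite K" unfolding K_def by (rule finite_all_edges[OF fin])
  define f where "f F t = N - t * Im (resolvent_trace I (centred p K F) t)" for F t
  have abq: "0 < a * q" "a * q \<le> b * q" using ab q by auto
  have "\<exists>J. (f F has_integral J) {a*q..b*q} \<and>
      \<bar>trace_norm I (centred p K F) - 2 / pi * J\<bar> \<le> 2 / pi * (N * (a * q) + N\<^sup>2 / (b * q))" for F
    by (rule trace_norm_resolvent_integral[OF fin centred_symmetric[of I p K F] abq centred_abs_le[OF p]])
      (auto simp: f_def[abs_def] N_def)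
  then obtain J where J: "\<And>F. (f F has_integral J F) {a*q..b*q}"
    and Jb: "\<And>F. \<bar>trace_norm I (centred p K F) - 2 / pi * J F\<bar> \<le> 2 / pi * (N * (a * q) + N\<^sup>2 / (b * q))"
    by metis
  have "\<bar>bexp p K (\<lambda>F. trace_norm I (centred p K F) - 2 / pi * J F)\<bar>
      \<le> bexp p K (\<lambda>F. \<bar>trace_norm I (centred p K F) - 2 / pi * J F\<bar>)"
    using norm_bexp_le[OF p, of K "\<lambda>F. trace_norm I (centred p K F) - 2 / pi * J F"] by simp
  also have "\<dots> \<le> 2 / pi * (N * (a * q) + N\<^sup>2 / (b * q))"
    by (intro bexp_le_const[OF p finK] Jb)
  also have "N * (a * q) + N\<^sup>2 / (b * q) = N * q * (a + 1 / b)"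
    using q ab unfolding q(2) by (simp add: field_simps power2_eq_square)
  finally have 1: "\<bar>bexp p K (\<lambda>F. trace_norm I (centred p K F)) - 2 / pi * bexp p K J\<bar> \<le> 2 / pi * (N * q * (a + 1 / b))"
    by (simp only: bexp_diff bexp_mult_left)
  have i1: "((\<lambda>t. bexp p K (\<lambda>F. f F t)) has_integral bexp p K J) {a*q..b*q}"
    by (rule bexp_has_integral[OF finK]) (rule J)
  define g where "g t = N * (1 - (t / q) * semicircle_resolvent s (t / q))" for t
  have "((\<lambda>t. N * q * H (t / q)) has_real_derivative g t) (at t)" for t
  proof -
    have "((\<lambda>t. H (t / q)) has_real_derivative (1 - (t / q) * semicircle_resolvent s (t / q)) * (1 / q)) (at t)"
      unfolding H_def s_def[symmetric]
      by (rule DERIV_chain2[OF semicircle_primitive_derivative[OF s]]) (use q in \<open>auto intro!: derivative_eq_intros\<close>)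
    from DERIV_cmult[OF this, of "N * q"] show ?thesis using q by (simp add: g_def)
  qed
  then have "(g has_integral N * q * H (b * q / q) - N * q * H (a * q / q)) {a*q..b*q}"
    using abq by (intro fundamental_theorem_of_calculus)
      (auto intro: has_field_derivative_at_within simp flip: has_real_derivative_iff_has_vector_derivative)
  then have i2: "(g has_integral N * q * (H b - H a)) {a*q..b*q}" using q by (simp add: algebra_simps)
  define C where "C x = 2 / x\<^sup>2 + 16 / x ^ 4 + 4 / x ^ 3" for x :: real
  have Ca: "C a \<ge> 0" using ab by (simp add: C_def)
  have "norm (bexp p K J - N * q * (H b - H a)) \<le> C a * q * measure lborel (cbox (a*q) (b*q))"
  proof (rule has_integral_bound)
    show "((\<lambda>t. bexp p K (\<lambda>F. f F t) - g t) has_integral bexp p K J - N * q * (H b - H a)) (cbox (a*q) (b*q))"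
      using has_integral_diff[OF i1 i2] by simp
    show "0 \<le> C a * q" using Ca q by simp
    fix t assume "t \<in> cbox (a*q) (b*q)"
    then have t: "a * q \<le> t" by simp
    define x where "x = t / q"
    have x: "x \<ge> a" "t = x * q" using t q by (simp_all add: x_def field_simps)
    then have x0: "x > 0" using ab by linarith
    have "\<bar>bexp p K (\<lambda>F. f F t) - g t\<bar> \<le> C x * q"
      using expected_resolvent_trace[OF fin ne x0]
      unfolding f_def g_def x_def[symmetric] C_def K_def[symmetric] N_def[symmetric] q_def[symmetric] x(2)[symmetric]
        s_def[symmetric] .
    also have "C x \<le> C a" unfolding C_def
      using ab x x0 by (intro add_mono divide_left_mono power_mono) auto
    finally show "norm (bexp p K (\<lambda>F. f F t) - g t) \<le> C a * q" using q by simp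
  qed
  also have "C a * q * measure lborel (cbox (a*q) (b*q)) = C a * (b - a) * N"
    using abq by (simp add: q(2) power2_eq_square algebra_simps)
  finally have 2: "\<bar>bexp p K J - N * q * (H b - H a)\<bar> \<le> C a * (b - a) * N" by simp
  have "2 / pi * \<bar>bexp p K J - N * q * (H b - H a)\<bar> \<le> 2 / pi * (C a * (b - a) * N)"
    using 2 by (intro mult_left_mono) auto
  then have "\<bar>2 / pi * bexp p K J - 2 / pi * (N * q * (H b - H a))\<bar> \<le> 2 / pi * (C a * (b - a) * N)"
    unfolding right_diff_distrib[symmetric] abs_mult by simp
  with 1 show ?thesis unfolding q_def[symmetric] C_def[symmetric]
    by (simp only: distrib_left)
qed

text \<open>\<open>a\<close> and \<open>b\<close> are fixed first, to make the cut-off errors and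
  the boundary values of the primitive accurate; then \<open>N0\<close> is taken so large that the
  remaining error of order N is absorbed.\<close>

theorem expected_trace_norm_asymptotics:
  assumes d: "d > 0"
  obtains N0 where "\<And>I :: 'v set. finite I \<Longrightarrow> card I \<ge> N0 \<Longrightarrow>
    \<bar>bexp p (all_edges I) (\<lambda>F. trace_norm I (centred p (all_edges I) F))
      - 8 / (3 * pi) * sqrt (p * (1 - p)) * (card I * sqrt (card I))\<bar> \<le> d * (card I * sqrt (card I))"
proof -
  define s where "s = p * (1 - p)"
  have s: "s > 0" using p by (simp add: s_def)
  define H where "H = semicircle_primitive s"
  have "isCont H 0" unfolding H_def using semicircle_primitive_derivative[OF s] by (rule DERIV_isCont)
  then have "(H \<longlongrightarrow> H 0) (at_right 0)"
    by (simp add: isCont_def filterlim_at_split)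
  then have "\<forall>\<^sub>F a in at_right 0. dist (H a) (H 0) < d / 8"
    using d by (intro tendstoD) auto
  moreover have "\<forall>\<^sub>F a in at_right 0. a < d / 8" "\<forall>\<^sub>F a in at_right 0. a > (0::real)"
    using d by (auto simp: eventually_at_right_less intro: eventually_at_rightI[of 0 "d / 8"])
  ultimately have "\<forall>\<^sub>F a in at_right 0. dist (H a) (H 0) < d / 8 \<and> a < d / 8 \<and> a > (0::real)"
    by eventually_elim auto
  then obtain a where a: "dist (H a) (H 0) < d / 8" "a < d / 8" "a > 0"
    using eventually_happens[of _ "at_right (0::real)"] by auto
  have "\<forall>\<^sub>F b in at_top. dist (H b) 0 < d / 8"
    using d semicircle_primitive_at_top[OF s] unfolding H_def by (intro tendstoD) auto
  moreover have "\<forall>\<^sub>F b in at_top. b \<ge> a \<and> b > 8 / d"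
    by (intro eventually_conj eventually_ge_at_top eventually_gt_at_top)
  ultimately have "\<forall>\<^sub>F b in at_top. dist (H b) 0 < d / 8 \<and> b \<ge> a \<and> b > 8 / d"
    by eventually_elim auto
  then obtain b where b: "dist (H b) 0 < d / 8" "b \<ge> a" "b > 8 / d"
    using eventually_happens[of _ "at_top :: real filter"] by auto
  have b1: "1 / b < d / 8" using b d a by (simp add: field_simps)
  define C where "C = (2 / a\<^sup>2 + 16 / a ^ 4 + 4 / a ^ 3) * (b - a)"
  have C: "C \<ge> 0" using a b by (simp add: C_def)
  define N0 where "N0 = nat \<lceil>(2 * C / d)\<^sup>2\<rceil> + 1"
  have "\<bar>bexp p (all_edges I) (\<lambda>F. trace_norm I (centred p (all_edges I) F))
      - 8 / (3 * pi) * sqrt s * (card I * sqrt (card I))\<bar> \<le> d * (card I * sqrt (card I))"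
    if I: "finite I" "card I \<ge> N0" for I :: "'v set"
  proof -
    define N where "N = real (card I)"
    have ne: "I \<noteq> {}" using I by (auto simp: N0_def)
    have "(2 * C / d)\<^sup>2 \<le> N" using I(2) unfolding N0_def N_def by linarith
    then have "2 * C / d \<le> sqrt N" by (rule real_le_rsqrt)
    then have "C \<le> d / 2 * sqrt N" using d by (simp add: field_simps)
    then have CN: "C * N \<le> d / 2 * (N * sqrt N)" 
      using mult_right_mono[of C "d / 2 * sqrt N" N] by (simp add: N_def mult_ac)
    define Q where "Q = N * sqrt N"
    have Q: "Q \<ge> 0" by (simp add: Q_def N_def)
    define X where "X = bexp p (all_edges I) (\<lambda>F. trace_norm I (centred p (all_edges I) F))"
    have "\<bar>X - 2 / pi * (Q * (H b - H a))\<bar> \<le> 2 / pi * (Q * (a + 1 / b) + C * N)"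
      using expected_trace_norm_bound[OF I(1) ne a(3) b(2)]
      unfolding X_def Q_def N_def H_def s_def C_def .
    also have "\<dots> \<le> 2 / pi * (Q * (d / 8 + d / 8) + d / 2 * Q)"
      using a b1 CN Q unfolding Q_def[symmetric] by (intro mult_left_mono add_mono) auto
    also have "\<dots> = 2 / pi * (3 * d / 4 * Q)" by (simp add: algebra_simps)
    finally have 1: "\<bar>X - 2 / pi * (Q * (H b - H a))\<bar> \<le> 2 / pi * (3 * d / 4 * Q)" .
    have "H 0 = - (4 * sqrt s / 3)" unfolding H_def by (rule semicircle_primitive_0[OF s])
    then have "\<bar>H b - H a - 4 * sqrt s / 3\<bar> \<le> d / 4" using a(1) b(1) unfolding dist_real_def by linarith
    then have "2 / pi * (Q * \<bar>H b - H a - 4 * sqrt s / 3\<bar>) \<le> 2 / pi * (Q * (d / 4))"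
      using Q by (intro mult_left_mono) auto
    then have 2: "\<bar>2 / pi * (Q * (H b - H a)) - 8 / (3 * pi) * sqrt s * Q\<bar> \<le> 2 / pi * (Q * (d / 4))"
    proof -
      have "2 / pi * (Q * (H b - H a)) - 8 / (3 * pi) * sqrt s * Q = 2 / pi * (Q * (H b - H a - 4 * sqrt s / 3))"
        by (simp add: field_simps)
      then have "\<bar>2 / pi * (Q * (H b - H a)) - 8 / (3 * pi) * sqrt s * Q\<bar> = 2 / pi * (Q * \<bar>H b - H a - 4 * sqrt s / 3\<bar>)"
        using Q by (simp only: abs_mult) simp
      then show ?thesis using \<open>2 / pi * (Q * \<bar>H b - H a - 4 * sqrt s / 3\<bar>) \<le> 2 / pi * (Q * (d / 4))\<close> by simp
    qed
    have "\<bar>X - 8 / (3 * pi) * sqrt s * Q\<bar> \<le> 2 / pi * (3 * d / 4 * Q) + 2 / pi * (Q * (d / 4))"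
      using 1 2 by linarith
    also have "\<dots> = 2 / pi * (d * Q)" by (simp add: algebra_simps)
    also have "\<dots> \<le> 1 * (d * Q)" using pi_gt3 d Q by (intro mult_right_mono) auto
    finally show ?thesis by (simp add: X_def Q_def N_def)
  qed
  then show ?thesis using that unfolding s_def by blast
qed

end

section \<open>Random multipartite graphs\<close>

definition adj :: "'v set set \<Rightarrow> 'v \<Rightarrow> 'v \<Rightarrow> real" where
  "adj F j k = of_bool ({j, k} \<in> F)"

lemma adj_symmetric: "symmetric_on I (adj F)"
  by (simp add: symmetric_on_def adj_def insert_commute)

text \<open>A new edge adds the symmetrised product of two unit coordinate vectors;
  \<open>trace_norm_rank_two_le\<close> with a = 1 gives 2.\<close>

lemma trace_norm_adj_insert_le:
  assumes fin: "finite I" and F: "F \<subseteq> all_edges I" and e: "e \<in> all_edges I"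
  shows "\<bar>trace_norm I (adj (insert e F)) - trace_norm I (adj F)\<bar> \<le> 2"
proof (cases "e \<in> F")
  case True
  then show ?thesis by (simp add: insert_absorb)
next
  case False
  obtain a b where ab: "a \<in> I" "b \<in> I" "a \<noteq> b" "e = {a, b}" using e by (auto simp: all_edges_def)
  define x where "x j = (of_bool (j = a) :: real)" for j
  define y where "y j = (of_bool (j = b) :: real)" for j
  have eq: "(\<lambda>j k. adj (insert e F) j k - adj F j k) = (\<lambda>j k. x j * y k + y j * x k)"
  proof (intro ext)
    fix j k
    have "{j, k} = e \<longleftrightarrow> j = a \<and> k = b \<or> j = b \<and> k = a" using ab by (auto simp: doubleton_eq_iff)
    then show "adj (insert e F) j k - adj F j k = x j * y k + y j * x k"
      using False ab(3) by (cases "{j, k} = e") (auto simp: adj_def x_def y_def)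
  qed
  have "\<bar>trace_norm I (adj (insert e F)) - trace_norm I (adj F)\<bar>
      \<le> trace_norm I (\<lambda>j k. adj (insert e F) j k - adj F j k)"
    by (rule trace_norm_diff_le[OF fin adj_symmetric adj_symmetric])
  also have "\<dots> \<le> 1 * (\<Sum>j\<in>I. (x j)\<^sup>2) + (\<Sum>j\<in>I. (y j)\<^sup>2) / 1"
    unfolding eq by (rule trace_norm_rank_two_le[OF fin]) simp
  also have "(\<Sum>j\<in>I. (x j)\<^sup>2) = 1"
  proof -
    have "(x j)\<^sup>2 = 1 * of_bool (j = a)" for j by (simp add: x_def)
    then show ?thesis using sum_mult_of_bool(1)[OF fin ab(1), of "\<lambda>_. 1"] by simp
  qed
  also have "(\<Sum>j\<in>I. (y j)\<^sup>2) = 1"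
  proof -
    have "(y j)\<^sup>2 = 1 * of_bool (j = b)" for j by (simp add: y_def)
    then show ?thesis using sum_mult_of_bool(1)[OF fin ab(2), of "\<lambda>_. 1"] by simp
  qed
  finally show ?thesis by simp
qed

lemma centred_Int: "centred p S (F \<inter> S) = centred p S F"
  by (intro ext) (simp add: centred_def)

text \<open>Crude Cauchy-Schwarz bound without a size threshold, for the parts that are too small
  for the asymptotics.\<close>

lemma trace_norm_centred_le:
  assumes "0 < p" "p < 1" and fin: "finite I"
  shows "trace_norm I (centred p S F) \<le> card I * sqrt (card I)"
proof -
  have "(trace_norm I (centred p S F))\<^sup>2 \<le> card I * (\<Sum>j\<in>I. \<Sum>k\<in>I. (centred p S F j k)\<^sup>2)"
    by (rule trace_norm_square_le[OF fin centred_symmetric])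
  also have "\<dots> \<le> card I * (\<Sum>j\<in>I. \<Sum>k\<in>I. (1::real))"
    using centred_abs_le[OF assms(1,2)] by (intro mult_left_mono sum_mono) (auto simp: abs_square_le_1)
  also have "\<dots> = (card I * sqrt (card I))\<^sup>2" by (simp add: power_mult_distrib power2_eq_square)
  finally show ?thesis by (rule power2_le_imp_le) simp
qed

definition expected_norm :: "real \<Rightarrow> 'v set \<Rightarrow> real" where
  "expected_norm p J = bexp p (all_edges J) (\<lambda>F. trace_norm J (centred p (all_edges J) F))"

locale vertex_partition =
  fixes I :: "'v set" and L :: "'l set" and V :: "'l \<Rightarrow> 'v set"
  assumes finI: "finite I" and finL: "finite L" and UV: "(\<Union>i\<in>L. V i) = I"
    and disj: "\<And>i j. i \<in> L \<Longrightarrow> j \<in> L \<Longrightarrow> i \<noteq> j \<Longrightarrow> V i \<inter> V j = {}"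
begin

definition edges :: "'v set set" where
  "edges = all_edges I - (\<Union>i\<in>L. all_edges (V i))"

lemma edges_subset: "edges \<subseteq> all_edges I" by (auto simp: edges_def)

lemma finite_edges: "finite edges"
  using edges_subset finite_all_edges[OF finI] finite_subset by blast

lemma V_subset: "i \<in> L \<Longrightarrow> V i \<subseteq> I" using UV by auto

lemma finite_V: "i \<in> L \<Longrightarrow> finite (V i)" using V_subset finI finite_subset by blast

lemma sum_card_V: "(\<Sum>i\<in>L. card (V i)) = card I"
  using card_UN_disjoint[OF finL, of V] finite_V disj UV by auto

lemma part_unique: "i \<in> L \<Longrightarrow> j \<in> L \<Longrightarrow> x \<in> V i \<Longrightarrow> x \<in> V j \<Longrightarrow> i = j"
  using disj by blast

text \<open>Exactly one part contains \<open>j\<close>. The diagonal is covered: {j, j} is no edge,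
  and both sides are then \<open>c\<close>.\<close>

lemma sum_parts_indicator:
  assumes j: "j \<in> I" and k: "k \<in> I"
  shows "(\<Sum>i\<in>L. if j \<in> V i \<and> k \<in> V i then c else 0)
    = (if {j, k} \<in> edges then 0 else c :: real)"
proof -
  obtain i where i: "i \<in> L" "j \<in> V i" using j UV by auto
  have "(\<Sum>l\<in>L. if j \<in> V l \<and> k \<in> V l then c else 0) = (\<Sum>l\<in>L. if l = i then if k \<in> V i then c else 0 else 0)"
    using i part_unique by (intro sum.cong refl) auto
  also have "\<dots> = (if k \<in> V i then c else 0)" using finL i by simp
  also have "k \<in> V i \<longleftrightarrow> {j, k} \<notin> edges"
  proof -
    have "{j, k} \<notin> edges \<longleftrightarrow> j = k \<or> (\<exists>l\<in>L. j \<in> V l \<and> k \<in> V l)"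
      using j k unfolding edges_def by (cases "j = k") (auto simp: doubleton_mem_all_edges, auto simp: all_edges_def)
    then show ?thesis using i part_unique by blast
  qed
  finally show ?thesis by auto
qed

lemma centred_split:
  assumes j: "j \<in> I" and k: "k \<in> I"
  shows "centred p (all_edges I) F j k = centred p edges F j k + (\<Sum>i\<in>L. centred p (all_edges (V i)) F j k)"
proof (cases "j = k")
  case True
  then show ?thesis by (auto simp: centred_def edges_def all_edges_def)
next
  case False
  have "(\<Sum>i\<in>L. centred p (all_edges (V i)) F j k)
      = (\<Sum>i\<in>L. if j \<in> V i \<and> k \<in> V i then of_bool ({j, k} \<in> F) - p else 0)"
    using False by (intro sum.cong refl) (simp add: centred_def doubleton_mem_all_edges)
  also have "\<dots> = (if {j, k} \<in> edges then 0 else of_bool ({j, k} \<in> F) - p)"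
    unfolding sum_parts_indicator[OF j k] by simp
  finally show ?thesis using False j k by (simp add: centred_def doubleton_mem_all_edges)
qed

section \<open>Comparison with the complete graph, and concentration\<close>

context
  fixes p :: real
  assumes p: "0 < p" "p < 1"
begin

text \<open>The mean matrix is p times the all-ones matrix minus p times those of the parts; the
  index \<open>None\<close> stands for the whole set. The part sizes add up to
  \<open>card I\<close>, so the number of parts does not enter.\<close>

lemma trace_norm_mean_le: "trace_norm I (\<lambda>j k. p * of_bool ({j, k} \<in> edges)) \<le> 2 * card I"
proof -
  define c where "c l = (case l of None \<Rightarrow> p | Some i \<Rightarrow> - p)" for l :: "'l option"
  define w where "w l j = (case l of None \<Rightarrow> 1::real | Some i \<Rightarrow> of_bool (j \<in> V i))" for l :: "'l option" and j
  have "trace_norm I (\<lambda>j k. p * of_bool ({j, k} \<in> edges))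
      \<le> (\<Sum>l\<in>insert None (Some ` L). \<bar>c l\<bar> * (\<Sum>j\<in>I. (w l j)\<^sup>2))"
  proof (rule trace_norm_le_decomposition[OF finI])
    fix j k assume jk: "j \<in> I" "k \<in> I"
    have "(\<Sum>l\<in>insert None (Some ` L). c l * w l j * w l k) = p + (\<Sum>i\<in>L. if j \<in> V i \<and> k \<in> V i then - p else 0)"
      using finL by (subst sum.insert) (auto simp: sum.reindex c_def w_def intro!: sum.cong)
    also have "\<dots> = p * of_bool ({j, k} \<in> edges)" unfolding sum_parts_indicator[OF jk] by simp
    finally show "p * of_bool ({j, k} \<in> edges) = (\<Sum>l\<in>insert None (Some ` L). c l * w l j * w l k)" by simp
  qed
  also have "\<dots> = p * card I + (\<Sum>i\<in>L. p * card (V i))"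
  proof -
    have "(\<Sum>j\<in>I. (of_bool (j \<in> V i))\<^sup>2) = real (card (V i))" if "i \<in> L" for i
    proof -
      have "(\<Sum>j\<in>I. (of_bool (j \<in> V i))\<^sup>2) = (\<Sum>j\<in>V i. 1 :: real)"
        using V_subset[OF that] finI by (intro sum.mono_neutral_cong_right) auto
      then show ?thesis by simp
    qed
    then show ?thesis
      using finL p by (subst sum.insert) (auto simp: sum.reindex c_def w_def)
  qed
  also have "\<dots> = p * (2 * card I)"
    using sum_card_V by (simp flip: sum_distrib_left of_nat_sum)
  also have "\<dots> \<le> 1 * real (2 * card I)" using p by (intro mult_right_mono) auto
  finally show ?thesis by simp
qed

lemma trace_norm_adj_centred:
  assumes "F \<subseteq> edges"
  shows "\<bar>trace_norm I (adj F) - trace_norm I (centred p edges F)\<bar> \<le> 2 * card I"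
proof -
  have "(\<lambda>j k. adj F j k - centred p edges F j k) = (\<lambda>j k. p * of_bool ({j, k} \<in> edges))"
    using assms by (intro ext) (auto simp: adj_def centred_def)
  then show ?thesis
    using trace_norm_diff_le(2)[OF finI adj_symmetric centred_symmetric, of F p edges F] trace_norm_mean_le by simp
qed

lemma expected_norm_le: "finite J \<Longrightarrow> expected_norm p J \<le> card J * sqrt (card J)"
  unfolding expected_norm_def
  by (intro bexp_le_const[OF p] trace_norm_centred_le[OF p] finite_all_edges) auto

text \<open>All matrices are read off one random subset of the complete edge set, so the triangle
  inequality applies pointwise; marginalisation then identifies each expectation.\<close>

lemma expected_trace_norm_adj:
  "\<bar>bexp p edges (\<lambda>F. trace_norm I (adj F)) - expected_norm p I\<bar> \<le> (\<Sum>i\<in>L. expected_norm p (V i)) + 2 * card I"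
proof -
  define K where "K = all_edges I"
  have finK: "finite K" unfolding K_def by (rule finite_all_edges[OF finI])
  have "\<bar>trace_norm I (centred p edges F) - trace_norm I (centred p K F)\<bar>
      \<le> (\<Sum>i\<in>L. trace_norm (V i) (centred p (all_edges (V i)) F))" for F
  proof -
    have "\<bar>trace_norm I (centred p edges F) - trace_norm I (centred p K F)\<bar>
        = \<bar>trace_norm I (centred p K F) - trace_norm I (centred p edges F)\<bar>" by simp
    also have "\<dots> \<le> trace_norm I (\<lambda>j k. centred p K F j k - centred p edges F j k)"
      by (rule trace_norm_diff_le[OF finI centred_symmetric centred_symmetric])
    also have "\<dots> = trace_norm I (\<lambda>j k. \<Sum>i\<in>L. centred p (all_edges (V i)) F j k)"
      by (rule trace_norm_cong) (simp add: K_def centred_split)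
    also have "\<dots> \<le> (\<Sum>i\<in>L. trace_norm I (centred p (all_edges (V i)) F))"
      by (rule trace_norm_sum_le[OF finI finL centred_symmetric])
    also have "\<dots> \<le> (\<Sum>i\<in>L. trace_norm (V i) (centred p (all_edges (V i)) F))"
      by (intro sum_mono trace_norm_supported_le[OF finI V_subset centred_symmetric])
        (auto simp: centred_def doubleton_mem_all_edges)
    finally show ?thesis .
  qed
  then have "bexp p K (\<lambda>F. \<bar>trace_norm I (centred p edges F) - trace_norm I (centred p K F)\<bar>)
      \<le> bexp p K (\<lambda>F. \<Sum>i\<in>L. trace_norm (V i) (centred p (all_edges (V i)) F))"
    by (intro bexp_mono[OF p])
  also have "\<dots> = (\<Sum>i\<in>L. expected_norm p (V i))"
    unfolding bexp_sum
  proof (intro sum.cong refl)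
    fix i assume "i \<in> L"
    then have "all_edges (V i) \<subseteq> K" using V_subset unfolding K_def all_edges_def by blast
    from bexp_marginal'[OF finK this, of p "\<lambda>F. trace_norm (V i) (centred p (all_edges (V i)) F)"]
    show "bexp p K (\<lambda>F. trace_norm (V i) (centred p (all_edges (V i)) F)) = expected_norm p (V i)"
      by (simp add: expected_norm_def centred_Int)
  qed
  finally have 1: "\<bar>bexp p K (\<lambda>F. trace_norm I (centred p edges F)) - expected_norm p I\<bar> \<le> (\<Sum>i\<in>L. expected_norm p (V i))"
    using norm_bexp_le[OF p, of K "\<lambda>F. trace_norm I (centred p edges F) - trace_norm I (centred p K F)"]
    by (simp add: bexp_diff expected_norm_def K_def)
  have 2: "bexp p K (\<lambda>F. trace_norm I (centred p edges F)) = bexp p edges (\<lambda>F. trace_norm I (centred p edges F))"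
    using bexp_marginal'[OF finK, of edges p "\<lambda>F. trace_norm I (centred p edges F)"] edges_subset
    by (simp add: centred_Int K_def)
  have "\<bar>bexp p edges (\<lambda>F. trace_norm I (adj F) - trace_norm I (centred p edges F))\<bar>
      \<le> bexp p edges (\<lambda>F. \<bar>trace_norm I (adj F) - trace_norm I (centred p edges F)\<bar>)"
    using norm_bexp_le[OF p, of edges "\<lambda>F. trace_norm I (adj F) - trace_norm I (centred p edges F)"] by simp
  also have "\<dots> \<le> 2 * card I"
    by (intro bexp_le_const[OF p finite_edges] trace_norm_adj_centred)
  finally show ?thesis using 1 unfolding 2 bexp_diff by linarith
qed

lemma trace_norm_adj_upper_tail:
  fixes S t :: real
  assumes S: "4 * card edges \<le> S" "S > 0" and t: "t \<ge> 0"
  shows "bexp p edges (\<lambda>F. of_bool (trace_norm I (adj F) \<ge> bexp p edges (\<lambda>F. trace_norm I (adj F)) + t))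
    \<le> exp (- t\<^sup>2 / (4 * S))"
proof (rule bounded_differences_upper_tail[OF p finite_edges _ _ S(2) t, of _ "\<lambda>_. 2"])
  fix e F assume "e \<in> edges" "F \<subseteq> edges - {e}"
  then show "\<bar>trace_norm I (adj (insert e F)) - trace_norm I (adj F)\<bar> \<le> 2"
    using edges_subset by (intro trace_norm_adj_insert_le[OF finI]) auto
qed (use S in simp)

lemma trace_norm_adj_lower_tail:
  fixes S t :: real
  assumes S: "4 * card edges \<le> S" "S > 0" and t: "t \<ge> 0"
  shows "bexp p edges (\<lambda>F. of_bool (trace_norm I (adj F) \<le> bexp p edges (\<lambda>F. trace_norm I (adj F)) - t))
    \<le> exp (- t\<^sup>2 / (4 * S))"
proof (rule bounded_differences_lower_tail[OF p finite_edges _ _ S(2) t, of _ "\<lambda>_. 2"])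
  fix e F assume "e \<in> edges" "F \<subseteq> edges - {e}"
  then show "\<bar>trace_norm I (adj (insert e F)) - trace_norm I (adj F)\<bar> \<le> 2"
    using edges_subset by (intro trace_norm_adj_insert_le[OF finI]) auto
qed (use S in simp)

end

end

lemma sum_pow32_le:
  fixes x :: "'l \<Rightarrow> real"
  assumes "\<And>i. i \<in> A \<Longrightarrow> 0 \<le> x i \<and> x i \<le> b" "(\<Sum>i\<in>A. x i) \<le> n" "0 \<le> b"
  shows "(\<Sum>i\<in>A. x i * sqrt (x i)) \<le> n * sqrt b"
proof -
  have "(\<Sum>i\<in>A. x i * sqrt (x i)) \<le> (\<Sum>i\<in>A. x i * sqrt b)"
    using assms(1) by (intro sum_mono mult_left_mono) auto
  also have "\<dots> = (\<Sum>i\<in>A. x i) * sqrt b" by (simp add: sum_distrib_right)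
  also have "\<dots> \<le> n * sqrt b" using assms by (intro mult_right_mono) auto
  finally show ?thesis .
qed

text \<open>Four errors of d/4 each: the semicircle limit for the whole set, the same for the large
  parts, the crude bound for the small parts, and the mean matrix. The thresholds depend on
  \<open>p\<close> and \<open>d\<close> only.\<close>

lemma expected_energy_multipartite:
  assumes p: "0 < p" "p < 1" and d: "d > 0"
  defines "c \<equiv> 8 / (3 * pi) * sqrt (p * (1 - p))"
  obtains N0 and \<epsilon> :: real where "\<epsilon> > 0" and "\<And>(I :: 'v set) (L :: 'l set) V R.
      vertex_partition I L V \<Longrightarrow> card I \<ge> N0 \<Longrightarrow> R \<subseteq> L \<Longrightarrow> \<forall>i\<in>R. card (V i) \<ge> N0 \<Longrightarrow>
      \<forall>i\<in>L - R. real (card (V i)) \<le> \<epsilon> * card I \<Longrightarrow>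
      \<bar>bexp p (vertex_partition.edges I L V) (\<lambda>F. trace_norm I (adj F)) - c * (card I * sqrt (card I))\<bar>
        \<le> c * (\<Sum>i\<in>R. card (V i) * sqrt (card (V i))) + d * (card I * sqrt (card I))"
proof -
  have d4: "d / 4 > 0" using d by simp
  obtain N1 where N1: "\<And>I :: 'v set. finite I \<Longrightarrow> card I \<ge> N1 \<Longrightarrow>
    \<bar>bexp p (all_edges I) (\<lambda>F. trace_norm I (centred p (all_edges I) F))
      - c * (card I * sqrt (card I))\<bar> \<le> d / 4 * (card I * sqrt (card I))"
    using expected_trace_norm_asymptotics[OF p d4] unfolding c_def by blast
  define N0 where "N0 = N1 + nat \<lceil>(8 / d)\<^sup>2\<rceil>"
  \<comment> \<open>Chosen so that sqrt \<epsilon> = d/4 in the bound for the small parts.\<close>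
  define \<epsilon> where "\<epsilon> = (d / 4)\<^sup>2"
  have \<epsilon>: "\<epsilon> > 0" using d by (simp add: \<epsilon>_def)
  have main: "\<bar>bexp p (vertex_partition.edges I L V) (\<lambda>F. trace_norm I (adj F)) - c * (card I * sqrt (card I))\<bar>
        \<le> c * (\<Sum>i\<in>R. card (V i) * sqrt (card (V i))) + d * (card I * sqrt (card I))"
    if vp: "vertex_partition I L V" and I: "card I \<ge> N0" and RL: "R \<subseteq> L" and R: "\<forall>i\<in>R. card (V i) \<ge> N0"
      and nR: "\<forall>i\<in>L - R. real (card (V i)) \<le> \<epsilon> * card I" for I :: "'v set" and L :: "'l set" and V R
  proof -
    interpret vertex_partition I L V by fact
    define n where "n = real (card I)"
    define Q where "Q = n * sqrt n"
    have n0: "n \<ge> 0" by (simp add: n_def)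
    have Q: "Q \<ge> 0" by (simp add: Q_def n_def)
    define X where "X = bexp p edges (\<lambda>F. trace_norm I (adj F))"
    define v where "v i = real (card (V i))" for i
    have sv: "(\<Sum>i\<in>L. v i) = n" using sum_card_V by (simp add: v_def n_def flip: of_nat_sum)
    have v0: "v i \<ge> 0" for i by (simp add: v_def)
    have vn: "v i \<le> n" if "i \<in> L" for i
      using V_subset[OF that] finI by (simp add: v_def n_def card_mono)
    have svA: "(\<Sum>i\<in>A. v i) \<le> n" if "A \<subseteq> L" for A
      unfolding sv[symmetric] using finL that v0 by (intro sum_mono2) auto
    have "\<bar>X - expected_norm p I\<bar> \<le> (\<Sum>i\<in>L. expected_norm p (V i)) + 2 * n"
      using expected_trace_norm_adj[OF p] by (simp add: X_def n_def)
    moreover have "\<bar>expected_norm p I - c * Q\<bar> \<le> d / 4 * Q"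
      using N1[OF finI] I by (simp add: expected_norm_def Q_def n_def N0_def)
    moreover have "(\<Sum>i\<in>L. expected_norm p (V i)) = (\<Sum>i\<in>R. expected_norm p (V i)) + (\<Sum>i\<in>L - R. expected_norm p (V i))"
      using sum.subset_diff[OF RL finL] by (simp add: add.commute)
    moreover have "(\<Sum>i\<in>R. expected_norm p (V i)) \<le> (\<Sum>i\<in>R. c * (v i * sqrt (v i)) + d / 4 * (v i * sqrt (v i)))"
    proof (rule sum_mono)
      fix i assume i: "i \<in> R"
      then have "finite (V i)" "card (V i) \<ge> N1" using RL finite_V R by (auto simp: N0_def)
      from N1[OF this] show "expected_norm p (V i) \<le> c * (v i * sqrt (v i)) + d / 4 * (v i * sqrt (v i))"
        unfolding expected_norm_def v_def by linarith
    qed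
    moreover have "(\<Sum>i\<in>R. c * (v i * sqrt (v i)) + d / 4 * (v i * sqrt (v i)))
        = c * (\<Sum>i\<in>R. v i * sqrt (v i)) + d / 4 * (\<Sum>i\<in>R. v i * sqrt (v i))"
      by (simp add: sum.distrib sum_distrib_left)
    moreover have "(\<Sum>i\<in>R. v i * sqrt (v i)) \<le> Q"
      unfolding Q_def using RL vn v0 n0 by (intro sum_pow32_le svA) auto
    then have "d / 4 * (\<Sum>i\<in>R. v i * sqrt (v i)) \<le> d / 4 * Q"
      using d by (intro mult_left_mono) auto
    moreover have "(\<Sum>i\<in>L - R. expected_norm p (V i)) \<le> (\<Sum>i\<in>L - R. v i * sqrt (v i))"
      unfolding v_def using finite_V by (intro sum_mono expected_norm_le[OF p]) auto
    moreover have "(\<Sum>i\<in>L - R. v i * sqrt (v i)) \<le> n * sqrt (\<epsilon> * n)"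
      using nR v0 n0 \<open>\<epsilon> > 0\<close> by (intro sum_pow32_le svA) (auto simp: v_def n_def)
    moreover have "n * sqrt (\<epsilon> * n) = d / 4 * Q"
      using d by (simp add: \<epsilon>_def Q_def real_sqrt_mult)
    moreover have "2 * n \<le> d / 4 * Q"
    proof -
      have "(8 / d)\<^sup>2 \<le> n" using I unfolding N0_def n_def by linarith
      then have "8 / d \<le> sqrt n" by (rule real_le_rsqrt)
      then have "2 \<le> d / 4 * sqrt n" using d by (simp add: field_simps)
      from mult_right_mono[OF this n0] show ?thesis by (simp add: Q_def mult_ac)
    qed
    ultimately have "\<bar>X - c * Q\<bar> \<le> c * (\<Sum>i\<in>R. v i * sqrt (v i)) + d * Q" by linarith
    then show ?thesis by (simp add: X_def Q_def n_def v_def)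
  qed
  show ?thesis by (rule that[OF \<epsilon> main])
qed

section \<open>Fourth moments of centred edge indicators\<close>

text \<open>Bookkeeping for \<open>gram_second_moment\<close>, where only index patterns with j = k
  or l = l' contribute; the last term of the hypothesis pays for both at once.\<close>

lemma sum_quadruples_le:
  fixes f :: "'a \<Rightarrow> 'a \<Rightarrow> 'b \<Rightarrow> 'b \<Rightarrow> real"
  assumes fin: "finite P" "finite Q"
    and f: "\<And>j k l l'. j \<in> P \<Longrightarrow> k \<in> P \<Longrightarrow> l \<in> Q \<Longrightarrow> l' \<in> Q \<Longrightarrow>
      f j k l l' \<le> c * of_bool (j = k) + c * of_bool (l = l') + of_bool (j = k) * of_bool (l = l')"
  shows "(\<Sum>j\<in>P. \<Sum>k\<in>P. \<Sum>l\<in>Q. \<Sum>l'\<in>Q. f j k l l')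
    \<le> c * (card P * (card Q)\<^sup>2 + (card P)\<^sup>2 * card Q) + card P * card Q"
proof -
  have one: "(\<Sum>x\<in>A. of_bool (y = x)) = (1::real)" if "finite A" "y \<in> A" for A and y :: 'z
    using sum_mult_of_bool(4)[OF that, of "\<lambda>_. 1"] by simp
  have "(\<Sum>j\<in>P. \<Sum>k\<in>P. \<Sum>l\<in>Q. \<Sum>l'\<in>Q. f j k l l')
      \<le> (\<Sum>j\<in>P. \<Sum>k\<in>P. \<Sum>l\<in>Q. \<Sum>l'\<in>Q. c * of_bool (j = k) + c * of_bool (l = l') + of_bool (j = k) * of_bool (l = l'))"
    by (intro sum_mono f)
  also have "\<dots> = (\<Sum>j\<in>P. \<Sum>k\<in>P. c * (card Q)\<^sup>2 * of_bool (j = k) + c * card Q + card Q * of_bool (j = k))"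
  proof (intro sum.cong refl)
    fix j k
    have "(\<Sum>l\<in>Q. \<Sum>l'\<in>Q. c * of_bool (j = k) + c * of_bool (l = l') + of_bool (j = k) * of_bool (l = l'))
        = (\<Sum>l\<in>Q. card Q * (c * of_bool (j = k)) + c + of_bool (j = k))"
      using one fin by (intro sum.cong refl) (simp add: sum.distrib flip: sum_distrib_left)
    then show "(\<Sum>l\<in>Q. \<Sum>l'\<in>Q. c * of_bool (j = k) + c * of_bool (l = l') + of_bool (j = k) * of_bool (l = l'))
        = c * (card Q)\<^sup>2 * of_bool (j = k) + c * card Q + card Q * of_bool (j = k)"
      by (simp add: power2_eq_square algebra_simps)
  qed
  also have "\<dots> = (\<Sum>j\<in>P. c * (card Q)\<^sup>2 + card P * (c * card Q) + card Q)"
    using one fin by (intro sum.cong refl) (simp add: sum.distrib flip: sum_distrib_left)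
  also have "\<dots> = c * (card P * (card Q)\<^sup>2 + (card P)\<^sup>2 * card Q) + card P * card Q"
    by (simp add: power2_eq_square algebra_simps)
  finally show ?thesis .
qed

text \<open>Unlike \<open>centred\<close> this has no mask; the restriction to crossing pairs is
  imposed in \<open>bip\<close>.\<close>

definition fluct :: "real \<Rightarrow> 'v set set \<Rightarrow> 'v \<Rightarrow> 'v \<Rightarrow> real" where
  "fluct p F j k = of_bool ({j, k} \<in> F) - p"

lemma fluct_sym: "fluct p F j k = fluct p F k j"
  by (simp add: fluct_def insert_commute)

lemma fluct_other:
  assumes "e \<noteq> {j, k}"
  shows "fluct p (insert e F) j k = fluct p F j k" "fluct p (F - {e}) j k = fluct p F j k"
  using assms by (auto simp: fluct_def)

context
  fixes p :: real
  assumes p: "0 < p" "p < 1"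
begin

lemma fluct_abs_le: "\<bar>fluct p F j k\<bar> \<le> 1"
  using p by (auto simp: fluct_def)

lemma bexp_fluct_square:
  assumes fin: "finite E" and e: "{j, k} \<in> E"
  shows "bexp p E (\<lambda>F. (fluct p F j k)\<^sup>2) = p * (1 - p)"
  using bexp_square_independent(2)[OF fin e, of "\<lambda>_. 1" p] fin by (simp add: fluct_def bexp_const)

lemma bexp_fluct_mult:
  assumes fin: "finite E" and e: "{j, k} \<in> E" "{j', k'} \<in> E"
  shows "bexp p E (\<lambda>F. fluct p F j k * fluct p F j' k') = p * (1 - p) * of_bool ({j, k} = {j', k'})"
proof (cases "{j, k} = {j', k'}")
  case True
  then have "fluct p F j k * fluct p F j' k' = (fluct p F j k)\<^sup>2" for F by (simp add: fluct_def power2_eq_square)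
  then show ?thesis using bexp_fluct_square[OF fin e(1)] True by simp
next
  case False
  then have "bexp p E (\<lambda>F. (of_bool ({j, k} \<in> F) - p) * fluct p F j' k') = 0"
    by (intro bexp_square_independent(1)[OF fin e(1)]) (simp add: fluct_other)
  then show ?thesis using False by (simp add: fluct_def)
qed

lemma bexp_fluct_square_mult:
  assumes fin: "finite E" and e: "{j, k} \<in> E" "{j', k'} \<in> E" "{j, k} \<noteq> {j', k'}"
  shows "bexp p E (\<lambda>F. (fluct p F j k)\<^sup>2 * (fluct p F j' k')\<^sup>2) = (p * (1 - p))\<^sup>2"
proof -
  have "bexp p E (\<lambda>F. (of_bool ({j, k} \<in> F) - p)\<^sup>2 * (fluct p F j' k')\<^sup>2) = p * (1 - p) * bexp p E (\<lambda>F. (fluct p F j' k')\<^sup>2)"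
    using e(3) by (intro bexp_square_independent(2)[OF fin e(1)]) (simp add: fluct_other)
  then show ?thesis using bexp_fluct_square[OF fin e(2)] by (simp add: fluct_def power2_eq_square)
qed

text \<open>Expanding the square gives closed walks j, l, k, l' between \<open>P\<close> and
  \<open>Q\<close>. If j differs from k and l from l', the four edges are distinct and a factor of
  mean zero splits off; if exactly one pair coincides, two squared edges give (p(1-p))^2; if both
  do, the bound 1 suffices.\<close>

lemma gram_second_moment:
  fixes P Q :: "'v set"
  assumes fin: "finite E" and PQ: "finite P" "finite Q" "P \<inter> Q = {}"
    and E: "\<And>x y. x \<in> P \<Longrightarrow> y \<in> Q \<Longrightarrow> {x, y} \<in> E"
  shows "bexp p E (\<lambda>F. \<Sum>j\<in>P. \<Sum>k\<in>P. (\<Sum>l\<in>Q. fluct p F j l * fluct p F k l)\<^sup>2)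
    \<le> (p * (1 - p))\<^sup>2 * (card P * (card Q)\<^sup>2 + (card P)\<^sup>2 * card Q) + card P * card Q"
proof -
  define s where "s = (p * (1 - p))\<^sup>2"
  have s: "0 \<le> s" by (simp add: s_def)
  define f where "f j k l l' = bexp p E (\<lambda>F. fluct p F j l * fluct p F k l * (fluct p F j l' * fluct p F k l'))" for j k l l'
  have "bexp p E (\<lambda>F. \<Sum>j\<in>P. \<Sum>k\<in>P. (\<Sum>l\<in>Q. fluct p F j l * fluct p F k l)\<^sup>2) = (\<Sum>j\<in>P. \<Sum>k\<in>P. \<Sum>l\<in>Q. \<Sum>l'\<in>Q. f j k l l')"
    unfolding power2_eq_square sum_product bexp_sum f_def ..
  also have "\<dots> \<le> s * (card P * (card Q)\<^sup>2 + (card P)\<^sup>2 * card Q) + card P * card Q"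
  proof (rule sum_quadruples_le[OF PQ(1,2)])
    fix j k l l' assume jk: "j \<in> P" "k \<in> P" and l: "l \<in> Q" "l' \<in> Q"
    have ne: "j \<noteq> l" "j \<noteq> l'" "k \<noteq> l" "k \<noteq> l'" using jk l PQ(3) by auto
    consider "j = k" "l = l'" | "j = k" "l \<noteq> l'" | "j \<noteq> k" "l = l'" | "j \<noteq> k" "l \<noteq> l'" by blast
    then show "f j k l l' \<le> s * of_bool (j = k) + s * of_bool (l = l') + of_bool (j = k) * of_bool (l = l')"
    proof cases
      case 1
      have "f j k l l' \<le> 1"
        unfolding f_def
      proof (rule bexp_le_const[OF p fin])
        fix F
        have "\<bar>fluct p F j l * fluct p F k l * (fluct p F j l' * fluct p F k l')\<bar> \<le> 1"
          unfolding abs_mult by (intro mult_le_one mult_nonneg_nonneg fluct_abs_le) auto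
        then show "fluct p F j l * fluct p F k l * (fluct p F j l' * fluct p F k l') \<le> 1" by linarith
      qed
      then show ?thesis using 1 s by simp
    next
      case 2
      have "f j k l l' = s"
        using bexp_fluct_square_mult[OF fin E E, of j l j l'] jk l 2 ne
        by (simp add: f_def s_def power2_eq_square doubleton_eq_iff)
      then show ?thesis using 2 by simp
    next
      case 3
      have "f j k l l' = s"
        using bexp_fluct_square_mult[OF fin E E, of j l k l] jk l 3 ne
        by (simp add: f_def s_def power2_eq_square doubleton_eq_iff mult_ac)
      then show ?thesis using 3 by simp
    next
      case 4
      have d: "{j, l} \<noteq> {k, l}" "{j, l} \<noteq> {j, l'}" "{j, l} \<noteq> {k, l'}"
        using 4 ne by (auto simp: doubleton_eq_iff)
      have "bexp p E (\<lambda>F. (of_bool ({j, l} \<in> F) - p) * (fluct p F k l * (fluct p F j l' * fluct p F k l'))) = 0"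
        using d by (intro bexp_square_independent(1)[OF fin E[OF jk(1) l(1)]]) (simp add: fluct_other)
      then have "f j k l l' = 0" by (simp add: f_def fluct_def mult.assoc)
      then show ?thesis using 4 by simp
    qed
  qed
  finally show ?thesis by (simp add: s_def)
qed

end

section \<open>Graphs dominated by a single part\<close>

text \<open>The other parts are merged into the complement of \<open>A\<close>, where
  \<open>E\<close> is left arbitrary; in the bounds they enter only through the size of that
  complement.\<close>

locale big_part =
  fixes I A :: "'v set" and E :: "'v set set" and p :: real
  assumes finI: "finite I" and AI: "A \<subseteq> I" and EI: "E \<subseteq> all_edges I"
    and cross: "\<And>w v. w \<in> I - A \<Longrightarrow> v \<in> A \<Longrightarrow> {w, v} \<in> E"
    and no_inner: "E \<inter> all_edges A = {}"
    and ne: "A \<noteq> {}" "I - A \<noteq> {}"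
    and p: "0 < p" "p < 1"
begin

section \<open>The centred bipartite matrix between the large part and its complement\<close>

definition "W = I - A"
definition "k = real (card W)"
definition "N = real (card A)"
definition "n = real (card I)"
definition "s = p * (1 - p)"

definition bip :: "'v set set \<Rightarrow> 'v \<Rightarrow> 'v \<Rightarrow> real" where
  "bip F i j = (if (i \<in> A) = (j \<in> A) then 0 else fluct p F i j)"

lemma finA: "finite A" and finW: "finite W" and finE: "finite E"
  using finI AI EI finite_all_edges[OF finI] by (auto simp: W_def intro: finite_subset)

lemma WA: "W \<inter> A = {}" by (auto simp: W_def)

lemma crossW: "w \<in> W \<Longrightarrow> v \<in> A \<Longrightarrow> {w, v} \<in> E" using cross by (simp add: W_def)

lemma crossW': "v \<in> A \<Longrightarrow> w \<in> W \<Longrightarrow> {v, w} \<in> E" by (metis crossW insert_commute)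

lemma pos: "k \<ge> 1" "N \<ge> 1" "n = k + N" "s > 0" "s \<le> 1"
proof -
  show "k \<ge> 1" "N \<ge> 1" using ne finA finW by (auto simp: k_def N_def W_def Suc_le_eq card_gt_0_iff)
  have "card A \<le> card I" using AI finI by (rule card_mono[rotated])
  then show "n = k + N" using AI finA finI by (simp add: n_def k_def N_def W_def card_Diff_subset)
  show "s > 0" using p by (simp add: s_def)
  show "s \<le> 1" using p by (simp add: s_def mult_le_one)
qed

lemma sumI: "(\<Sum>j\<in>I. f j) = (\<Sum>j\<in>W. f j) + (\<Sum>j\<in>A. f j)" for f :: "'v \<Rightarrow> real"
  unfolding W_def by (rule sum.subset_diff[OF AI finI])

lemma inW: "j \<in> W \<Longrightarrow> j \<notin> A" by (simp add: W_def)

lemma sum_cross: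
  fixes g :: "'v \<Rightarrow> 'v \<Rightarrow> real"
  shows "(\<Sum>i\<in>I. \<Sum>j\<in>I. if (i \<in> A) = (j \<in> A) then 0 else g i j) = (\<Sum>w\<in>W. \<Sum>v\<in>A. g w v + g v w)"
proof -
  have "(\<Sum>i\<in>I. \<Sum>j\<in>I. if (i \<in> A) = (j \<in> A) then 0 else g i j) = (\<Sum>i\<in>W. \<Sum>j\<in>A. g i j) + (\<Sum>i\<in>A. \<Sum>j\<in>W. g i j)"
    using inW by (simp add: sumI cong: sum.cong)
  also have "(\<Sum>i\<in>A. \<Sum>j\<in>W. g i j) = (\<Sum>j\<in>W. \<Sum>i\<in>A. g i j)" by (rule sum.swap)
  finally show ?thesis by (simp add: sum.distrib)
qed

lemma bip_symmetric: "symmetric_on I (bip F)"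
  unfolding symmetric_on_def bip_def using fluct_sym[of p F] by auto

lemma bip_row:
  assumes "i \<in> I" "j \<in> I"
  shows "(\<Sum>l\<in>I. bip F i l * bip F l j) =
    (if i \<in> A \<and> j \<in> A then \<Sum>l\<in>W. fluct p F i l * fluct p F j l
     else if i \<notin> A \<and> j \<notin> A then \<Sum>l\<in>A. fluct p F i l * fluct p F j l else 0)"
proof -
  have "bip F l j = bip F j l" for l using fluct_sym[of p F l j] by (auto simp: bip_def)
  then show ?thesis using inW by (auto simp: sumI bip_def intro!: sum.neutral sum.cong)
qed

lemma sum_bip_square: "(\<Sum>i\<in>I. \<Sum>j\<in>I. (bip F i j)\<^sup>2) = 2 * (\<Sum>w\<in>W. \<Sum>v\<in>A. (fluct p F w v)\<^sup>2)"
proof -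
  have "(\<Sum>i\<in>I. \<Sum>j\<in>I. (bip F i j)\<^sup>2) = (\<Sum>i\<in>I. \<Sum>j\<in>I. if (i \<in> A) = (j \<in> A) then 0 else (fluct p F i j)\<^sup>2)"
    by (intro sum.cong refl) (simp add: bip_def)
  also have "\<dots> = (\<Sum>w\<in>W. \<Sum>v\<in>A. (fluct p F w v)\<^sup>2 + (fluct p F v w)\<^sup>2)" by (rule sum_cross)
  also have "\<dots> = (\<Sum>w\<in>W. \<Sum>v\<in>A. 2 * (fluct p F w v)\<^sup>2)"
    using fluct_sym[of p F] by (intro sum.cong refl) (metis mult_2)
  finally show ?thesis by (simp add: sum_distrib_left)
qed

lemma sum_bip_fourth:
  "(\<Sum>i\<in>I. \<Sum>j\<in>I. (\<Sum>l\<in>I. bip F i l * bip F l j)\<^sup>2)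
    = (\<Sum>i\<in>W. \<Sum>j\<in>W. (\<Sum>l\<in>A. fluct p F i l * fluct p F j l)\<^sup>2)
    + (\<Sum>i\<in>A. \<Sum>j\<in>A. (\<Sum>l\<in>W. fluct p F i l * fluct p F j l)\<^sup>2)"
proof -
  define g where "g i j = (if i \<in> A \<and> j \<in> A then (\<Sum>l\<in>W. fluct p F i l * fluct p F j l)\<^sup>2
     else if i \<notin> A \<and> j \<notin> A then (\<Sum>l\<in>A. fluct p F i l * fluct p F j l)\<^sup>2 else 0)" for i j
  have "(\<Sum>i\<in>I. \<Sum>j\<in>I. (\<Sum>l\<in>I. bip F i l * bip F l j)\<^sup>2) = (\<Sum>i\<in>I. \<Sum>j\<in>I. g i j)"
    by (intro sum.cong refl) (simp add: bip_row g_def)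
  also have "\<dots> = (\<Sum>i\<in>W. \<Sum>j\<in>W. g i j) + (\<Sum>i\<in>W. \<Sum>j\<in>A. g i j) + ((\<Sum>i\<in>A. \<Sum>j\<in>W. g i j) + (\<Sum>i\<in>A. \<Sum>j\<in>A. g i j))"
    by (simp add: sumI sum.distrib)
  also have "(\<Sum>i\<in>W. \<Sum>j\<in>A. g i j) = 0" using inW by (intro sum.neutral ballI) (simp add: g_def)
  also have "(\<Sum>i\<in>A. \<Sum>j\<in>W. g i j) = 0" using inW by (intro sum.neutral ballI) (simp add: g_def)
  also have "(\<Sum>i\<in>W. \<Sum>j\<in>W. g i j) = (\<Sum>i\<in>W. \<Sum>j\<in>W. (\<Sum>l\<in>A. fluct p F i l * fluct p F j l)\<^sup>2)"
    using inW by (intro sum.cong refl) (simp add: g_def)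
  also have "(\<Sum>i\<in>A. \<Sum>j\<in>A. g i j) = (\<Sum>i\<in>A. \<Sum>j\<in>A. (\<Sum>l\<in>W. fluct p F i l * fluct p F j l)\<^sup>2)"
    by (intro sum.cong refl) (simp add: g_def)
  finally show ?thesis by simp
qed

text \<open>The tangent point a = sqrt (s n) matches the expected singular values sqrt (s N) when
  \<open>N\<close> is close to \<open>n\<close>; for s^2 n large the bound is then about 2 k sqrt (s
  n).\<close>

lemma expected_trace_norm_bip_ge:
  "bexp p E (\<lambda>F. trace_norm I (bip F)) \<ge> k * N * (2 * s\<^sup>2 * n - 1) / (s * n * sqrt (s * n))"
proof -
  define a where "a = sqrt (s * n)"
  have sn: "s * n > 0" using pos by simp
  then have a: "a > 0" "a\<^sup>2 = s * n" by (auto simp: a_def)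
  have a3: "a ^ 3 = s * n * a" using a by (simp add: power3_eq_cube power2_eq_square)
  define SS where "SS F = (\<Sum>i\<in>I. \<Sum>j\<in>I. (bip F i j)\<^sup>2)" for F
  define QQ where "QQ F = (\<Sum>i\<in>I. \<Sum>j\<in>I. (\<Sum>l\<in>I. bip F i l * bip F l j)\<^sup>2)" for F
  have SS: "bexp p E SS = 2 * (k * N * s)"
  proof -
    have "bexp p E SS = 2 * (\<Sum>w\<in>W. \<Sum>v\<in>A. bexp p E (\<lambda>F. (fluct p F w v)\<^sup>2))"
      unfolding SS_def sum_bip_square bexp_mult_left bexp_sum ..
    also have "\<dots> = 2 * (\<Sum>w\<in>W. \<Sum>v\<in>A. s)"
      using crossW by (simp add: bexp_fluct_square[OF p finE] s_def)
    finally show ?thesis by (simp add: k_def N_def)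
  qed
  have QQ: "bexp p E QQ \<le> 2 * (s\<^sup>2 * k * N * n + k * N)"
  proof -
    have "bexp p E QQ = bexp p E (\<lambda>F. \<Sum>i\<in>W. \<Sum>j\<in>W. (\<Sum>l\<in>A. fluct p F i l * fluct p F j l)\<^sup>2)
        + bexp p E (\<lambda>F. \<Sum>i\<in>A. \<Sum>j\<in>A. (\<Sum>l\<in>W. fluct p F i l * fluct p F j l)\<^sup>2)"
      unfolding QQ_def sum_bip_fourth by (rule bexp_add)
    also have "\<dots> \<le> (s\<^sup>2 * (card W * (card A)\<^sup>2 + (card W)\<^sup>2 * card A) + card W * card A)
        + (s\<^sup>2 * (card A * (card W)\<^sup>2 + (card A)\<^sup>2 * card W) + card A * card W)"
      unfolding s_def
    proof (intro add_mono gram_second_moment p finE finA finW)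
      show "W \<inter> A = {}" "A \<inter> W = {}" using WA by auto
    qed (use crossW crossW' in auto)
    also have "\<dots> = 2 * (s\<^sup>2 * k * N * n + k * N)"
      unfolding pos(3) by (simp add: k_def N_def power2_eq_square algebra_simps)
    finally show ?thesis .
  qed
  have "k * N * (2 * s\<^sup>2 * n - 1) / (s * n * a) = (3 * a\<^sup>2 * (2 * (k * N * s)) - 2 * (s\<^sup>2 * k * N * n + k * N)) / (2 * a ^ 3)"
  proof -
    have "3 * (s * n) * (2 * (k * N * s)) - 2 * (s\<^sup>2 * k * N * n + k * N) = 2 * (k * N * (2 * s\<^sup>2 * n - 1))"
      by (simp add: power2_eq_square algebra_simps)
    then show ?thesis unfolding a3 a(2) by simp
  qed
  also have "\<dots> \<le> (3 * a\<^sup>2 * bexp p E SS - bexp p E QQ) / (2 * a ^ 3)"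
    unfolding SS using QQ a by (intro divide_right_mono) auto
  also have "\<dots> = bexp p E (\<lambda>F. (3 * a\<^sup>2 * SS F - QQ F) / (2 * a ^ 3))"
    by (simp only: bexp_divide bexp_diff bexp_mult_left)
  also have "\<dots> \<le> bexp p E (\<lambda>F. trace_norm I (bip F))"
    unfolding SS_def QQ_def by (intro bexp_mono[OF p] trace_norm_ge_tangent[OF finI bip_symmetric a(1)])
  finally show ?thesis by (simp add: a_def)
qed

text \<open>Pinching removes the entries inside the complement. The mean of the rest is a rank-two
  matrix built from the indicators of \<open>A\<close> and of \<open>W\<close>, and the weight sqrt
  (k/N) balances their norms.\<close>

lemma trace_norm_adj_ge_bip: "trace_norm I (adj F) \<ge> trace_norm I (bip F) - 2 * sqrt (k * N)"
proof -
  define B where "B i j = (if (i \<in> A) = (j \<in> A) then 0 else adj F i j)" for i j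
  define x where "x j = p * of_bool (j \<in> A)" for j
  define y where "y j = (of_bool (j \<notin> A) :: real)" for j
  have B: "symmetric_on I B" using adj_symmetric[of I F] by (auto simp: symmetric_on_def B_def)
  have "\<bar>trace_norm I B - trace_norm I (bip F)\<bar> \<le> trace_norm I (\<lambda>i j. B i j - bip F i j)"
    by (rule trace_norm_diff_le[OF finI B bip_symmetric])
  also have "(\<lambda>i j. B i j - bip F i j) = (\<lambda>i j. x i * y j + y i * x j)"
    by (intro ext) (auto simp: B_def bip_def fluct_def adj_def x_def y_def)
  also have "trace_norm I \<dots> \<le> sqrt k / sqrt N * (\<Sum>j\<in>I. (x j)\<^sup>2) + (\<Sum>j\<in>I. (y j)\<^sup>2) / (sqrt k / sqrt N)"
    using pos by (intro trace_norm_rank_two_le[OF finI]) auto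
  also have "(\<Sum>j\<in>I. (x j)\<^sup>2) = p\<^sup>2 * N"
    using inW by (simp add: sumI x_def N_def power_mult_distrib cong: sum.cong)
  also have "(\<Sum>j\<in>I. (y j)\<^sup>2) = k"
    using inW by (simp add: sumI y_def k_def cong: sum.cong)
  also have "sqrt k / sqrt N * (p\<^sup>2 * N) + k / (sqrt k / sqrt N) \<le> sqrt k / sqrt N * (1 * N) + k / (sqrt k / sqrt N)"
    using p pos by (intro add_mono mult_left_mono mult_right_mono) (auto simp: power_le_one)
  also have "\<dots> = 2 * sqrt (k * N)"
  proof -
    have "k = sqrt k * sqrt k" "N = sqrt N * sqrt N" "sqrt k > 0" "sqrt N > 0" using pos by auto
    then have "N / sqrt N = sqrt N" "k / sqrt k = sqrt k" by (auto simp: field_simps)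
    moreover have "sqrt k / sqrt N * (1 * N) + k / (sqrt k / sqrt N) = sqrt k * (N / sqrt N) + (k / sqrt k) * sqrt N" by simp
    ultimately show ?thesis by (simp only:) (simp add: real_sqrt_mult)
  qed
  finally have "trace_norm I B \<ge> trace_norm I (bip F) - 2 * sqrt (k * N)" by linarith
  moreover have "trace_norm I B \<le> trace_norm I (adj F)"
    unfolding B_def[abs_def] by (rule trace_norm_bipartite_le[OF finI adj_symmetric])
  ultimately show ?thesis by linarith
qed

text \<open>Every edge has an endpoint outside \<open>A\<close>. Counting k n rather than n^2 edges
  is what makes bounded differences effective on the scale k sqrt n.\<close>

lemma card_E_le: "real (card E) \<le> k * n"
proof -
  have "E \<subseteq> (\<lambda>(w, v). {w, v}) ` (W \<times> I)"
  proof
    fix e assume e: "e \<in> E"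
    then obtain a b where ab: "e = {a, b}" "a \<in> I" "b \<in> I" "a \<noteq> b" using EI by (auto simp: all_edges_def)
    then have "a \<in> W \<or> b \<in> W" using e no_inner by (auto simp: W_def all_edges_def)
    then show "e \<in> (\<lambda>(w, v). {w, v}) ` (W \<times> I)"
      using ab by (auto simp: image_iff)
  qed
  then have "card E \<le> card ((\<lambda>(w, v). {w, v}) ` (W \<times> I))" using finW finI by (intro card_mono) auto
  also have "\<dots> \<le> card (W \<times> I)" using finW finI by (intro card_image_le) auto
  finally show ?thesis by (simp add: card_cartesian_product k_def n_def flip: of_nat_mult)
qed

text \<open>With Y = k sqrt (s n), the centred mean is at least 171/100 Y, where 171/100 is 9/10
  from \<open>N\<close> times 19/10 from s^2 n \<ge> 10. Since s k \<ge> 400, the mean matrix costs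
  at most Y/10; a deviation of Y/10 then still leaves more than 4/3 Y.\<close>

lemma many_outside_tail:
  assumes N: "N \<ge> 9 / 10 * n" and sn: "s\<^sup>2 * n \<ge> 10" and sk: "s * k \<ge> 400"
  shows "bexp p E (\<lambda>F. of_bool (trace_norm I (adj F) \<le> 4 / 3 * (k * sqrt (s * n)))) \<le> exp (- (s * k) / 1600)"
proof -
  define Y where "Y = k * sqrt (s * n)"
  have Y: "Y \<ge> 0" using pos by (simp add: Y_def)
  have n0: "n > 0" using pos by linarith
  have sn0: "s * n > 0" using pos n0 by simp
  define X where "X = bexp p E (\<lambda>F. trace_norm I (adj F))"
  have "X \<ge> bexp p E (\<lambda>F. trace_norm I (bip F) - 2 * sqrt (k * N))"
    unfolding X_def by (intro bexp_mono[OF p] trace_norm_adj_ge_bip)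
  then have 1: "X \<ge> bexp p E (\<lambda>F. trace_norm I (bip F)) - 2 * sqrt (k * N)"
    using finE by (simp add: bexp_diff bexp_const)
  have 2: "2 * sqrt (k * N) \<le> 1 / 10 * Y"
  proof (rule power2_le_imp_le)
    have "(2 * sqrt (k * N))\<^sup>2 = 4 * (k * N)" using pos by (simp add: power_mult_distrib)
    also have "\<dots> \<le> 4 * (k * n)" using pos by (intro mult_left_mono) auto
    also have "\<dots> \<le> 1 / 100 * (s * k) * (k * n)"
      using sk pos n0 by (simp add: mult_right_mono)
    also have "\<dots> = (1 / 10 * Y)\<^sup>2" using sn0 by (simp add: Y_def power_mult_distrib power2_eq_square)
    finally show "(2 * sqrt (k * N))\<^sup>2 \<le> (1 / 10 * Y)\<^sup>2" .
  qed (use Y in simp)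
  have "171 / 100 * Y \<le> k * N * (2 * s\<^sup>2 * n - 1) / (s * n * sqrt (s * n))"
  proof -
    have "171 / 100 * Y * (s * n * sqrt (s * n)) = k * (9 / 10 * n) * (19 / 10 * (s\<^sup>2 * n))"
      using sn0 by (simp add: Y_def power2_eq_square)
    also have "\<dots> \<le> k * N * (2 * s\<^sup>2 * n - 1)"
    proof (intro mult_mono)
      show "19 / 10 * (s\<^sup>2 * n) \<le> 2 * s\<^sup>2 * n - 1" using sn by linarith
    qed (use N pos n0 in auto)
    finally show ?thesis using sn0 by (simp add: pos_le_divide_eq)
  qed
  then have X: "X \<ge> 161 / 100 * Y" using 1 2 expected_trace_norm_bip_ge by linarith
  have "bexp p E (\<lambda>F. of_bool (trace_norm I (adj F) \<le> 4 / 3 * Y) :: real) \<le>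
      bexp p E (\<lambda>F. of_bool (trace_norm I (adj F) \<le> bexp p E (\<lambda>F. trace_norm I (adj F)) - 1 / 10 * Y))"
  proof (rule bexp_mono[OF p])
    fix F
    show "of_bool (trace_norm I (adj F) \<le> 4 / 3 * Y) \<le>
       (of_bool (trace_norm I (adj F) \<le> bexp p E (\<lambda>F. trace_norm I (adj F)) - 1 / 10 * Y) :: real)"
      using X Y unfolding X_def by auto
  qed
  also have "\<dots> \<le> exp (- (1 / 10 * Y)\<^sup>2 / (4 * (4 * (k * n))))"
  proof (rule bounded_differences_lower_tail[OF p finE, where c = "\<lambda>_. 2"])
    fix e F assume "e \<in> E" "F \<subseteq> E - {e}"
    then show "\<bar>trace_norm I (adj (insert e F)) - trace_norm I (adj F)\<bar> \<le> 2"
      using EI by (intro trace_norm_adj_insert_le[OF finI]) auto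
  qed (use card_E_le pos n0 Y in auto)
  also have "- (1 / 10 * Y)\<^sup>2 / (4 * (4 * (k * n))) = - (s * k) / 1600"
    using pos(1,4) n0 sn0 by (simp add: Y_def power_mult_distrib field_simps power2_eq_square)
  finally show ?thesis by (simp add: Y_def)
qed

section \<open>Few vertices outside the large part: the dual certificate\<close>

definition gram :: "'v set set \<Rightarrow> 'v \<Rightarrow> 'v \<Rightarrow> real" where
  "gram F w w' = (\<Sum>v\<in>A. fluct p F w v * fluct p F w' v)"

text \<open>Products of two centred indicators lie between -p(1-p) and 1 - p(1-p), an interval of
  length 1.\<close>

lemma fluct_mult_diff: "\<bar>fluct p F a b * fluct p F c d - fluct p F' a b * fluct p F' c d\<bar> \<le> 1"
proof -
  have *: "- (p * (1 - p)) \<le> x * y \<and> x * y \<le> 1 - p * (1 - p)" if "x \<in> {1 - p, - p}" "y \<in> {1 - p, - p}" for x y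
    using that by (elim insertE emptyE; hypsubst; use p in \<open>simp add: algebra_simps\<close>)
  have m: "fluct p G x y \<in> {1 - p, - p}" for G x y by (simp add: fluct_def)
  have "- (p * (1 - p)) \<le> fluct p G a b * fluct p G c d \<and> fluct p G a b * fluct p G c d \<le> 1 - p * (1 - p)" for G
    by (rule *[OF m m])
  from this[of F] this[of F'] show ?thesis by linarith
qed

lemma bexp_gram:
  assumes "w \<in> W" "w' \<in> W"
  shows "bexp p E (\<lambda>F. gram F w w') = s * N * of_bool (w = w')"
proof -
  have "bexp p E (\<lambda>F. gram F w w') = (\<Sum>v\<in>A. s * of_bool (w = w'))"
    unfolding gram_def bexp_sum
  proof (intro sum.cong refl)
    fix v assume "v \<in> A"
    then show "bexp p E (\<lambda>F. fluct p F w v * fluct p F w' v) = s * of_bool (w = w')"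
      using bexp_fluct_mult[OF p finE crossW crossW, of w v w' v] assms by (auto simp: s_def doubleton_eq_iff)
  qed
  then show ?thesis by (simp add: N_def)
qed

text \<open>The statistic sees only the at most 2 N edges joining w or w' to \<open>A\<close>, each
  with difference at most 1, so the sum of squared differences is 2 N instead of growing with
  \<open>card E\<close>.\<close>

lemma gram_tail:
  assumes w: "w \<in> W" "w' \<in> W" and b: "b \<ge> 0"
  shows "bexp p E (\<lambda>F. of_bool (\<bar>gram F w w' - s * N * of_bool (w = w')\<bar> \<ge> b)) \<le> 2 * exp (- b\<^sup>2 / (8 * N))"
proof -
  define D where "D = (\<lambda>v. {w, v}) ` A \<union> (\<lambda>v. {w', v}) ` A"
  have diff: "\<bar>gram (insert e F) w w' - gram F w w'\<bar> \<le> of_bool (e \<in> D)" for e F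
  proof (cases "e \<in> D")
    case False
    then have "gram (insert e F) w w' = gram F w w'"
      unfolding gram_def by (intro sum.cong refl) (auto simp: D_def fluct_def)
    then show ?thesis by simp
  next
    case True
    then obtain x v0 where x: "x \<in> {w, w'}" "v0 \<in> A" "e = {x, v0}" by (auto simp: D_def)
    have "\<bar>gram (insert e F) w w' - gram F w w'\<bar>
        \<le> (\<Sum>v\<in>A. \<bar>fluct p (insert e F) w v * fluct p (insert e F) w' v - fluct p F w v * fluct p F w' v\<bar>)"
      unfolding gram_def sum_subtractf[symmetric] by (rule sum_abs)
    also have "\<dots> \<le> (\<Sum>v\<in>A. 1 * of_bool (v = v0))"
    proof (rule sum_mono)
      fix v assume v: "v \<in> A"
      show "\<bar>fluct p (insert e F) w v * fluct p (insert e F) w' v - fluct p F w v * fluct p F w' v\<bar> \<le> 1 * of_bool (v = v0)"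
      proof (cases "v = v0")
        case True
        then show ?thesis using fluct_mult_diff by simp
      next
        case False
        then have "e \<noteq> {w, v}" "e \<noteq> {w', v}" using x v w inW by (auto simp: doubleton_eq_iff)
        then show ?thesis by (simp add: fluct_other)
      qed
    qed
    also have "\<dots> = 1" using sum_mult_of_bool(1)[OF finA x(2), of "\<lambda>_. 1 :: real"] by simp
    finally show ?thesis using True by simp
  qed
  have S: "(\<Sum>e\<in>E. (of_bool (e \<in> D))\<^sup>2) \<le> 2 * N"
  proof -
    have "(\<Sum>e\<in>E. (of_bool (e \<in> D))\<^sup>2 :: real) = (\<Sum>e\<in>E \<inter> D. 1)"
      using finE by (intro sum.mono_neutral_cong_right) auto
    also have "\<dots> = card (E \<inter> D)" by simp
    also have "card (E \<inter> D) \<le> card D" unfolding D_def using finA by (intro card_mono) auto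
    also have "card D \<le> card ((\<lambda>v. {w, v}) ` A) + card ((\<lambda>v. {w', v}) ` A)" unfolding D_def by (rule card_Un_le)
    also have "\<dots> \<le> card A + card A" using finA by (intro add_mono card_image_le)
    finally show ?thesis by (simp add: N_def)
  qed
  have N2: "2 * N > 0" using pos by simp
  let ?f = "\<lambda>F. gram F w w'"
  have mean: "bexp p E ?f = s * N * of_bool (w = w')" by (rule bexp_gram[OF w])
  have "bexp p E (\<lambda>F. of_bool (\<bar>gram F w w' - s * N * of_bool (w = w')\<bar> \<ge> b) :: real)
      \<le> bexp p E (\<lambda>F. of_bool (?f F \<ge> bexp p E ?f + b) + of_bool (?f F \<le> bexp p E ?f - b))"
    unfolding mean by (intro bexp_mono[OF p]) auto
  also have "\<dots> \<le> exp (- b\<^sup>2 / (4 * (2 * N))) + exp (- b\<^sup>2 / (4 * (2 * N)))"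
    unfolding bexp_add
    by (intro add_mono bounded_differences_upper_tail[OF p finE diff S N2 b] bounded_differences_lower_tail[OF p finE diff S N2 b])
  finally show ?thesis by simp
qed

text \<open>Half the entrywise pairing of the adjacency matrix with \<open>bip\<close>, the quantity
  to which duality is applied.\<close>

definition cross_sum :: "'v set set \<Rightarrow> real" where
  "cross_sum F = (\<Sum>w\<in>W. \<Sum>v\<in>A. adj F w v * fluct p F w v)"

lemma bexp_cross_sum: "bexp p E cross_sum = k * N * s"
proof -
  \<comment> \<open>The indicator is its centred version plus p, so the product is a square plus a
    term of mean zero.\<close>
  have "bexp p E cross_sum = (\<Sum>w\<in>W. \<Sum>v\<in>A. bexp p E (\<lambda>F. (fluct p F w v)\<^sup>2 + p * (fluct p F w v)))"
    unfolding cross_sum_def bexp_sum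
    by (intro sum.cong refl bexp_cong) (simp add: adj_def fluct_def power2_eq_square algebra_simps)
  also have "\<dots> = (\<Sum>w\<in>W. \<Sum>v\<in>A. s)"
  proof (intro sum.cong refl)
    fix w v assume "w \<in> W" "v \<in> A"
    then have e: "{w, v} \<in> E" by (rule crossW)
    have "bexp p E (\<lambda>F. fluct p F w v) = 0"
      using bexp_square_independent(1)[OF finE e, of "\<lambda>_. 1" p] by (simp add: fluct_def)
    then show "bexp p E (\<lambda>F. (fluct p F w v)\<^sup>2 + p * (fluct p F w v)) = s"
      by (simp add: bexp_add bexp_mult_left bexp_fluct_square[OF p finE e] s_def)
  qed
  finally show ?thesis by (simp add: k_def N_def)
qed

lemma cross_sum_tail:
  assumes "t \<ge> 0"
  shows "bexp p E (\<lambda>F. of_bool (cross_sum F \<le> k * N * s - t)) \<le> exp (- t\<^sup>2 / (4 * (k * n)))"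
  unfolding bexp_cross_sum[symmetric]
proof (rule bounded_differences_lower_tail[OF p finE, where c = "\<lambda>_. 1"])
  fix e F assume "e \<in> E" "F \<subseteq> E - {e}"
  let ?d = "\<lambda>w v. \<bar>adj (insert e F) w v * fluct p (insert e F) w v - adj F w v * fluct p F w v\<bar>"
  have d: "?d w v \<le> of_bool ({w, v} = e)" for w v using p by (auto simp: adj_def fluct_def)
  have "\<bar>cross_sum (insert e F) - cross_sum F\<bar> \<le> (\<Sum>w\<in>W. \<Sum>v\<in>A. ?d w v)"
    unfolding cross_sum_def sum_subtractf[symmetric] by (intro order_trans[OF sum_abs] sum_mono sum_abs)
  also have "\<dots> \<le> (\<Sum>w\<in>W. \<Sum>v\<in>A. of_bool ({w, v} = e))" by (intro sum_mono d)
  also have "\<dots> \<le> 1"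
  proof (cases "\<exists>w\<in>W. \<exists>v\<in>A. {w, v} = e")
    case True
    then obtain w0 v0 where e: "w0 \<in> W" "v0 \<in> A" "e = {w0, v0}" by blast
    have "(\<Sum>w\<in>W. \<Sum>v\<in>A. of_bool ({w, v} = e)) = (\<Sum>w\<in>W. \<Sum>v\<in>A. of_bool (w = w0) * of_bool (v = v0) :: real)"
      using e inW by (intro sum.cong refl) (auto simp: doubleton_eq_iff)
    also have "\<dots> = (\<Sum>w\<in>W. 1 * of_bool (w = w0))"
      using sum_mult_of_bool(1)[OF finA e(2), of "\<lambda>_. of_bool (w = w0) :: real" for w] by (intro sum.cong refl) simp
    also have "\<dots> = 1" using sum_mult_of_bool(1)[OF finW e(1), of "\<lambda>_. 1 :: real"] by simp
    finally show ?thesis by simp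
  next
    case False
    then have "(\<Sum>w\<in>W. \<Sum>v\<in>A. of_bool ({w, v} = e) :: real) = 0" by (intro sum.neutral ballI) auto
    then show ?thesis by simp
  qed
  finally show "\<bar>cross_sum (insert e F) - cross_sum F\<bar> \<le> 1" .
qed (use assms card_E_le pos in \<open>auto intro!: mult_pos_pos\<close>)

text \<open>Operator norm through the Gram matrix: its deviation from s N times the identity has row
  sums at most k b, so the squared norm of the block is at most s N + k b \<le> a^2.\<close>

lemma quad_form_bip_le:
  assumes g: "\<And>w w'. w \<in> W \<Longrightarrow> w' \<in> W \<Longrightarrow> \<bar>gram F w w' - s * N * of_bool (w = w')\<bar> \<le> b"
    and a: "a > 0" "s * N + k * b \<le> a\<^sup>2"
  shows "\<bar>quad_form I (bip F) y\<bar> \<le> a * (\<Sum>j\<in>I. (y j)\<^sup>2)"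
proof -
  define h where "h v = (\<Sum>w\<in>W. fluct p F w v * y w)" for v
  have "quad_form I (bip F) y = (\<Sum>i\<in>I. \<Sum>j\<in>I. if (i \<in> A) = (j \<in> A) then 0 else fluct p F i j * y i * y j)"
    unfolding quad_form_def by (intro sum.cong refl) (simp add: bip_def)
  also have "\<dots> = (\<Sum>w\<in>W. \<Sum>v\<in>A. fluct p F w v * y w * y v + fluct p F v w * y v * y w)" by (rule sum_cross)
  also have "\<dots> = (\<Sum>w\<in>W. \<Sum>v\<in>A. 2 * y v * (fluct p F w v * y w))"
  proof (intro sum.cong refl)
    fix w v
    have "fluct p F v w = fluct p F w v" by (rule fluct_sym)
    then show "fluct p F w v * y w * y v + fluct p F v w * y v * y w = 2 * y v * (fluct p F w v * y w)" by simp
  qed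
  also have "\<dots> = (\<Sum>v\<in>A. \<Sum>w\<in>W. 2 * y v * (fluct p F w v * y w))" by (rule sum.swap)
  also have "\<dots> = (\<Sum>v\<in>A. 2 * y v * h v)" by (simp add: h_def sum_distrib_left)
  finally have q: "quad_form I (bip F) y = (\<Sum>v\<in>A. 2 * y v * h v)" .
  have "\<bar>quad_form I (bip F) y\<bar> \<le> (\<Sum>v\<in>A. a * (y v)\<^sup>2 + (h v)\<^sup>2 / a)"
    unfolding q
  proof (intro order_trans[OF sum_abs] sum_mono)
    fix v
    have "0 \<le> (a * \<bar>y v\<bar> - \<bar>h v\<bar>)\<^sup>2" by simp
    then have "a * \<bar>2 * y v * h v\<bar> \<le> a * (a * (y v)\<^sup>2 + (h v)\<^sup>2 / a)"
      using a by (simp add: power2_eq_square algebra_simps abs_mult)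
    then show "\<bar>2 * y v * h v\<bar> \<le> a * (y v)\<^sup>2 + (h v)\<^sup>2 / a" using a by (simp only: mult_le_cancel_left_pos)
  qed
  also have "\<dots> = a * (\<Sum>v\<in>A. (y v)\<^sup>2) + (\<Sum>v\<in>A. (h v)\<^sup>2) / a"
    by (simp add: sum.distrib sum_distrib_left sum_divide_distrib)
  also have "(\<Sum>v\<in>A. (h v)\<^sup>2) \<le> a\<^sup>2 * (\<Sum>w\<in>W. (y w)\<^sup>2)"
  proof -
    have "(\<Sum>v\<in>A. (h v)\<^sup>2) = (\<Sum>v\<in>A. \<Sum>w\<in>W. \<Sum>w'\<in>W. y w * y w' * (fluct p F w v * fluct p F w' v))"
      unfolding h_def power2_eq_square sum_product by (intro sum.cong refl) (simp add: mult_ac)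
    also have "\<dots> = (\<Sum>w\<in>W. \<Sum>w'\<in>W. \<Sum>v\<in>A. y w * y w' * (fluct p F w v * fluct p F w' v))" by (rule sum_swap3)
    also have "\<dots> = (\<Sum>w\<in>W. \<Sum>w'\<in>W. y w * y w' * gram F w w')" by (simp add: gram_def sum_distrib_left)
    also have "\<dots> \<le> (\<Sum>w\<in>W. \<Sum>w'\<in>W. s * N * (y w)\<^sup>2 * of_bool (w = w') + b / 2 * (y w)\<^sup>2 + b / 2 * (y w')\<^sup>2)"
    proof (intro sum_mono)
      fix w w' assume w: "w \<in> W" "w' \<in> W"
      have b0: "b \<ge> 0" using g[OF w] by linarith
      have yy: "\<bar>y w * y w'\<bar> \<le> (y w)\<^sup>2 / 2 + (y w')\<^sup>2 / 2"
      proof -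
        have "0 \<le> (\<bar>y w\<bar> - \<bar>y w'\<bar>)\<^sup>2" by simp
        then show ?thesis by (simp add: power2_diff abs_mult)
      qed
      have "y w * y w' * (gram F w w' - s * N * of_bool (w = w')) \<le> \<bar>y w * y w'\<bar> * \<bar>gram F w w' - s * N * of_bool (w = w')\<bar>"
        by (metis abs_ge_self abs_mult)
      also have "\<dots> \<le> ((y w)\<^sup>2 / 2 + (y w')\<^sup>2 / 2) * b"
        using g[OF w] yy by (intro mult_mono) auto
      finally have "y w * y w' * gram F w w' \<le> y w * y w' * (s * N * of_bool (w = w')) + ((y w)\<^sup>2 / 2 + (y w')\<^sup>2 / 2) * b"
        by (simp add: right_diff_distrib)
      moreover have "y w * y w' * (s * N * of_bool (w = w')) = s * N * (y w)\<^sup>2 * of_bool (w = w')"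
        by (auto simp: power2_eq_square)
      moreover have "((y w)\<^sup>2 / 2 + (y w')\<^sup>2 / 2) * b = b / 2 * (y w)\<^sup>2 + b / 2 * (y w')\<^sup>2" by (simp add: algebra_simps)
      ultimately show "y w * y w' * gram F w w' \<le> s * N * (y w)\<^sup>2 * of_bool (w = w') + b / 2 * (y w)\<^sup>2 + b / 2 * (y w')\<^sup>2" by linarith
    qed
    also have "\<dots> = (\<Sum>w\<in>W. s * N * (y w)\<^sup>2 + k * (b / 2 * (y w)\<^sup>2) + b / 2 * (\<Sum>w'\<in>W. (y w')\<^sup>2))"
    proof (intro sum.cong refl)
      fix w assume "w \<in> W"
      then have "(\<Sum>w'\<in>W. of_bool (w = w')) = (1 :: real)"
        using sum_mult_of_bool(2)[OF finW, of w "\<lambda>_. 1 :: real"] by simp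
      then show "(\<Sum>w'\<in>W. s * N * (y w)\<^sup>2 * of_bool (w = w') + b / 2 * (y w)\<^sup>2 + b / 2 * (y w')\<^sup>2)
          = s * N * (y w)\<^sup>2 + k * (b / 2 * (y w)\<^sup>2) + b / 2 * (\<Sum>w'\<in>W. (y w')\<^sup>2)"
        unfolding sum.distrib sum_distrib_left[symmetric] by (simp add: k_def)
    qed
    also have "\<dots> = (s * N + k * b) * (\<Sum>w\<in>W. (y w)\<^sup>2)"
    proof -
      have "(\<Sum>w\<in>W. s * N * (y w)\<^sup>2 + k * (b / 2 * (y w)\<^sup>2) + b / 2 * (\<Sum>w'\<in>W. (y w')\<^sup>2))
        = s * N * (\<Sum>w\<in>W. (y w)\<^sup>2) + k * (b / 2 * (\<Sum>w\<in>W. (y w)\<^sup>2)) + k * (b / 2 * (\<Sum>w\<in>W. (y w)\<^sup>2))"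
        unfolding sum.distrib sum_distrib_left[symmetric] by (simp add: k_def)
      then show ?thesis by (simp add: algebra_simps)
    qed
    also have "\<dots> \<le> a\<^sup>2 * (\<Sum>w\<in>W. (y w)\<^sup>2)" using a by (intro mult_right_mono) (auto intro: sum_nonneg)
    finally show ?thesis .
  qed
  then have "(\<Sum>v\<in>A. (h v)\<^sup>2) / a \<le> a * (\<Sum>w\<in>W. (y w)\<^sup>2)" using a by (simp add: field_simps power2_eq_square)
  finally show ?thesis by (simp add: sumI algebra_simps)
qed

text \<open>Off the bad events duality bounds the trace norm below by 2 cross_sum/a, where 2
  cross_sum exceeds 9/5 k s N. A union bound over pairs of outside vertices, plus the lower tail of
  \<open>cross_sum\<close>, gives the probability.\<close>

lemma few_outside_tail:
  assumes N: "N \<ge> 9 / 10 * n"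
  shows "bexp p E (\<lambda>F. of_bool (trace_norm I (adj F) \<le> 4 / 3 * (k * sqrt (s * n))))
    \<le> 2 * k\<^sup>2 * exp (- (s\<^sup>2 * n) / (250 * k\<^sup>2)) + exp (- (s\<^sup>2 * n) / 500)"
proof -
  \<comment> \<open>k b = 21/100 s N makes s N + k b = (11/10)^2 s N, the square of
    \<open>a\<close>.\<close>
  define b where "b = 21 / 100 * (s * N) / k"
  define a where "a = 11 / 10 * sqrt (s * N)"
  have n0: "n > 0" using pos by linarith
  have sN: "s * N > 0" "s * n > 0" using pos n0 by auto
  have b0: "b \<ge> 0" using sN pos by (simp add: b_def)
  have kb: "k * b = 21 / 100 * (s * N)" using pos(1) by (simp add: b_def)
  have a: "a > 0" "a\<^sup>2 = 121 / 100 * (s * N)" using sN by (auto simp: a_def power_mult_distrib power2_eq_square)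
  define bad where "bad F w w' \<longleftrightarrow> \<bar>gram F w w' - s * N * of_bool (w = w')\<bar> \<ge> b" for F w w'
  define t where "t = k * N * s / 10"
  have t0: "t \<ge> 0" using pos by (simp add: t_def)
  have "bexp p E (\<lambda>F. of_bool (trace_norm I (adj F) \<le> 4 / 3 * (k * sqrt (s * n))) :: real)
      \<le> bexp p E (\<lambda>F. (\<Sum>w\<in>W. \<Sum>w'\<in>W. of_bool (bad F w w')) + of_bool (cross_sum F \<le> k * N * s - t))"
  proof (rule bexp_mono[OF p])
    fix F
    have nn: "(\<Sum>w\<in>W. \<Sum>w'\<in>W. of_bool (bad F w w') :: real) \<ge> 0" by (intro sum_nonneg) auto
    show "of_bool (trace_norm I (adj F) \<le> 4 / 3 * (k * sqrt (s * n)))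
        \<le> (\<Sum>w\<in>W. \<Sum>w'\<in>W. of_bool (bad F w w')) + (of_bool (cross_sum F \<le> k * N * s - t) :: real)"
    proof (cases "(\<exists>w\<in>W. \<exists>w'\<in>W. bad F w w') \<or> cross_sum F \<le> k * N * s - t")
      case True
      then show ?thesis
      proof
        assume "\<exists>w\<in>W. \<exists>w'\<in>W. bad F w w'"
        then obtain w w' where w: "w \<in> W" "w' \<in> W" "bad F w w'" by blast
        have "(1::real) = of_bool (bad F w w')" using w by simp
        also have "\<dots> \<le> (\<Sum>w'\<in>W. of_bool (bad F w w'))"
          using finW w by (intro member_le_sum) auto
        also have "\<dots> \<le> (\<Sum>w\<in>W. \<Sum>w'\<in>W. of_bool (bad F w w'))"
          using finW w by (intro member_le_sum[of w W "\<lambda>w. \<Sum>w'\<in>W. of_bool (bad F w w')"]) (auto intro: sum_nonneg)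
        finally have "1 \<le> (\<Sum>w\<in>W. \<Sum>w'\<in>W. of_bool (bad F w w') :: real)" .
        then show ?thesis by (simp add: of_bool_def split: if_splits)
      next
        assume "cross_sum F \<le> k * N * s - t"
        then show ?thesis using nn by simp
      qed
    next
      case False
      have q: "\<bar>quad_form I (bip F) y\<bar> \<le> a * (\<Sum>j\<in>I. (y j)\<^sup>2)" for y
      proof (rule quad_form_bip_le[OF _ a(1)])
        show "\<bar>gram F w w' - s * N * of_bool (w = w')\<bar> \<le> b" if "w \<in> W" "w' \<in> W" for w w'
          using False that by (meson bad_def linear)
        show "s * N + k * b \<le> a\<^sup>2" unfolding kb a(2) by simp
      qed
      have "2 * cross_sum F = (\<Sum>w\<in>W. \<Sum>v\<in>A. adj F w v * fluct p F w v + adj F v w * fluct p F v w)"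
        unfolding cross_sum_def sum_distrib_left
        by (intro sum.cong refl) (simp add: adj_def fluct_def insert_commute)
      also have "\<dots> = (\<Sum>i\<in>I. \<Sum>j\<in>I. if (i \<in> A) = (j \<in> A) then 0 else adj F i j * fluct p F i j)"
        by (rule sum_cross[symmetric])
      also have "\<dots> = (\<Sum>i\<in>I. \<Sum>j\<in>I. adj F i j * bip F i j)"
        by (intro sum.cong refl) (simp add: bip_def)
      also have "\<dots> \<le> a * trace_norm I (adj F)" by (rule trace_norm_ge_dual[OF finI adj_symmetric q])
      finally have c: "2 * cross_sum F \<le> a * trace_norm I (adj F)" .
      \<comment> \<open>81/100 \<le> 9/10, so passing from n to N loses at most the factor 9/10, and
        4/3 becomes 40/27.\<close>
      have "9 / 10 * sqrt (s * n) \<le> sqrt (s * N)"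
      proof (rule real_le_rsqrt)
        have "(9 / 10 * sqrt (s * n))\<^sup>2 = s * (81 / 100 * n)" using sN by (simp add: power_mult_distrib power2_eq_square)
        also have "\<dots> \<le> s * N" using N pos n0 by (intro mult_left_mono) auto
        finally show "(9 / 10 * sqrt (s * n))\<^sup>2 \<le> s * N" .
      qed
      then have r: "4 / 3 * (k * sqrt (s * n)) \<le> 40 / 27 * (k * sqrt (s * N))" using pos(1) by (simp add: mult_left_mono)
      have "a * (40 / 27 * (k * sqrt (s * N))) = 44 / 27 * k * (sqrt (s * N) * sqrt (s * N))" by (simp add: a_def)
      also have "\<dots> = 44 / 27 * k * (s * N)" using sN by simp
      also have "\<dots> < 18 / 10 * k * (s * N)" using pos(1) sN by (intro mult_strict_right_mono) auto
      also have "\<dots> \<le> 2 * cross_sum F" using False by (simp add: t_def algebra_simps)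
      finally have "a * (40 / 27 * (k * sqrt (s * N))) < a * trace_norm I (adj F)" using c by linarith
      then have "40 / 27 * (k * sqrt (s * N)) < trace_norm I (adj F)" using a(1) by (simp only: mult_less_cancel_left_pos)
      then have "\<not> trace_norm I (adj F) \<le> 4 / 3 * (k * sqrt (s * n))" using r by linarith
      then show ?thesis using nn by simp
    qed
  qed
  also have "\<dots> = (\<Sum>w\<in>W. \<Sum>w'\<in>W. bexp p E (\<lambda>F. of_bool (bad F w w'))) + bexp p E (\<lambda>F. of_bool (cross_sum F \<le> k * N * s - t))"
    by (simp add: bexp_add bexp_sum)
  also have "\<dots> \<le> (\<Sum>w\<in>W. \<Sum>w'\<in>W. 2 * exp (- b\<^sup>2 / (8 * N))) + exp (- t\<^sup>2 / (4 * (k * n)))"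
    unfolding bad_def by (intro add_mono sum_mono gram_tail cross_sum_tail b0 t0)
  also have "\<dots> = 2 * k\<^sup>2 * exp (- b\<^sup>2 / (8 * N)) + exp (- t\<^sup>2 / (4 * (k * n)))"
    by (simp add: k_def power2_eq_square)
  also have "\<dots> \<le> 2 * k\<^sup>2 * exp (- (s\<^sup>2 * n) / (250 * k\<^sup>2)) + exp (- (s\<^sup>2 * n) / 500)"
  proof -
    have "b\<^sup>2 / (8 * N) = 441 / 80000 * (s\<^sup>2 * N / k\<^sup>2)"
      using pos(1,2) by (simp add: b_def power_divide power_mult_distrib power2_eq_square field_simps)
    moreover have "441 / 80000 * (s\<^sup>2 * N / k\<^sup>2) \<ge> 441 / 80000 * (s\<^sup>2 * (9 / 10 * n) / k\<^sup>2)"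
      using N by (intro mult_left_mono divide_right_mono) auto
    moreover have "441 / 80000 * (s\<^sup>2 * (9 / 10 * n) / k\<^sup>2) \<ge> 1 / 250 * (s\<^sup>2 * n / k\<^sup>2)"
    proof -
      have "0 \<le> s\<^sup>2 * n / k\<^sup>2" using n0 by simp
      moreover have "s\<^sup>2 * (9 / 10 * n) / k\<^sup>2 = 9 / 10 * (s\<^sup>2 * n / k\<^sup>2)" by simp
      ultimately show ?thesis by linarith
    qed
    ultimately have 1: "- b\<^sup>2 / (8 * N) \<le> - (s\<^sup>2 * n) / (250 * k\<^sup>2)" by simp
    have "t\<^sup>2 / (4 * (k * n)) = k * s\<^sup>2 / 400 * (N\<^sup>2 / n)"
      using pos(1) n0 by (simp add: t_def power_divide power_mult_distrib power2_eq_square)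
    moreover have "(9 / 10 * n)\<^sup>2 \<le> N\<^sup>2" using N n0 by (intro power_mono) auto
    then have "N\<^sup>2 / n \<ge> 81 / 100 * n" using n0 by (simp add: field_simps power2_eq_square)
    then have "k * s\<^sup>2 / 400 * (N\<^sup>2 / n) \<ge> 1 * s\<^sup>2 / 400 * (81 / 100 * n)"
      using pos(1) n0 by (intro mult_mono divide_right_mono) auto
    moreover have "1 * s\<^sup>2 / 400 * (81 / 100 * n) \<ge> s\<^sup>2 * n / 500"
      using n0 by (simp add: field_simps)
    ultimately have "s\<^sup>2 * n / 500 \<le> t\<^sup>2 / (4 * (k * n))" by linarith
    then have "- t\<^sup>2 / (4 * (k * n)) \<le> - (s\<^sup>2 * n) / 500"
      unfolding minus_divide_left[symmetric] by (rule le_imp_neg_le)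
    with 1 show ?thesis by (intro add_mono mult_left_mono) auto
  qed
  finally show ?thesis .
qed

end

section \<open>Graph energy and random edge sets\<close>

lemma order_linear: "Polynomial.order x [:- a, 1:] = (if x = a then 1 else 0)" for a :: "'a::idom"
proof (cases "x = a")
  case True
  then show ?thesis using order_power_n_n[of a 1] by simp
next
  case False
  then show ?thesis by (auto intro: order_0I)
qed

lemma order_prod_list_linear:
  "Polynomial.order x (\<Prod>a\<leftarrow>xs. [:- a, 1:]) = count_list xs x" for x :: "'a::idom"
proof (induction xs)
  case (Cons a xs)
  have "(\<Prod>a\<leftarrow>xs. [:- a, 1:]) \<noteq> 0" by (auto simp: prod_list_zero_iff)
  then have "[:- a, 1:] * (\<Prod>a\<leftarrow>xs. [:- a, 1:]) \<noteq> 0" by (intro no_zero_divisors) auto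
  from order_mult[OF this] show ?case using Cons by (simp only: list.map prod_list.Cons order_linear) simp
qed simp

lemma poly_prod_list_linear:
  "poly (\<Prod>a\<leftarrow>xs. [:- a, 1:]) x = 0 \<longleftrightarrow> x \<in> set xs" for x :: "'a::idom"
  by (induction xs) auto

lemma sum_count_list:
  fixes f :: "'a \<Rightarrow> real"
  assumes "finite S" "set xs \<subseteq> S"
  shows "(\<Sum>x\<in>S. real (count_list xs x) * f x) = (\<Sum>x\<leftarrow>xs. f x)"
  using assms(2)
proof (induction xs)
  case (Cons a xs)
  have "real (count_list (a # xs) x) * f x = of_bool (x = a) * f x + real (count_list xs x) * f x" for x
    by (simp add: algebra_simps)
  then have "(\<Sum>x\<in>S. real (count_list (a # xs) x) * f x)
      = (\<Sum>x\<in>S. of_bool (x = a) * f x) + (\<Sum>x\<in>S. real (count_list xs x) * f x)"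
    by (simp only: sum.distrib)
  also have "(\<Sum>x\<in>S. of_bool (x = a) * f x) = f a"
    using assms(1) Cons.prems by (intro sum_mult_of_bool(3)) auto
  finally show ?case using Cons by simp
qed simp

lemma sum_shift_Suc: "(\<Sum>i = 0..<n. f (Suc i)) = (\<Sum>i\<in>{1..n}. f i)"
  by (metis One_nat_def atLeastLessThanSuc_atLeastAtMost sum.shift_bounds_Suc_ivl)

text \<open>The eigenvectors give B = P D Q with P and Q inverse to each other, so the
  characteristic polynomial is a product over the list of eigenvalues. The order of a root counts
  its occurrences, and the sum over distinct roots becomes the sum over the list.\<close>

lemma graph_energy_eq_trace_norm: "graph_energy n F = trace_norm {1..n} (adj F)"
proof -
  define B where "B = adjacency_matrix n F"
  obtain lam u where d: "diagonalises {1..n} (adj F) lam u"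
    and tn: "trace_norm {1..n} (adj F) = (\<Sum>i\<in>{1..n}. \<bar>lam i\<bar>)"
    using trace_norm_spectral[OF finite_atLeastAtMost adj_symmetric] by blast
  define P where "P = Matrix.mat n n (\<lambda>(i, j). u (Suc j) (Suc i))"
  define Q where "Q = Matrix.mat n n (\<lambda>(i, j). u (Suc i) (Suc j))"
  define D where "D = Matrix.mat n n (\<lambda>(i, j). if i = j then lam (Suc i) else 0)"
  have carr: "B \<in> carrier_mat n n" "D \<in> carrier_mat n n" "P \<in> carrier_mat n n" "Q \<in> carrier_mat n n"
    by (simp_all add: B_def adjacency_matrix_def D_def P_def Q_def)
  have "P * Q = 1\<^sub>m n"
  proof (rule eq_matI)
    fix i j assume "i < dim_row (1\<^sub>m n)" "j < dim_col (1\<^sub>m n)"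
    then have ij: "i < n" "j < n" by auto
    have "(P * Q) $$ (i, j) = (\<Sum>k = 0..<n. u (Suc k) (Suc i) * u (Suc k) (Suc j))"
      using ij by (simp add: P_def Q_def scalar_prod_def)
    also have "\<dots> = (\<Sum>k\<in>{1..n}. u k (Suc i) * u k (Suc j))" by (rule sum_shift_Suc)
    also have "\<dots> = of_bool (Suc i = Suc j)"
      using d ij unfolding diagonalises_def orthonormal_system_def by auto
    finally show "(P * Q) $$ (i, j) = 1\<^sub>m n $$ (i, j)" using ij by simp
  qed (simp_all add: P_def Q_def)
  moreover have "Q * P = 1\<^sub>m n"
  proof (rule eq_matI)
    fix i j assume "i < dim_row (1\<^sub>m n)" "j < dim_col (1\<^sub>m n)"
    then have ij: "i < n" "j < n" by auto
    have "(Q * P) $$ (i, j) = (\<Sum>k = 0..<n. u (Suc i) (Suc k) * u (Suc j) (Suc k))"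
      using ij by (simp add: P_def Q_def scalar_prod_def)
    also have "\<dots> = (\<Sum>k\<in>{1..n}. u (Suc i) k * u (Suc j) k)" by (rule sum_shift_Suc)
    also have "\<dots> = of_bool (Suc i = Suc j)"
      using d ij unfolding diagonalises_def orthonormal_system_def by auto
    finally show "(Q * P) $$ (i, j) = 1\<^sub>m n $$ (i, j)" using ij by simp
  qed (simp_all add: P_def Q_def)
  moreover have "B = P * D * Q"
  proof (rule eq_matI)
    fix i j assume "i < dim_row (P * D * Q)" "j < dim_col (P * D * Q)"
    then have ij: "i < n" "j < n" by (auto simp: P_def Q_def)
    have PD: "(P * D) $$ (i, k) = lam (Suc k) * u (Suc k) (Suc i)" if "k < n" for k
    proof -
      have "(P * D) $$ (i, k) = (\<Sum>l = 0..<n. u (Suc l) (Suc i) * (if l = k then lam (Suc l) else 0))"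
        using ij that by (simp add: P_def D_def scalar_prod_def)
      also have "\<dots> = (\<Sum>l = 0..<n. if l = k then u (Suc l) (Suc i) * lam (Suc l) else 0)"
        by (intro sum.cong refl) simp
      finally show ?thesis using that by simp
    qed
    define C where "C = P * D"
    have C: "C \<in> carrier_mat n n" using carr by (simp add: C_def)
    have "(C * Q) $$ (i, j) = (\<Sum>k = 0..<n. C $$ (i, k) * u (Suc k) (Suc j))"
      using ij C by (simp add: scalar_prod_def Q_def)
    then have "(P * D * Q) $$ (i, j) = (\<Sum>k = 0..<n. (P * D) $$ (i, k) * u (Suc k) (Suc j))" unfolding C_def .
    also have "\<dots> = (\<Sum>k = 0..<n. lam (Suc k) * u (Suc k) (Suc i) * u (Suc k) (Suc j))"
      using PD by (intro sum.cong refl) simp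
    also have "\<dots> = (\<Sum>k\<in>{1..n}. lam k * u k (Suc i) * u k (Suc j))" by (rule sum_shift_Suc)
    also have "\<dots> = adj F (Suc i) (Suc j)" using d ij unfolding diagonalises_def by simp
    finally show "B $$ (i, j) = (P * D * Q) $$ (i, j)"
      using ij by (simp add: B_def adjacency_matrix_def adj_def)
  qed (simp_all add: B_def adjacency_matrix_def P_def Q_def)
  ultimately have "similar_mat_wit B D P Q"
    using carr unfolding similar_mat_wit_def Let_def by (auto simp del: assoc_mult_mat)
  then have "similar_mat B D" unfolding similar_mat_def by blast
  then have "char_poly B = char_poly D" by (rule char_poly_similar)
  also have "\<dots> = (\<Prod>a\<leftarrow>diag_mat D. [:- a, 1:])"
    by (rule char_poly_upper_triangular[OF carr(2)]) (auto simp: upper_triangular_def D_def)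
  also have "diag_mat D = map (\<lambda>i. lam (Suc i)) [0..<n]"
    by (simp add: diag_mat_def D_def)
  finally have cp: "char_poly B = (\<Prod>a\<leftarrow>map (\<lambda>i. lam (Suc i)) [0..<n]. [:- a, 1:])" .
  define xs where "xs = map (\<lambda>i. lam (Suc i)) [0..<n]"
  have "spectrum B = set xs"
    unfolding spectrum_root_char_poly[OF carr(1)] cp xs_def[symmetric] poly_prod_list_linear by simp
  then have "graph_energy n F = (\<Sum>x\<in>set xs. real (count_list xs x) * \<bar>x\<bar>)"
    unfolding graph_energy_def B_def[symmetric] cp xs_def[symmetric] order_prod_list_linear by simp
  also have "\<dots> = (\<Sum>x\<leftarrow>xs. \<bar>x\<bar>)" by (rule sum_count_list) auto
  also have "\<dots> = (\<Sum>i = 0..<n. \<bar>lam (Suc i)\<bar>)" by (simp add: xs_def comp_def interv_sum_list_conv_sum_set_nat)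
  also have "\<dots> = trace_norm {1..n} (adj F)" unfolding tn by (rule sum_shift_Suc)
  finally show ?thesis .
qed

text \<open>Injectivity of the indexing turns disjointness of distinct blocks into disjointness of
  blocks with distinct indices.\<close>

lemma vertex_partition_of_indexed_partition:
  assumes fin: "finite I" and ip: "indexed_partition I m V"
  shows "vertex_partition I {1..m} V"
    and "complete_multipartite_edges m V = vertex_partition.edges I {1..m} V"
    and "\<forall>i\<in>{1..m}. V i \<noteq> {}"
proof -
  have U: "(\<Union>i\<in>{1..m}. V i) = I" and D: "disjoint (V ` {1..m})" and ne: "{} \<notin> V ` {1..m}"
    and inj: "inj_on V {1..m}"
    using ip by (auto simp: indexed_partition_def partition_on_def)
  show vp: "vertex_partition I {1..m} V"
  proof
    fix i j assume ij: "i \<in> {1..m}" "j \<in> {1..m}" "i \<noteq> j"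
    then have "V i \<noteq> V j" using inj by (auto dest: inj_onD)
    then show "V i \<inter> V j = {}" using D ij by (auto simp: disjoint_def)
  qed (use fin U in auto)
  show "\<forall>i\<in>{1..m}. V i \<noteq> {}" using ne by (metis imageI)
  interpret vertex_partition I "{1..m}" V by (rule vp)
  show "complete_multipartite_edges m V = edges"
  proof (intro equalityI subsetI)
    fix e assume "e \<in> complete_multipartite_edges m V"
    then obtain u v i j where e: "e = {u, v}" "i \<in> {1..m}" "j \<in> {1..m}" "i \<noteq> j" "u \<in> V i" "v \<in> V j"
      by (auto simp: complete_multipartite_edges_def)
    have "u \<noteq> v" using e part_unique by blast
    moreover have "u \<in> I" "v \<in> I" using e U by blast+
    moreover have "{u, v} \<notin> all_edges (V l)" if "l \<in> {1..m}" for l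
      using e that part_unique unfolding doubleton_mem_all_edges by metis
    ultimately show "e \<in> edges" unfolding e(1) edges_def by (auto simp: doubleton_mem_all_edges)
  next
    fix e assume e: "e \<in> edges"
    then obtain u v where uv: "e = {u, v}" "u \<in> I" "v \<in> I" "u \<noteq> v"
      unfolding edges_def all_edges_def by blast
    obtain i j where ij: "i \<in> {1..m}" "j \<in> {1..m}" "u \<in> V i" "v \<in> V j" using uv U by blast
    have "i \<noteq> j" using e uv ij unfolding edges_def by (auto simp: doubleton_mem_all_edges)
    then show "e \<in> complete_multipartite_edges m V"
      using uv ij unfolding complete_multipartite_edges_def by blast
  qed
qed

section \<open>The law of the random edge set\<close>

context prob_space
begin

text \<open>Induction on the excluded elements: excluding \<open>x\<close> subtracts the event that
  requires \<open>x\<close>, and p^i - p^(i+1) = p^i (1 - p).\<close>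

lemma indep_events_cylinder:
  assumes ind: "indep_events B E" and B: "\<And>e. e \<in> E \<Longrightarrow> prob (B e) = p"
    and S: "finite S" "S \<subseteq> E" and T: "finite T" "T \<subseteq> E" "S \<inter> T = {}"
  shows "{\<omega> \<in> space M. (\<forall>e\<in>S. \<omega> \<in> B e) \<and> (\<forall>e\<in>T. \<omega> \<notin> B e)} \<in> events \<and>
    prob {\<omega> \<in> space M. (\<forall>e\<in>S. \<omega> \<in> B e) \<and> (\<forall>e\<in>T. \<omega> \<notin> B e)} = p ^ card S * (1 - p) ^ card T"
  using T S
proof (induction T arbitrary: S rule: finite_induct)
  case empty
  have Bev: "B e \<in> events" if "e \<in> E" for e using ind that by (auto simp: indep_events_def)
  show ?case
  proof (cases "S = {}")
    case True
    then show ?thesis by (simp add: prob_space)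
  next
    case False
    have eq: "{\<omega> \<in> space M. (\<forall>e\<in>S. \<omega> \<in> B e) \<and> (\<forall>e\<in>{}. \<omega> \<notin> B e)} = (\<Inter>e\<in>S. B e)"
    proof -
      obtain e0 where e0: "e0 \<in> S" using False by blast
      then have "B e0 \<subseteq> space M" using empty by (intro sets.sets_into_space Bev) auto
      then show ?thesis using e0 by auto
    qed
    have "prob (\<Inter>e\<in>S. B e) = (\<Prod>e\<in>S. prob (B e))"
      using ind False empty unfolding indep_events_def by blast
    also have "\<dots> = p ^ card S" using empty B by (simp add: subset_iff)
    finally show ?thesis unfolding eq using Bev empty False by (auto intro!: sets.finite_INT)
  qed
next
  case (insert x T)
  let ?C = "\<lambda>S T. {\<omega> \<in> space M. (\<forall>e\<in>S. \<omega> \<in> B e) \<and> (\<forall>e\<in>T. \<omega> \<notin> B e)}"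
  have 1: "?C S T \<in> events \<and> prob (?C S T) = p ^ card S * (1 - p) ^ card T"
    using insert by (intro insert.IH) auto
  have 2: "?C (insert x S) T \<in> events \<and> prob (?C (insert x S) T) = p ^ card (insert x S) * (1 - p) ^ card T"
    using insert by (intro insert.IH) auto
  have eq: "?C S (insert x T) = ?C S T - ?C (insert x S) T" by auto
  have sub: "?C (insert x S) T \<subseteq> ?C S T" by auto
  have "prob (?C S (insert x T)) = p ^ card S * (1 - p) ^ card T - p ^ card (insert x S) * (1 - p) ^ card T"
    unfolding eq using finite_measure_Diff[OF _ _ sub] 1 2 by simp
  also have "card (insert x S) = Suc (card S)" using insert by auto
  also have "p ^ card S * (1 - p) ^ card T - p ^ Suc (card S) * (1 - p) ^ card T = p ^ card S * (1 - p) ^ card (insert x T)"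
    using insert by (simp add: algebra_simps)
  finally show ?case using 1 2 unfolding eq by auto
qed

text \<open>\<open>G\<close> takes finitely many values, and each value is a cylinder of the
  independent edge events; hence every property of the graph is an event.\<close>

lemma random_graph_prob:
  assumes G: "random_multipartite_graph M m V p G" and fin: "finite (complete_multipartite_edges m V)"
  shows "{\<omega> \<in> space M. P (G \<omega>)} \<in> events"
    and "prob {\<omega> \<in> space M. P (G \<omega>)} = bexp p (complete_multipartite_edges m V) (\<lambda>F. of_bool (P F))"
proof -
  define E where "E = complete_multipartite_edges m V"
  have finE: "finite E" using fin by (simp add: E_def)
  define B where "B e = {\<omega> \<in> space M. e \<in> G \<omega>}" for e
  have GE: "G \<omega> \<subseteq> E" if "\<omega> \<in> space M" for \<omega> using G that by (simp add: random_multipartite_graph_def E_def)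
  have ind: "indep_events B E" and pB: "\<And>e. e \<in> E \<Longrightarrow> prob (B e) = p"
    using G by (auto simp: random_multipartite_graph_def E_def B_def[abs_def])
  have cyl: "{\<omega> \<in> space M. G \<omega> = F} \<in> events \<and> prob {\<omega> \<in> space M. G \<omega> = F} = p ^ card F * (1 - p) ^ card (E - F)"
    if "F \<subseteq> E" for F
  proof -
    have "{\<omega> \<in> space M. G \<omega> = F} = {\<omega> \<in> space M. (\<forall>e\<in>F. \<omega> \<in> B e) \<and> (\<forall>e\<in>E - F. \<omega> \<notin> B e)}"
    proof (intro Collect_cong conj_cong refl)
      fix \<omega> assume "\<omega> \<in> space M"
      then show "G \<omega> = F \<longleftrightarrow> (\<forall>e\<in>F. \<omega> \<in> B e) \<and> (\<forall>e\<in>E - F. \<omega> \<notin> B e)"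
        using GE[of \<omega>] that unfolding B_def by blast
    qed
    then show ?thesis
      using indep_events_cylinder[OF ind pB, of F "E - F"] that finE rev_finite_subset[OF finE that] by auto
  qed
  have U: "{\<omega> \<in> space M. P (G \<omega>)} = (\<Union>F\<in>{F\<in>Pow E. P F}. {\<omega> \<in> space M. G \<omega> = F})"
    using GE by auto
  show "{\<omega> \<in> space M. P (G \<omega>)} \<in> events"
    unfolding U using finE cyl by (intro sets.finite_UN) auto
  have "prob {\<omega> \<in> space M. P (G \<omega>)} = (\<Sum>F\<in>{F\<in>Pow E. P F}. prob {\<omega> \<in> space M. G \<omega> = F})"
    unfolding U using finE cyl by (intro finite_measure_finite_Union) (auto simp: disjoint_family_on_def)
  also have "\<dots> = (\<Sum>F\<in>{F\<in>Pow E. P F}. p ^ card F * (1 - p) ^ card (E - F))"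
    using cyl by (intro sum.cong refl) auto
  also have "\<dots> = bexp p E (\<lambda>F. of_bool (P F))"
    unfolding bexp_def using finE by (intro sum.mono_neutral_cong_left) auto
  finally show "prob {\<omega> \<in> space M. P (G \<omega>)} = bexp p (complete_multipartite_edges m V) (\<lambda>F. of_bool (P F))"
    by (simp add: E_def)
qed

end

section \<open>Almost sure bounds for the energy\<close>

lemma powr_three_halves: "x \<ge> 0 \<Longrightarrow> x powr (3/2) = x * sqrt x" for x :: real
proof (cases "x = 0")
  case False
  assume "x \<ge> 0"
  then have "x powr (1 + 1/2) = x * sqrt x"
    using False by (subst powr_add) (simp add: powr_half_sqrt)
  then show ?thesis by simp
qed simp

lemma fourth_root_power: "x > 0 \<Longrightarrow> (x ^ 4) powr (1/4) = x" for x :: real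
proof -
  assume x: "x > 0"
  have "(x ^ 4) powr (1/4) = (x powr 4) powr (1/4)" using x by simp
  also have "\<dots> = x powr (4 * (1/4))" by (rule powr_powr)
  finally show ?thesis using x by simp
qed

text \<open>Equivalent to (x - y)^2 (x + 2 y) \<ge> 0 for the square roots x and y; it bounds the
  left-hand side of the claim when one part has N vertices.\<close>

lemma three_halves_power_diff_le:
  fixes n N :: real
  assumes "0 \<le> N" "N \<le> n"
  shows "n * sqrt n - N * sqrt N \<le> 3/2 * ((n - N) * sqrt n)"
proof -
  define x where "x = sqrt n"
  define y where "y = sqrt N"
  have xy: "x \<ge> 0" "y \<ge> 0" using assms by (auto simp: x_def y_def)
  have "0 \<le> (x - y)\<^sup>2 * (x + 2 * y)" using xy by simp
  then have "x\<^sup>2 * x - y\<^sup>2 * y \<le> 3/2 * ((x\<^sup>2 - y\<^sup>2) * x)"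
    by (simp add: power2_eq_square algebra_simps)
  then show ?thesis using assms by (simp add: x_def y_def)
qed

text \<open>A single summable \<open>q\<close> serves all admissible partitions of n vertices, as
  Borel-Cantelli requires when the partition varies with n.\<close>

lemma energy_tail:
  fixes p \<delta> :: real
  assumes p: "0 < p" "p < 1" and \<delta>: "\<delta> > 0"
  defines "c \<equiv> 8 / (3 * pi) * sqrt (p * (1 - p))"
  obtains N0 and \<epsilon> :: real and q :: "nat \<Rightarrow> real" where "\<epsilon> > 0" "summable q"
    and "\<And>(I :: 'v set) (L :: 'l set) V R.
      vertex_partition I L V \<Longrightarrow> card I \<ge> N0 \<Longrightarrow> R \<subseteq> L \<Longrightarrow> card L \<ge> 2 \<Longrightarrow> \<forall>i\<in>L. V i \<noteq> {} \<Longrightarrow>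
      \<forall>i\<in>R. card (V i) \<ge> N0 \<Longrightarrow> \<forall>i\<in>L - R. real (card (V i)) \<le> \<epsilon> * card I \<Longrightarrow>
      bexp p (vertex_partition.edges I L V) (\<lambda>F. of_bool (\<not>
        ((card I * sqrt (card I) - (\<Sum>i\<in>R. card (V i) * sqrt (card (V i)))) * (c - \<delta>) \<le> trace_norm I (adj F) \<and>
         trace_norm I (adj F) \<le> (card I * sqrt (card I) + (\<Sum>i\<in>R. card (V i) * sqrt (card (V i)))) * (c + \<delta>))))
      \<le> q (card I)"
proof -
  define s where "s = p * (1 - p)"
  have s: "s > 0" using p by (simp add: s_def)
  have c: "c > 0" using s by (simp add: c_def s_def)
  \<comment> \<open>With Q = n^(3/2) and Z the sum over the large parts: if none of these exceeds
    9/10 n, then Q - Z \<ge> \<kappa> Q, and the additive error 2 d Q = \<delta> \<kappa> Q is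
    absorbed by the slack \<delta> (Q - Z).\<close>
  define \<kappa> where "\<kappa> = 1 - sqrt (9/10 :: real)"
  have \<kappa>: "\<kappa> > 0" "\<kappa> \<le> 1" by (auto simp: \<kappa>_def)
  define d where "d = \<delta> * \<kappa> / 2"
  have d: "d > 0" using \<delta> \<kappa> by (simp add: d_def)
  have d2: "2 * d \<le> \<delta>" using \<delta> \<kappa> by (simp add: d_def mult_left_le)
  obtain N1 and \<epsilon> :: real where \<epsilon>: "\<epsilon> > 0" and N1: "\<And>(I :: 'v set) (L :: 'l set) V R.
      vertex_partition I L V \<Longrightarrow> card I \<ge> N1 \<Longrightarrow> R \<subseteq> L \<Longrightarrow> \<forall>i\<in>R. card (V i) \<ge> N1 \<Longrightarrow>
      \<forall>i\<in>L - R. real (card (V i)) \<le> \<epsilon> * card I \<Longrightarrow>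
      \<bar>bexp p (vertex_partition.edges I L V) (\<lambda>F. trace_norm I (adj F)) - c * (card I * sqrt (card I))\<bar>
        \<le> c * (\<Sum>i\<in>R. card (V i) * sqrt (card (V i))) + d * (card I * sqrt (card I))"
    by (rule expected_energy_multipartite[OF p d, folded c_def]) (rule that)
  define q :: "nat \<Rightarrow> real" where "q n = 2 * exp (- (d\<^sup>2 * n) / 16) + exp (- (s * real n powr (1/4)) / 1600)
    + (2 * sqrt n * exp (- (s\<^sup>2 * sqrt n) / 250) + exp (- (s\<^sup>2 * n) / 500))" for n
  have sq: "summable q"
  proof (rule summable_comparison_test_bigo)
    show "summable (\<lambda>n. norm (1 / real n ^ 2))"
      using inverse_power_summable[of 2, where 'a = real] by (simp add: inverse_eq_divide)
    have "(\<lambda>n. exp (- (d\<^sup>2 * real n) / 16)) \<in> O(\<lambda>n. 1 / real n ^ 2)" using d by real_asymp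
    moreover have "(\<lambda>n. exp (- (s * real n powr (1/4)) / 1600)) \<in> O(\<lambda>n. 1 / real n ^ 2)" using s by real_asymp
    moreover have "(\<lambda>n. 2 * sqrt (real n) * exp (- (s\<^sup>2 * sqrt (real n)) / 250)) \<in> O(\<lambda>n. 1 / real n ^ 2)" using s by real_asymp
    moreover have "(\<lambda>n. exp (- (s\<^sup>2 * real n) / 500)) \<in> O(\<lambda>n. 1 / real n ^ 2)" using s by real_asymp
    ultimately show "q \<in> O(\<lambda>n. 1 / real n ^ 2)"
      unfolding q_def[abs_def] by (intro sum_in_bigo) auto
  qed
  \<comment> \<open>10/s^2 and (400/s)^4 secure the hypotheses of \<open>many_outside_tail\<close>
    once k \<ge> n^(1/4).\<close>
  define N0 where "N0 = N1 + nat \<lceil>10 / s\<^sup>2\<rceil> + nat \<lceil>(400 / s) ^ 4\<rceil> + 1"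
  have main: "bexp p (vertex_partition.edges I L V) (\<lambda>F. of_bool (\<not>
        ((card I * sqrt (card I) - (\<Sum>i\<in>R. card (V i) * sqrt (card (V i)))) * (c - \<delta>) \<le> trace_norm I (adj F) \<and>
         trace_norm I (adj F) \<le> (card I * sqrt (card I) + (\<Sum>i\<in>R. card (V i) * sqrt (card (V i)))) * (c + \<delta>))))
      \<le> q (card I)"
    if vp: "vertex_partition I L V" and I: "card I \<ge> N0" and RL: "R \<subseteq> L" and L2: "card L \<ge> 2"
      and Vne: "\<forall>i\<in>L. V i \<noteq> {}" and R: "\<forall>i\<in>R. card (V i) \<ge> N0"
      and nR: "\<forall>i\<in>L - R. real (card (V i)) \<le> \<epsilon> * card I" for I :: "'v set" and L :: "'l set" and V R
  proof -
    interpret vertex_partition I L V by fact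
    define n where "n = real (card I)"
    have n1: "n \<ge> 1" using I unfolding N0_def n_def by simp
    define Q where "Q = n * sqrt n"
    have Q: "Q > 0" using n1 by (simp add: Q_def)
    define v where "v i = real (card (V i))" for i
    define Z where "Z = (\<Sum>i\<in>R. v i * sqrt (v i))"
    have sv: "(\<Sum>i\<in>L. v i) = n" using sum_card_V by (simp add: v_def n_def flip: of_nat_sum)
    have v0: "v i \<ge> 0" for i by (simp add: v_def)
    have vn: "v i \<le> n" if "i \<in> L" for i
      using V_subset[OF that] finI by (simp add: v_def n_def card_mono)
    have svR: "(\<Sum>i\<in>R. v i) \<le> n"
      unfolding sv[symmetric] using finL RL v0 by (intro sum_mono2) auto
    have Z0: "Z \<ge> 0" unfolding Z_def using v0 by (intro sum_nonneg) simp
    have ZQ: "Z \<le> Q"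
      unfolding Z_def Q_def using RL vn v0 n1 svR by (intro sum_pow32_le) auto
    define T where "T F = trace_norm I (adj F)" for F
    define X where "X = bexp p edges T"
    have X: "\<bar>X - c * Q\<bar> \<le> c * Z + d * Q"
    proof -
      have "card I \<ge> N1" "\<forall>i\<in>R. card (V i) \<ge> N1" using I R by (auto simp: N0_def)
      from N1[OF vp this(1) RL this(2) nR]
      show ?thesis by (simp add: X_def T_def[abs_def] Q_def n_def Z_def v_def)
    qed
    have S: "real (4 * card edges) \<le> 4 * n\<^sup>2" "4 * n\<^sup>2 > 0"
    proof -
      have "card edges \<le> (card I)\<^sup>2"
        using card_mono[OF finite_all_edges[OF finI] edges_subset] card_all_edges_le[OF finI] by linarith
      then have "real (card edges) \<le> (real (card I))\<^sup>2" by (metis of_nat_le_iff of_nat_power)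
      then show "real (4 * card edges) \<le> 4 * n\<^sup>2" by (simp add: n_def)
      show "4 * n\<^sup>2 > 0" using n1 by simp
    qed
    have dQ: "d * Q \<ge> 0" using d Q by simp
    have e: "- (d * Q)\<^sup>2 / (4 * (4 * n\<^sup>2)) = - (d\<^sup>2 * n) / 16"
      using n1 by (simp add: Q_def power_mult_distrib power2_eq_square)
    have up: "bexp p edges (\<lambda>F. of_bool (T F \<ge> X + d * Q)) \<le> exp (- (d\<^sup>2 * n) / 16)"
      using trace_norm_adj_upper_tail[OF p S dQ] unfolding e by (simp add: T_def[abs_def] X_def)
    have low: "bexp p edges (\<lambda>F. of_bool (T F \<le> X - d * Q)) \<le> exp (- (d\<^sup>2 * n) / 16)"
      using trace_norm_adj_lower_tail[OF p S dQ] unfolding e by (simp add: T_def[abs_def] X_def)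
    have upper: "T F \<le> (Q + Z) * (c + \<delta>)" if "T F < X + d * Q" for F
    proof -
      have "2 * d * Q \<le> \<delta> * Q" using d2 Q by (intro mult_right_mono) auto
      moreover have "0 \<le> \<delta> * Z" using \<delta> Z0 by simp
      ultimately show ?thesis using that X by (simp add: algebra_simps)
    qed
    have "bexp p edges (\<lambda>F. of_bool (\<not> ((Q - Z) * (c - \<delta>) \<le> T F \<and> T F \<le> (Q + Z) * (c + \<delta>)))) \<le> q (card I)"
    proof (cases "\<forall>i\<in>R. v i \<le> 9/10 * n")
      case True
      have "Z \<le> n * sqrt (9/10 * n)"
        unfolding Z_def using True v0 n1 svR by (intro sum_pow32_le) auto
      also have "\<dots> = (1 - \<kappa>) * Q" unfolding real_sqrt_mult Q_def \<kappa>_def by simp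
      finally have ZK: "\<kappa> * Q \<le> Q - Z" by (simp add: algebra_simps)
      have lower: "(Q - Z) * (c - \<delta>) \<le> T F" if "T F > X - d * Q" for F
      proof -
        have "2 * (d * Q) = \<delta> * (\<kappa> * Q)" by (simp add: d_def)
        also have "\<dots> \<le> \<delta> * (Q - Z)" using ZK \<delta> by (intro mult_left_mono) auto
        finally show ?thesis using that X by (simp add: algebra_simps)
      qed
      have "bexp p edges (\<lambda>F. of_bool (\<not> ((Q - Z) * (c - \<delta>) \<le> T F \<and> T F \<le> (Q + Z) * (c + \<delta>))) :: real)
          \<le> bexp p edges (\<lambda>F. of_bool (T F \<ge> X + d * Q) + of_bool (T F \<le> X - d * Q))"
      proof (rule bexp_mono[OF p])
        fix F
        show "of_bool (\<not> ((Q - Z) * (c - \<delta>) \<le> T F \<and> T F \<le> (Q + Z) * (c + \<delta>)))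
            \<le> (of_bool (T F \<ge> X + d * Q) + of_bool (T F \<le> X - d * Q) :: real)"
          using upper[of F] lower[of F] by (cases "T F \<ge> X + d * Q"; cases "T F \<le> X - d * Q") auto
      qed
      also have "\<dots> \<le> exp (- (d\<^sup>2 * n) / 16) + exp (- (d\<^sup>2 * n) / 16)"
        unfolding bexp_add by (intro add_mono up low)
      also have "\<dots> \<le> q (card I)" by (simp add: q_def n_def)
      finally show ?thesis .
    next
      case False
      then obtain i where i: "i \<in> R" "v i > 9/10 * n" by auto
      have iL: "i \<in> L" using i RL by auto
      \<comment> \<open>A second non-empty part makes the complement of \<open>V i\<close>
        non-empty, so that k \<ge> 1.\<close>
      have "L \<noteq> {i}" using L2 by auto
      then obtain j where j: "j \<in> L" "j \<noteq> i" using iL by blast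
      obtain y where y: "y \<in> V j" using Vne j by blast
      interpret bp: big_part I "V i" edges p
      proof
        show "finite I" "V i \<subseteq> I" "edges \<subseteq> all_edges I" "0 < p" "p < 1"
          by (rule finI V_subset[OF iL] edges_subset p)+
        show "edges \<inter> all_edges (V i) = {}" using iL by (auto simp: edges_def)
        show "V i \<noteq> {}" using Vne iL by blast
        show "I - V i \<noteq> {}" using y j V_subset[OF j(1)] part_unique[OF j(1) iL y] by blast
        fix w x assume "w \<in> I - V i" "x \<in> V i"
        then show "{w, x} \<in> edges"
          using V_subset[OF iL] part_unique[OF _ iL] unfolding edges_def
          by (auto simp: doubleton_mem_all_edges)
      qed
      have bs: "bp.s = s" and bn: "bp.n = n" and bN: "bp.N = v i"
        by (simp_all add: bp.s_def s_def bp.n_def n_def bp.N_def v_def)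
      define k where "k = bp.k"
      have k1: "k \<ge> 1" and nk: "n = k + v i" using bp.pos by (simp_all add: k_def bn bN)
      have N9: "bp.N \<ge> 9/10 * bp.n" using i by (simp add: bn bN)
      \<comment> \<open>3/2 times the constant 8/(3 pi) is 4/pi, and pi > 3 turns it into the
        threshold 4/3 of the two tail bounds.\<close>
      have lower: "(Q - Z) * (c - \<delta>) \<le> T F" if "T F > 4/3 * (k * sqrt (s * n))" for F
      proof -
        have "v i * sqrt (v i) \<le> Z"
          unfolding Z_def using i v0 finite_subset[OF RL finL] by (intro member_le_sum) auto
        then have "Q - Z \<le> n * sqrt n - v i * sqrt (v i)" by (simp add: Q_def)
        also have "\<dots> \<le> 3/2 * ((n - v i) * sqrt n)"
          using vn[OF iL] v0 by (intro three_halves_power_diff_le)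
        finally have QZ: "Q - Z \<le> 3/2 * (k * sqrt n)" using nk by simp
        have "(Q - Z) * (c - \<delta>) \<le> (Q - Z) * c" using ZQ \<delta> by (intro mult_left_mono) auto
        also have "\<dots> \<le> 3/2 * (k * sqrt n) * c" using QZ c by (intro mult_right_mono) auto
        also have "\<dots> = 4 / pi * (k * sqrt (s * n))"
          unfolding c_def s_def[symmetric] by (simp add: real_sqrt_mult)
        also have "\<dots> \<le> 4 / 3 * (k * sqrt (s * n))"
          using pi_gt3 k1 s n1 by (intro mult_right_mono divide_left_mono) auto
        finally show ?thesis using that by linarith
      qed
      have tail: "bexp p edges (\<lambda>F. of_bool (T F \<le> 4/3 * (k * sqrt (s * n))))
          \<le> exp (- (s * n powr (1/4)) / 1600) + (2 * sqrt n * exp (- (s\<^sup>2 * sqrt n) / 250) + exp (- (s\<^sup>2 * n) / 500))"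
      \<comment> \<open>At k = n^(1/4) both exponents, of order s k and s^2 n/k^2, are still powers
        of n.\<close>
      proof (cases "n \<le> k ^ 4")
        case True
        have "n powr (1/4) \<le> (k ^ 4) powr (1/4)" using True n1 by (intro powr_mono2) auto
        also have "\<dots> = k" using k1 by (intro fourth_root_power) simp
        finally have k4: "n powr (1/4) \<le> k" .
        have "(400 / s) ^ 4 \<le> n" using I unfolding N0_def n_def by linarith
        then have "((400 / s) ^ 4) powr (1/4) \<le> n powr (1/4)" using s by (intro powr_mono2) auto
        moreover have "((400 / s) ^ 4) powr (1/4) = 400 / s" using s by (intro fourth_root_power) simp
        ultimately have "400 / s \<le> k" using k4 by linarith
        then have sk: "s * k \<ge> 400" using s by (simp add: field_simps)
        have "10 / s\<^sup>2 \<le> n" using I unfolding N0_def n_def by linarith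
        then have sn: "s\<^sup>2 * n \<ge> 10" using s by (simp add: field_simps)
        have "bexp p edges (\<lambda>F. of_bool (T F \<le> 4/3 * (k * sqrt (s * n)))) \<le> exp (- (s * k) / 1600)"
          using bp.many_outside_tail[OF N9] sk sn by (simp add: T_def k_def bs bn)
        also have "\<dots> \<le> exp (- (s * n powr (1/4)) / 1600)"
          using k4 s by (simp add: mult_left_mono)
        also have "\<dots> \<le> exp (- (s * n powr (1/4)) / 1600) + (2 * sqrt n * exp (- (s\<^sup>2 * sqrt n) / 250) + exp (- (s\<^sup>2 * n) / 500))"
          using n1 by simp
        finally show ?thesis .
      next
        case False
        have k2: "k\<^sup>2 \<le> sqrt n"
          using False by (intro real_le_rsqrt) (simp flip: power_mult)
        have "sqrt n * k\<^sup>2 \<le> sqrt n * sqrt n" using k2 n1 by (intro mult_left_mono) auto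
        then have "sqrt n \<le> n / k\<^sup>2" using k1 n1 by (simp add: pos_le_divide_eq)
        then have "s\<^sup>2 * sqrt n \<le> s\<^sup>2 * (n / k\<^sup>2)" by (intro mult_left_mono) auto
        then have ex: "- (s\<^sup>2 * n) / (250 * k\<^sup>2) \<le> - (s\<^sup>2 * sqrt n) / 250" by simp
        have "bexp p edges (\<lambda>F. of_bool (T F \<le> 4/3 * (k * sqrt (s * n))))
            \<le> 2 * k\<^sup>2 * exp (- (s\<^sup>2 * n) / (250 * k\<^sup>2)) + exp (- (s\<^sup>2 * n) / 500)"
          using bp.few_outside_tail[OF N9] by (simp add: T_def k_def bs bn)
        also have "\<dots> \<le> 2 * sqrt n * exp (- (s\<^sup>2 * sqrt n) / 250) + exp (- (s\<^sup>2 * n) / 500)"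
          using k2 ex n1 by (intro add_mono mult_mono) auto
        also have "\<dots> \<le> exp (- (s * n powr (1/4)) / 1600) + (2 * sqrt n * exp (- (s\<^sup>2 * sqrt n) / 250) + exp (- (s\<^sup>2 * n) / 500))"
          by simp
        finally show ?thesis .
      qed
      have "bexp p edges (\<lambda>F. of_bool (\<not> ((Q - Z) * (c - \<delta>) \<le> T F \<and> T F \<le> (Q + Z) * (c + \<delta>))) :: real)
          \<le> bexp p edges (\<lambda>F. of_bool (T F \<ge> X + d * Q) + of_bool (T F \<le> 4/3 * (k * sqrt (s * n))))"
      proof (rule bexp_mono[OF p])
        fix F
        show "of_bool (\<not> ((Q - Z) * (c - \<delta>) \<le> T F \<and> T F \<le> (Q + Z) * (c + \<delta>)))
            \<le> (of_bool (T F \<ge> X + d * Q) + of_bool (T F \<le> 4/3 * (k * sqrt (s * n))) :: real)"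
          using upper[of F] lower[of F] by (cases "T F \<ge> X + d * Q"; cases "T F \<le> 4/3 * (k * sqrt (s * n))") auto
      qed
      also have "\<dots> \<le> exp (- (d\<^sup>2 * n) / 16) + (exp (- (s * n powr (1/4)) / 1600)
          + (2 * sqrt n * exp (- (s\<^sup>2 * sqrt n) / 250) + exp (- (s\<^sup>2 * n) / 500)))"
        unfolding bexp_add by (intro add_mono up tail)
      also have "\<dots> \<le> q (card I)" by (simp add: q_def n_def)
      finally show ?thesis .
    qed
    then show ?thesis by (simp add: Q_def Z_def n_def v_def T_def)
  qed
  show ?thesis by (rule that[OF \<epsilon> sq main])
qed

text \<open>Both inequalities must hold exactly with one sequence. \<open>b n\<close> is the point
  nearest to \<open>c\<close> among the admissible normalisers, the interval from X/Y to X/U; the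
  bounds for every tolerance say that this interval comes arbitrarily close to
  \<open>c\<close>.\<close>

lemma normalising_constant:
  fixes X U Y :: "nat \<Rightarrow> real"
  assumes c: "c > 0"
    and ev: "\<forall>\<^sub>F n in sequentially. 0 \<le> U n \<and> U n \<le> Y n \<and> 0 < Y n \<and> 0 \<le> X n"
    and lim: "\<And>j::nat. \<forall>\<^sub>F n in sequentially. U n * (c - 1 / (real j + 1)) \<le> X n \<and> X n \<le> Y n * (c + 1 / (real j + 1))"
  shows "\<exists>\<epsilon>. \<epsilon> \<longlonglongrightarrow> 0 \<and>
    (\<forall>\<^sub>F n in sequentially. U n \<le> X n * inverse (c + \<epsilon> n) \<and> X n * inverse (c + \<epsilon> n) \<le> Y n)"
proof -
  \<comment> \<open>U may be 0; since X \<ge> 0 that falls into the first branch, where only Y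
    divides.\<close>
  define b where "b n = (if U n * c \<le> X n then max c (X n / Y n) else X n / U n)" for n
  have close: "\<forall>\<^sub>F n in sequentially. \<bar>b n - c\<bar> \<le> 1 / (real j + 1)" for j :: nat
    using ev lim[of j]
  proof eventually_elim
    case (elim n)
    show ?case
    proof (cases "U n * c \<le> X n")
      case True
      have "X n / Y n \<le> c + 1 / (real j + 1)" using elim by (simp add: pos_divide_le_eq mult.commute[of _ "Y n"])
      then show ?thesis using True by (simp add: b_def max_def)
    next
      case False
      then have U: "U n > 0" using elim by (cases "U n = 0") auto
      have "c - 1 / (real j + 1) \<le> X n / U n" using elim U by (simp add: pos_le_divide_eq mult.commute[of _ "U n"])
      moreover have "X n / U n \<le> c" using False U by (simp add: pos_divide_le_eq mult.commute[of _ "U n"])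
      ultimately show ?thesis using False by (simp add: b_def)
    qed
  qed
  have "(\<lambda>n. b n - c) \<longlonglongrightarrow> 0"
  proof (rule tendstoI)
    fix e :: real assume "e > 0"
    then obtain j :: nat where "1 / (real j + 1) < e" using nat_approx_posE[of e] by (auto simp: add.commute)
    with close[of j] show "\<forall>\<^sub>F n in sequentially. dist (b n - c) 0 < e"
      by (auto elim!: eventually_mono simp: dist_real_def)
  qed
  moreover from tendstoD[OF this, of c] c have "\<forall>\<^sub>F n in sequentially. b n > 0"
    by (auto elim!: eventually_mono simp: dist_real_def)
  with ev have "\<forall>\<^sub>F n in sequentially. U n \<le> X n * inverse (c + (b n - c)) \<and> X n * inverse (c + (b n - c)) \<le> Y n"
  proof eventually_elim
    case (elim n)
    have "U n * b n \<le> X n \<and> X n \<le> Y n * b n"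
    proof (cases "U n * c \<le> X n")
      case True
      have "U n * (X n / Y n) \<le> Y n * (X n / Y n)" using elim by (intro mult_right_mono) auto
      then have "U n * (X n / Y n) \<le> X n" using elim by simp
      moreover have "X n / Y n \<le> b n" using True by (simp add: b_def)
      then have "X n \<le> Y n * b n" using elim by (simp add: pos_divide_le_eq mult.commute[of _ "Y n"])
      ultimately show ?thesis using True by (auto simp: b_def max_def)
    next
      case False
      then have U: "U n > 0" using elim by (cases "U n = 0") auto
      have b: "b n = X n / U n" using False by (simp add: b_def)
      have "U n * b n = X n" using U b by simp
      moreover have "U n * b n \<le> Y n * b n" using elim by (intro mult_right_mono) auto
      ultimately show ?thesis by simp
    qed
    then show ?case using elim by (simp add: field_simps)
  qed
  ultimately show ?thesis by blast
qed

theorem theorem4: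
  fixes M :: "'a measure"
    and p :: real
    and r :: nat
    and m :: "nat \<Rightarrow> nat"
    and V :: "nat \<Rightarrow> nat \<Rightarrow> nat set"
    and \<nu> :: "nat \<Rightarrow> nat \<Rightarrow> real"
    and G :: "nat \<Rightarrow> 'a \<Rightarrow> nat set set"
  assumes "prob_space M"
    and "0 < p" and "p < 1"
    and "r \<ge> 1"
    and "\<forall>\<^sub>F n in sequentially. m n \<ge> 2 \<and> r \<le> m n"
    and "\<forall>\<^sub>F n in sequentially. indexed_partition {1..n} (m n) (V n)"
    and "\<forall>\<^sub>F n in sequentially. \<forall>i \<in> {1..m n}. real (card (V n i)) = real n * \<nu> n i"
    and "\<forall>i \<in> {1..r}. (\<lambda>n. real (card (V n i))) \<in> \<Theta>(\<lambda>n. real n)"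
    and "\<forall>\<epsilon>>0. \<forall>\<^sub>F n in sequentially. \<forall>i \<in> {r+1..m n}. real (card (V n i)) \<le> \<epsilon> * real n"
    and "\<forall>\<^sub>F n in sequentially. random_multipartite_graph M (m n) (V n) p (G n)"
  shows "AE \<omega> in M. \<exists>\<epsilon> :: nat \<Rightarrow> real. \<epsilon> \<longlonglongrightarrow> 0 \<and>
    (\<forall>\<^sub>F n in sequentially.
       (1 - (\<Sum>i = 1..r. \<nu> n i powr (3/2))) * real n powr (3/2)
         \<le> graph_energy n (G n \<omega>) * inverse (8 / (3 * pi) * sqrt (p * (1 - p)) + \<epsilon> n) \<and>
       graph_energy n (G n \<omega>) * inverse (8 / (3 * pi) * sqrt (p * (1 - p)) + \<epsilon> n)
         \<le> (1 + (\<Sum>i = 1..r. \<nu> n i powr (3/2))) * real n powr (3/2))"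
proof -
  interpret prob_space M by fact
  note p = assms(2,3)
  define c where "c = 8 / (3 * pi) * sqrt (p * (1 - p))"
  have c: "c > 0" using p by (simp add: c_def)
  define Q where "Q n = real n * sqrt (real n)" for n
  define Z where "Z n = (\<Sum>i\<in>{1..r}. card (V n i) * sqrt (card (V n i)))" for n
  have reg: "\<forall>\<^sub>F n in sequentially. m n \<ge> 2 \<and> r \<le> m n \<and> indexed_partition {1..n} (m n) (V n) \<and>
      random_multipartite_graph M (m n) (V n) p (G n) \<and> n \<ge> 1"
    using assms(5,6,10) eventually_ge_at_top[of 1] by eventually_elim auto
  have big: "\<forall>\<^sub>F n in sequentially. \<forall>i\<in>{1..r}. card (V n i) \<ge> N0" for N0
  proof (rule eventually_ball_finite[rule_format])
    fix i assume "i \<in> {1..r}"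
    then have "(\<lambda>n. real (card (V n i))) \<in> \<Omega>(\<lambda>n. real n)" using assms(8) by (simp add: bigtheta_def)
    then obtain a where a: "a > 0" "\<forall>\<^sub>F n in sequentially. norm (real (card (V n i))) \<ge> a * norm (real n)"
      by (rule landau_omega.bigE)
    have "filterlim (\<lambda>n. a * real n) at_top sequentially"
      using a by (intro filterlim_tendsto_pos_mult_at_top[OF tendsto_const] filterlim_real_sequentially) auto
    then have "\<forall>\<^sub>F n in sequentially. a * real n \<ge> real N0" by (simp add: filterlim_at_top)
    with a(2) show "\<forall>\<^sub>F n in sequentially. card (V n i) \<ge> N0" by eventually_elim simp
  qed simp
  have ZQ: "0 \<le> Z n \<and> Z n \<le> Q n" if "indexed_partition {1..n} (m n) (V n)" "r \<le> m n" for n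
  proof -
    interpret vertex_partition "{1..n}" "{1..m n}" "V n"
      using that by (intro vertex_partition_of_indexed_partition) auto
    have R: "{1..r} \<subseteq> {1..m n}" using that by auto
    have "(\<Sum>i\<in>{1..r}. real (card (V n i))) \<le> (\<Sum>i\<in>{1..m n}. real (card (V n i)))"
      using R by (intro sum_mono2) auto
    also have "\<dots> = real n" using sum_card_V by (simp flip: of_nat_sum)
    finally have "(\<Sum>i\<in>{1..r}. real (card (V n i))) \<le> real n" .
    moreover have "card (V n i) \<le> n" if "i \<in> {1..r}" for i
      using card_mono[OF finI V_subset[of i]] R that by auto
    ultimately show ?thesis
      unfolding Z_def Q_def by (auto intro!: sum_pow32_le sum_nonneg)
  qed
  \<comment> \<open>Countably many tolerances are treated separately so that their exceptional null
    sets can be united.\<close>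
  have "AE \<omega> in M. \<forall>\<^sub>F n in sequentially. (Q n - Z n) * (c - 1 / (real j + 1)) \<le> graph_energy n (G n \<omega>) \<and>
      graph_energy n (G n \<omega>) \<le> (Q n + Z n) * (c + 1 / (real j + 1))" for j :: nat
  proof -
    define \<delta> where "\<delta> = 1 / (real j + 1)"
    have \<delta>: "\<delta> > 0" by (simp add: \<delta>_def)
    define good where "good n F \<longleftrightarrow> (Q n - Z n) * (c - \<delta>) \<le> trace_norm {1..n} (adj F) \<and>
      trace_norm {1..n} (adj F) \<le> (Q n + Z n) * (c + \<delta>)" for n F
    obtain N0 and \<epsilon> :: real and q :: "nat \<Rightarrow> real" where \<epsilon>: "\<epsilon> > 0" and q: "summable q"
      and tail: "\<And>(I :: nat set) (L :: nat set) V R.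
      vertex_partition I L V \<Longrightarrow> card I \<ge> N0 \<Longrightarrow> R \<subseteq> L \<Longrightarrow> card L \<ge> 2 \<Longrightarrow> \<forall>i\<in>L. V i \<noteq> {} \<Longrightarrow>
      \<forall>i\<in>R. card (V i) \<ge> N0 \<Longrightarrow> \<forall>i\<in>L - R. real (card (V i)) \<le> \<epsilon> * card I \<Longrightarrow>
      bexp p (vertex_partition.edges I L V) (\<lambda>F. of_bool (\<not>
        ((card I * sqrt (card I) - (\<Sum>i\<in>R. card (V i) * sqrt (card (V i)))) * (c - \<delta>) \<le> trace_norm I (adj F) \<and>
         trace_norm I (adj F) \<le> (card I * sqrt (card I) + (\<Sum>i\<in>R. card (V i) * sqrt (card (V i)))) * (c + \<delta>))))
      \<le> q (card I)"
      by (rule energy_tail[OF p \<delta>, folded c_def]) (rule that)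
    \<comment> \<open>The default {} at indices where the eventual hypotheses may still fail makes
      every \<open>B n\<close> an event.\<close>
    define B where "B n = (if random_multipartite_graph M (m n) (V n) p (G n) \<and> indexed_partition {1..n} (m n) (V n)
      then {\<omega> \<in> space M. \<not> good n (G n \<omega>)} else {})" for n
    have fin: "finite (complete_multipartite_edges (m n) (V n))" if "indexed_partition {1..n} (m n) (V n)" for n
      using vertex_partition.finite_edges[OF vertex_partition_of_indexed_partition(1)[OF _ that]]
        vertex_partition_of_indexed_partition(2)[OF _ that] by simp
    have Bev: "B n \<in> events" for n
      unfolding B_def using random_graph_prob(1)[of "m n" "V n" p "G n" "\<lambda>F. \<not> good n F"] fin by auto
    have small: "\<forall>\<^sub>F n in sequentially. \<forall>i\<in>{r+1..m n}. real (card (V n i)) \<le> \<epsilon> * real n"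
      using assms(9) \<epsilon> by blast
    have "\<forall>\<^sub>F n in sequentially. norm (prob (B n)) \<le> q n"
      using reg big[of N0] small eventually_ge_at_top[of N0]
    proof eventually_elim
      case (elim n)
      have vp: "vertex_partition {1..n} {1..m n} (V n)" and ne: "\<forall>i\<in>{1..m n}. V n i \<noteq> {}"
        and E: "complete_multipartite_edges (m n) (V n) = vertex_partition.edges {1..n} {1..m n} (V n)"
        by (rule vertex_partition_of_indexed_partition[OF finite_atLeastAtMost], use elim in blast)+
      have "prob (B n) = bexp p (complete_multipartite_edges (m n) (V n)) (\<lambda>F. of_bool (\<not> good n F))"
        unfolding B_def using random_graph_prob(2)[of "m n" "V n" p "G n" "\<lambda>F. \<not> good n F"] fin elim by simp
      also have "\<dots> \<le> q n"
      proof -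
        have "card {1..n} \<ge> N0" "{1..r} \<subseteq> {1..m n}" "card {1..m n} \<ge> 2" using elim by auto
        moreover have "\<forall>i\<in>{1..r}. card (V n i) \<ge> N0" using elim by blast
        moreover have "\<forall>i\<in>{1..m n} - {1..r}. real (card (V n i)) \<le> \<epsilon> * card {1..n}" using elim by auto
        ultimately show ?thesis
          using tail[OF vp, of "{1..r}"] ne unfolding E good_def Q_def Z_def by simp
      qed
      finally show ?case by simp
    qed
    then have "summable (\<lambda>n. prob (B n))" using q by (rule summable_comparison_test_ev)
    then have "AE \<omega> in M. \<forall>\<^sub>F n in sequentially. \<omega> \<in> space M - B n"
      using Bev by (intro borel_cantelli_AE1) (auto simp: emeasure_eq_measure)
    then show ?thesis
    proof eventually_elim
      case (elim \<omega>)
      from elim reg show ?case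
        by eventually_elim (auto simp: B_def good_def graph_energy_eq_trace_norm \<delta>_def)
    qed
  qed
  then have "AE \<omega> in M. \<forall>j::nat. \<forall>\<^sub>F n in sequentially. (Q n - Z n) * (c - 1 / (real j + 1)) \<le> graph_energy n (G n \<omega>) \<and>
      graph_energy n (G n \<omega>) \<le> (Q n + Z n) * (c + 1 / (real j + 1))"
    by (simp add: AE_all_countable)
  then show ?thesis
  proof eventually_elim
    case (elim \<omega>)
    have "\<exists>\<epsilon>. \<epsilon> \<longlonglongrightarrow> 0 \<and> (\<forall>\<^sub>F n in sequentially. Q n - Z n \<le> graph_energy n (G n \<omega>) * inverse (c + \<epsilon> n) \<and>
        graph_energy n (G n \<omega>) * inverse (c + \<epsilon> n) \<le> Q n + Z n)"
    proof (rule normalising_constant[OF c])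
      show "\<forall>\<^sub>F n in sequentially. 0 \<le> Q n - Z n \<and> Q n - Z n \<le> Q n + Z n \<and> 0 < Q n + Z n \<and> 0 \<le> graph_energy n (G n \<omega>)"
        using reg
      proof eventually_elim
        case (elim n)
        then have "0 \<le> Z n" "Z n \<le> Q n" using ZQ by auto
        moreover have "Q n > 0" using elim by (simp add: Q_def)
        ultimately show ?case by (simp add: graph_energy_eq_trace_norm trace_norm_nonneg)
      qed
    qed (use elim in auto)
    then obtain \<epsilon> where \<epsilon>: "\<epsilon> \<longlonglongrightarrow> 0" and ev: "\<forall>\<^sub>F n in sequentially. Q n - Z n \<le> graph_energy n (G n \<omega>) * inverse (c + \<epsilon> n) \<and>
        graph_energy n (G n \<omega>) * inverse (c + \<epsilon> n) \<le> Q n + Z n" by blast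
    \<comment> \<open>The part sizes n \<nu> give back the densities, the factor n^(3/2) being
      distributed over the sum.\<close>
    have "\<forall>\<^sub>F n in sequentially. real n powr (3/2) = Q n \<and> (\<Sum>i = 1..r. \<nu> n i powr (3/2)) * real n powr (3/2) = Z n"
      using reg assms(7)
    proof eventually_elim
      case (elim n)
      have "\<nu> n i powr (3/2) * real n powr (3/2) = card (V n i) * sqrt (card (V n i))" if "i \<in> {1..r}" for i
      proof -
        have v: "real (card (V n i)) = real n * \<nu> n i" using elim that by auto
        moreover have "real n > 0" using elim by simp
        ultimately have "\<nu> n i \<ge> 0" by (metis of_nat_0_le_iff zero_le_mult_iff not_le)
        then have "\<nu> n i powr (3/2) * real n powr (3/2) = real (card (V n i)) powr (3/2)"
          unfolding v by (simp add: powr_mult mult.commute)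
        then show ?thesis by (simp add: powr_three_halves)
      qed
      then show ?case by (simp add: Q_def Z_def powr_three_halves sum_distrib_right)
    qed
    with ev have "\<forall>\<^sub>F n in sequentially.
       (1 - (\<Sum>i = 1..r. \<nu> n i powr (3/2))) * real n powr (3/2)
         \<le> graph_energy n (G n \<omega>) * inverse (c + \<epsilon> n) \<and>
       graph_energy n (G n \<omega>) * inverse (c + \<epsilon> n)
         \<le> (1 + (\<Sum>i = 1..r. \<nu> n i powr (3/2))) * real n powr (3/2)"
    proof eventually_elim
      case (elim n)
      then have e: "real n powr (3/2) = Q n" "(\<Sum>i = 1..r. \<nu> n i powr (3/2)) * real n powr (3/2) = Z n" by blast+
      show ?case
        using elim unfolding left_diff_distrib distrib_right mult_1_left e(2) unfolding e(1) by blast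
    qed
    with \<epsilon> show ?case unfolding c_def by blast
  qed
qed

end
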